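(* Let $X$ be a compact complex manifold, $L$ a vector bundle on $X$ and $(E,L,\theta)$ a Hitchin pair on $X$ with $\mathrm{rk}\,E=r$. Let $\mathbb H^2(\mathcal C)$ be the second hypercohomology space of the complex of sheaves $$\mathcal C:\quad0\to\mathcal{E}nd(E)\xrightarrow{[-,\theta]}\mathcal{E}nd(E)\otimes L\xrightarrow{[-,\theta]}\mathcal{E}nd(E)\otimes(L\wedge L)\xrightarrow{[-,\theta]}\cdots$$ (with $\mathcal{E}nd(E)$ in degree $0$). Then the obstructions to deform the Hitchin pair $(E,L,\theta)$ are contained in the kernel of the linear map $$H^2(h_1):\ \mathbb H^2(\mathcal C)\to\bigoplus_{k=1}^rH^1(X,\textstyle\bigodot^kL),\qquad H^2(h_1)([\omega\otimes f])=\bigl[(k\cdot\omega\otimes\mathrm{Tr}(f\theta^{k-1}))_{k=1,\dots,r}\bigr]\ \text{ for }\omega\otimes f\in A_X^{0,1}(\mathcal{E}nd(E)\otimes L).$$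
   Context: **Hitchin pairs.** A Hitchin pair $(E,L,\theta)$ on $X$ consists of holomorphic vector bundles $E$, $L$ on $X$ and $\theta\in H^0(X,\mathcal{E}nd(E)\otimes L)$ with $\theta\wedge\theta=0$ in $H^0(X,\mathcal{E}nd(E)\otimes(L\wedge L))$. $\mathbf{Art}_{\mathbb C}$ is the category of local Artinian $\mathbb C$-algebras with residue field $\mathbb C$; $\mathfrak m_A$ is the maximal ideal of $A$. **Deformations.** A deformation of $(E,L,\theta)$ over $A$ is $(E_A,\theta_A)$, with $E_A$ a locally free $\mathcal O_X\otimes A$-module, flat over $A$, with a morphism $E_A\to E$ inducing $E_A\otimes_A\mathbb C\cong E$, and $\theta_A\in H^0(X\times\mathrm{Spec}\,A,\mathcal{E}nd(E_A)\otimes L\otimes A)$ with $\theta_A\wedge\theta_A=0$ restricting to $\theta$ on the closed fibre. Isomorphisms are $\mathcal O_X\otimes A$-linear isomorphisms $E_A\to E'_A$ reducing to $\mathrm{id}_E$ and mapping $\theta_A$ to $\theta_A'$. $\mathrm{Def}_{(E,L,\theta)}(A)$ is the set of isomorphism classes. **Hypercohomology and the dgla $M$.** $A_X^{0,p}(\mathcal F)$ is the space of global smooth $(0,p)$-forms with values in $\mathcal F$. On $\mathcal{E}nd(E)\otimes\bigwedge^*L$, graded by the degree in $\bigwedge^*L$, $[\phi\otimes h,\psi\otimes l]=[\phi,\psi]\otimes h\wedge l$; this gives the differential $[-,\theta]$ of $\mathcal C$. The dgla $M^n=\bigoplus_{p+q=n}A_X^{0,p}(\mathcal{E}nd(E)\otimes\bigwedge^qL)$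 has $d(\omega\otimes f)=\bar\partial\omega\otimes f+(-1)^{\deg\omega}\omega\otimes[\theta,f]$ and $[\omega\otimes f,\omega'\otimes f']=(-1)^{\deg\omega'\deg f}\omega\wedge\omega'\otimes[f,f']$; it is the total complex of the Dolbeault resolution of $\mathcal C$, so $H^2(M)=\mathbb H^2(\mathcal C)$. $\mathrm{Def}_M(A)=\{z\in M^1\otimes\mathfrak m_A\mid dz+\frac12[z,z]=0\}/\exp(M^0\otimes\mathfrak m_A)$ (gauge action $e^a*z=z+\sum_{n\ge0}\frac{([a,-])^n}{(n+1)!}([a,z]-da)$) is identified with $\mathrm{Def}_{(E,L,\theta)}(A)$ by $(x,y)\mapsto(\ker(\bar\partial+x),\theta+y)$, $x\in A_X^{0,1}(\mathcal{E}nd(E))\otimes\mathfrak m_A$, $y\in A_X^{0,0}(\mathcal{E}nd(E)\otimes L)\otimes\mathfrak m_A$, the kernel being that of $\bar\partial+x:\mathcal A_X^{0,0}(E)\otimes A\to\mathcal A_X^{0,1}(E)\otimes A$. **Obstructions.** For a small extension $0\to J\to B\to A\to0$ in $\mathbf{Art}_{\mathbb C}$ ($\mathfrak m_BJ=0$) and a Maurer–Cartan element $z\in M^1\otimes\mathfrak m_A$ with any lift $\tilde z\in M^1\otimes\mathfrak m_B$, the obstruction of the corresponding deformation is the class of $d\tilde z+\frac12[\tilde z,\tilde z]$ in $H^2(M)\otimes J=\mathbb H^2(\mathcal C)\otimes J$. "Obstructions are contained in $\ker H^2(h_1)$" means that all these classes lie in $\ker H^2(h_1)\otimes J$. **The map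 $h_1$.** $h_1:M[1]\to\bigoplus_{k=1}^rA_X^{0,*}(\bigodot^kL)$ is $\omega\otimes f\mapsto(k\,\omega\otimes\mathrm{Tr}(f\theta^{k-1}))_k$ on $A_X^{0,*}(\mathcal{E}nd(E)\otimes L)$ (products in $\mathcal{E}nd(E)\otimes\bigodot^*L$, $\bigodot^k$ symmetric powers) and $0$ on $A_X^{0,*}(\mathcal{E}nd(E)\otimes\bigwedge^qL)$ for $q\neq1$; thus $H^2(h_1)$ of the class of a cocycle of degree $2$ is computed by applying the displayed formula to its component in $A_X^{0,1}(\mathcal{E}nd(E)\otimes L)$. *)

theory Defs
  imports "HOL-Analysis.Analysis" "HOL-Combinatorics.Permutations"
begin

section \<open>Smooth and holomorphic functions on open subsets of the coordinate space\<close>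

text \<open>The model space of a manifold of dimension \<open>card N\<close> is the coordinate subspace of
  \<open>complex ^ 'n\<close> with coordinates in \<open>N\<close>; in this way the dimension \<open>0\<close> is not excluded.\<close>

definition model_space :: "'n set \<Rightarrow> (complex ^ 'n::finite) set" where
  "model_space N = {z. \<forall>i. i \<notin> N \<longrightarrow> z $ i = 0}"

definition dir_deriv ::
  "complex ^ 'n::finite \<Rightarrow> (complex ^ 'n \<Rightarrow> complex) \<Rightarrow> complex ^ 'n \<Rightarrow> complex" where
  "dir_deriv v f z = vector_derivative (\<lambda>t::real. f (z + t *\<^sub>R v)) (at 0)"

definition real_directions :: "'n set \<Rightarrow> (complex ^ 'n::finite) set" where
  "real_directions N = (\<lambda>i. axis i 1) ` N \<union> (\<lambda>i. axis i \<i>) ` N"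

text \<open>All iterated real partial derivatives exist and are continuous; \<open>V\<close> is meant to be
  relatively open in \<open>model_space N\<close>.\<close>

definition smooth_on ::
  "'n set \<Rightarrow> (complex ^ 'n::finite) set \<Rightarrow> (complex ^ 'n \<Rightarrow> complex) \<Rightarrow> bool" where
  "smooth_on N V f \<longleftrightarrow>
     (\<forall>vs. set vs \<subseteq> real_directions N \<longrightarrow>
        continuous_on V (foldr dir_deriv vs f) \<and>
        (\<forall>z\<in>V. \<forall>v\<in>real_directions N.
           (\<lambda>t::real. foldr dir_deriv vs f (z + t *\<^sub>R v)) differentiable (at 0)))"

definition wirt :: "'n::finite \<Rightarrow> (complex ^ 'n \<Rightarrow> complex) \<Rightarrow> complex ^ 'n \<Rightarrow> complex" where
  "wirt i f z = (dir_deriv (axis i 1) f z - \<i> * dir_deriv (axis i \<i>) f z) / 2"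

definition wirt_bar :: "'n::finite \<Rightarrow> (complex ^ 'n \<Rightarrow> complex) \<Rightarrow> complex ^ 'n \<Rightarrow> complex" where
  "wirt_bar i f z = (dir_deriv (axis i 1) f z + \<i> * dir_deriv (axis i \<i>) f z) / 2"

definition hol_on ::
  "'n set \<Rightarrow> (complex ^ 'n::finite) set \<Rightarrow> (complex ^ 'n \<Rightarrow> complex) \<Rightarrow> bool" where
  "hol_on N V f \<longleftrightarrow> smooth_on N V f \<and> (\<forall>i\<in>N. \<forall>z\<in>V. wirt_bar i f z = 0)"

section \<open>Complex manifolds and holomorphic vector bundles\<close>

record ('c, 'x, 'n) manifold =
  coords :: "'n set"
  chart_dom :: "'c \<Rightarrow> 'x set"
  chart :: "'c \<Rightarrow> 'x \<Rightarrow> complex ^ 'n"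

definition chart_inv :: "('c, 'x, 'n::finite) manifold \<Rightarrow> 'c \<Rightarrow> complex ^ 'n \<Rightarrow> 'x" where
  "chart_inv X c = inv_into (chart_dom X c) (chart X c)"

definition complex_manifold :: "('c, 'x::t2_space, 'n::finite) manifold \<Rightarrow> bool" where
  "complex_manifold X \<longleftrightarrow>
     (\<forall>c. open (chart_dom X c) \<and>
        openin (top_of_set (model_space (coords X))) (chart X c ` chart_dom X c) \<and>
        homeomorphism (chart_dom X c) (chart X c ` chart_dom X c) (chart X c) (chart_inv X c)) \<and>
     (\<Union>c. chart_dom X c) = UNIV \<and>
     (\<forall>c d. \<forall>a\<in>coords X.
        hol_on (coords X) (chart X d ` (chart_dom X c \<inter> chart_dom X d))
          (\<lambda>z. chart X c (chart_inv X d z) $ a))"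

definition compact_complex_manifold :: "('c, 'x::t2_space, 'n::finite) manifold \<Rightarrow> bool" where
  "compact_complex_manifold X \<longleftrightarrow> complex_manifold X \<and> compact (UNIV :: 'x set)"

text \<open>The derivative of the \<open>a\<close>-th coordinate of the chart \<open>c\<close> with respect to the \<open>b\<close>-th
  coordinate of the chart \<open>d\<close>.\<close>

definition jacobian ::
  "('c, 'x, 'n::finite) manifold \<Rightarrow> 'c \<Rightarrow> 'c \<Rightarrow> 'x \<Rightarrow> 'n \<Rightarrow> 'n \<Rightarrow> complex" where
  "jacobian X c d x a b = wirt b (\<lambda>z. chart X c (chart_inv X d z) $ a) (chart X d x)"

text \<open>A vector bundle is given by frames over the sets of an open cover; the frame over
  \<open>frame_dom F i\<close> is indexed by the finite set \<open>fibre F\<close>, so the rank is \<open>card (fibre F)\<close>.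
  The matrix \<open>transition F i j x\<close> sends coordinates in the frame \<open>j\<close> to those in the frame \<open>i\<close>.\<close>

record ('i, 'x, 'f) vbundle =
  frame_dom :: "'i \<Rightarrow> 'x set"
  fibre :: "'f set"
  transition :: "'i \<Rightarrow> 'i \<Rightarrow> 'x \<Rightarrow> 'f \<Rightarrow> 'f \<Rightarrow> complex"

definition holomorphic_bundle ::
  "('c, 'x::t2_space, 'n::finite) manifold \<Rightarrow> ('i, 'x, 'f) vbundle \<Rightarrow> bool" where
  "holomorphic_bundle X F \<longleftrightarrow>
     finite (fibre F) \<and>
     (\<forall>i. open (frame_dom F i)) \<and> (\<Union>i. frame_dom F i) = UNIV \<and>
     (\<forall>i. \<forall>x\<in>frame_dom F i. \<forall>a\<in>fibre F. \<forall>b\<in>fibre F.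
        transition F i i x a b = (if a = b then 1 else 0)) \<and>
     (\<forall>i j k. \<forall>x\<in>frame_dom F i \<inter> frame_dom F j \<inter> frame_dom F k.
        \<forall>a\<in>fibre F. \<forall>b\<in>fibre F.
        transition F i k x a b = (\<Sum>m\<in>fibre F. transition F i j x a m * transition F j k x m b)) \<and>
     (\<forall>c i j. \<forall>a\<in>fibre F. \<forall>b\<in>fibre F.
        hol_on (coords X) (chart X c ` (chart_dom X c \<inter> frame_dom F i \<inter> frame_dom F j))
          (\<lambda>z. transition F i j (chart_inv X c z) a b))"

definition end_bundle :: "('i, 'x, 'f) vbundle \<Rightarrow> ('i, 'x, 'f \<times> 'f) vbundle" where
  "end_bundle E =
     \<lparr>frame_dom = frame_dom E,
      fibre = fibre E \<times> fibre E,
      transition = (\<lambda>i j x (a, b) (a', b'). transition E i j x a a' * transition E j i x b' b)\<rparr>"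

definition tensor_bundle ::
  "('i, 'x, 'f) vbundle \<Rightarrow> ('j, 'x, 'g) vbundle \<Rightarrow> ('i \<times> 'j, 'x, 'f \<times> 'g) vbundle" where
  "tensor_bundle F G =
     \<lparr>frame_dom = (\<lambda>(i, j). frame_dom F i \<inter> frame_dom G j),
      fibre = fibre F \<times> fibre G,
      transition = (\<lambda>(i, j) (i', j') x (a, b) (a', b').
        transition F i i' x a a' * transition G j j' x b b')\<rparr>"

definition tensor_power :: "nat \<Rightarrow> ('j, 'x, 'g) vbundle \<Rightarrow> ('j, 'x, 'g list) vbundle" where
  "tensor_power k L =
     \<lparr>frame_dom = frame_dom L,
      fibre = {K. length K = k \<and> set K \<subseteq> fibre L},
      transition = (\<lambda>i j x K K'. \<Prod>t<k. transition L i j x (K ! t) (K' ! t))\<rparr>"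

section \<open>Forms of type (0,p) with values in a bundle\<close>

text \<open>A form \<open>\<omega>\<close> is given by its coefficients: \<open>\<omega> (c, i, x, J, f)\<close> is the value at \<open>x\<close> of the
  coefficient with index list \<open>J\<close> (of length \<open>p\<close>) with respect to the conjugate coordinate
  differentials of the chart \<open>c\<close>, and index \<open>f\<close> with respect to the frame \<open>i\<close>. Coefficients are
  alternating in \<open>J\<close> and vanish at meaningless indices, so that a form determines them.

  The exterior power of \<open>L\<close> is the bundle of alternating tensors and the symmetric power the bundle
  of symmetric tensors in the tensor power of \<open>L\<close>. The product of alternating tensors is the
  sum over shuffles, so that the wedge product of \<open>u\<close> and \<open>v\<close> in \<open>L\<close> is
  \<open>u \<otimes> v - v \<otimes> u\<close>; the product of symmetric tensors is the symmetrization (average over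
  permutations) of the tensor product.\<close>

type_synonym ('c, 'i, 'x, 'n, 'f) coeff_index = "'c \<times> 'i \<times> 'x \<times> 'n list \<times> 'f"

definition alternating :: "('k list \<Rightarrow> complex) \<Rightarrow> bool" where
  "alternating f \<longleftrightarrow>
     (\<forall>K \<sigma>. \<sigma> permutes {..<length K} \<longrightarrow> f (permute_list \<sigma> K) = of_int (sign \<sigma>) * f K)"

definition symmetric :: "('k list \<Rightarrow> complex) \<Rightarrow> bool" where
  "symmetric f \<longleftrightarrow> (\<forall>K \<sigma>. \<sigma> permutes {..<length K} \<longrightarrow> f (permute_list \<sigma> K) = f K)"

definition forms ::
  "('c, 'x, 'n::finite) manifold \<Rightarrow> ('i, 'x, 'f) vbundle \<Rightarrow> nat \<Rightarrow>
   (('c, 'i, 'x, 'n, 'f) coeff_index \<Rightarrow> complex) set" where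
  "forms X F p =
     {\<omega>.
       (\<forall>c i x J f. \<omega> (c, i, x, J, f) \<noteq> 0 \<longrightarrow>
          x \<in> chart_dom X c \<inter> frame_dom F i \<and> length J = p \<and> set J \<subseteq> coords X \<and> f \<in> fibre F) \<and>
       (\<forall>c i x f. alternating (\<lambda>J. \<omega> (c, i, x, J, f))) \<and>
       (\<forall>c i J f. smooth_on (coords X) (chart X c ` (chart_dom X c \<inter> frame_dom F i))
          (\<lambda>z. \<omega> (c, i, chart_inv X c z, J, f))) \<and>
       (\<forall>c d i j x J f.
          x \<in> chart_dom X c \<inter> chart_dom X d \<inter> frame_dom F i \<inter> frame_dom F j \<longrightarrow>
          length J = p \<longrightarrow> set J \<subseteq> coords X \<longrightarrow> f \<in> fibre F \<longrightarrow>
          \<omega> (d, j, x, J, f) =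
            (\<Sum>J' \<in> {J'. length J' = p \<and> set J' \<subseteq> coords X}. \<Sum>f' \<in> fibre F.
               (\<Prod>t<p. cnj (jacobian X c d x (J' ! t) (J ! t))) *
               transition F j i x f f' * \<omega> (c, i, x, J', f')))}"

definition dbar ::
  "('c, 'x, 'n::finite) manifold \<Rightarrow> ('i, 'x, 'f) vbundle \<Rightarrow>
   (('c, 'i, 'x, 'n, 'f) coeff_index \<Rightarrow> complex) \<Rightarrow>
   (('c, 'i, 'x, 'n, 'f) coeff_index \<Rightarrow> complex)" where
  "dbar X F \<omega> = (\<lambda>(c, i, x, J, f).
     if x \<in> chart_dom X c \<inter> frame_dom F i \<and> set J \<subseteq> coords X
     then \<Sum>t<length J. (-1) ^ t *
            wirt_bar (J ! t) (\<lambda>z. \<omega> (c, i, chart_inv X c z, nths J (- {t}), f)) (chart X c x)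
     else 0)"

definition ext_forms ::
  "('c, 'x, 'n::finite) manifold \<Rightarrow> ('i, 'x, 'f) vbundle \<Rightarrow> ('j, 'x, 'g) vbundle \<Rightarrow> nat \<Rightarrow> nat \<Rightarrow>
   (('c, 'i \<times> 'j, 'x, 'n, ('f \<times> 'f) \<times> 'g list) coeff_index \<Rightarrow> complex) set" where
  \<comment> \<open>forms of type \<open>(0,p)\<close> with values in the tensor product of End(\<open>E\<close>) and the \<open>q\<close>-th exterior
     power of \<open>L\<close>\<close>
  "ext_forms X E L p q =
     {\<omega> \<in> forms X (tensor_bundle (end_bundle E) (tensor_power q L)) p.
        \<forall>c i x J ab. alternating (\<lambda>K. \<omega> (c, i, x, J, (ab, K)))}"

definition sym_forms ::
  "('c, 'x, 'n::finite) manifold \<Rightarrow> ('j, 'x, 'g) vbundle \<Rightarrow> nat \<Rightarrow> nat \<Rightarrow>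
   (('c, 'j, 'x, 'n, 'g list) coeff_index \<Rightarrow> complex) set" where
  \<comment> \<open>forms of type \<open>(0,p)\<close> with values in the \<open>k\<close>-th symmetric power of \<open>L\<close>\<close>
  "sym_forms X L k p =
     {\<eta> \<in> forms X (tensor_power k L) p. \<forall>c j x J. symmetric (\<lambda>K. \<eta> (c, j, x, J, K))}"

section \<open>The algebra End(E) with coefficients in the exterior algebra of L\<close>

text \<open>The following operations act on coefficient functions at a point. They are polymorphic
  in the coefficient ring, so that they also are the extensions of the complex bilinear operations
  to coefficients in a commutative algebra, \<open>[m \<otimes> a, m' \<otimes> a'] = [m, m'] \<otimes> a a'\<close>.\<close>

definition shuffle_sign :: "nat set \<Rightarrow> 'v::comm_ring_1" where
  "shuffle_sign S = (-1) ^ card {(s, t). s \<in> S \<and> t \<notin> S \<and> t < s}"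

definition end_wedge ::
  "'f set \<Rightarrow> (('f \<times> 'f) \<times> 'g list \<Rightarrow> 'v::comm_ring_1) \<Rightarrow> (('f \<times> 'f) \<times> 'g list \<Rightarrow> 'v) \<Rightarrow>
   ('f \<times> 'f) \<times> 'g list \<Rightarrow> 'v" where
  "end_wedge R u v = (\<lambda>((a, b), K).
     \<Sum>T\<in>Pow {..<length K}. shuffle_sign T *
       (\<Sum>m\<in>R. u ((a, m), nths K T) * v ((m, b), nths K (- T))))"

definition end_bracket ::
  "'f set \<Rightarrow> (('f \<times> 'f) \<times> 'g list \<Rightarrow> 'v::comm_ring_1) \<Rightarrow> (('f \<times> 'f) \<times> 'g list \<Rightarrow> 'v) \<Rightarrow>
   ('f \<times> 'f) \<times> 'g list \<Rightarrow> 'v" where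
  \<comment> \<open>\<open>[\<phi> \<otimes> h, \<psi> \<otimes> l] = [\<phi>, \<psi>] \<otimes> h \<and> l\<close>, with the ungraded commutator of endomorphisms\<close>
  "end_bracket R u v = (\<lambda>((a, b), K).
     \<Sum>T\<in>Pow {..<length K}. shuffle_sign T *
       (\<Sum>m\<in>R. u ((a, m), nths K T) * v ((m, b), nths K (- T))
             - v ((a, m), nths K (- T)) * u ((m, b), nths K T)))"

text \<open>In a Hitchin pair, \<open>\<theta>\<close> is a form of type (0,0), so its only form index is the empty list.\<close>

definition hitchin_pair ::
  "('c, 'x::t2_space, 'n::finite) manifold \<Rightarrow> ('i, 'x, 'f) vbundle \<Rightarrow> ('j, 'x, 'g) vbundle \<Rightarrow>
   (('c, 'i \<times> 'j, 'x, 'n, ('f \<times> 'f) \<times> 'g list) coeff_index \<Rightarrow> complex) \<Rightarrow> bool" where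
  "hitchin_pair X E L \<theta> \<longleftrightarrow>
     holomorphic_bundle X E \<and> holomorphic_bundle X L \<and>
     \<theta> \<in> ext_forms X E L 0 1 \<and>
     (\<forall>c i j f. hol_on (coords X)
        (chart X c ` (chart_dom X c \<inter> frame_dom E i \<inter> frame_dom L j))
        (\<lambda>z. \<theta> (c, (i, j), chart_inv X c z, [], f))) \<and>
     (\<forall>c i x. end_wedge (fibre E) (\<lambda>f. \<theta> (c, i, x, [], f)) (\<lambda>f. \<theta> (c, i, x, [], f)) = (\<lambda>_. 0))"

section \<open>The differential graded Lie algebra M\<close>

text \<open>An element of \<open>M_space X E L n\<close> is the sum of its components of type \<open>(p,q)\<close> with
  \<open>p + q = n\<close>; the component is recognised by the lengths of the two index lists.\<close>

definition M_component ::
  "nat \<Rightarrow> nat \<Rightarrow>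
   (('c, 'i \<times> 'j, 'x, 'n, ('f \<times> 'f) \<times> 'g list) coeff_index \<Rightarrow> complex) \<Rightarrow>
   (('c, 'i \<times> 'j, 'x, 'n, ('f \<times> 'f) \<times> 'g list) coeff_index \<Rightarrow> complex)" where
  "M_component p q z = (\<lambda>(c, i, x, J, (ab, K)).
     if length J = p \<and> length K = q then z (c, i, x, J, (ab, K)) else 0)"

definition M_space ::
  "('c, 'x, 'n::finite) manifold \<Rightarrow> ('i, 'x, 'f) vbundle \<Rightarrow> ('j, 'x, 'g) vbundle \<Rightarrow> nat \<Rightarrow>
   (('c, 'i \<times> 'j, 'x, 'n, ('f \<times> 'f) \<times> 'g list) coeff_index \<Rightarrow> complex) set" where
  "M_space X E L n =
     {z. \<forall>p q. if p + q = n then M_component p q z \<in> ext_forms X E L p q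
               else M_component p q z = (\<lambda>_. 0)}"

definition M_diff ::
  "('c, 'x, 'n::finite) manifold \<Rightarrow> ('i, 'x, 'f) vbundle \<Rightarrow> ('j, 'x, 'g) vbundle \<Rightarrow>
   (('c, 'i \<times> 'j, 'x, 'n, ('f \<times> 'f) \<times> 'g list) coeff_index \<Rightarrow> complex) \<Rightarrow>
   (('c, 'i \<times> 'j, 'x, 'n, ('f \<times> 'f) \<times> 'g list) coeff_index \<Rightarrow> complex) \<Rightarrow>
   (('c, 'i \<times> 'j, 'x, 'n, ('f \<times> 'f) \<times> 'g list) coeff_index \<Rightarrow> complex)" where
  \<comment> \<open>the bundle in \<open>dbar\<close> only serves to restrict \<open>x\<close> to the domain of the frame, which
     does not depend on the exponent \<open>length K\<close>\<close>
  "M_diff X E L \<theta> z = (\<lambda>(c, i, x, J, (ab, K)).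
     dbar X (tensor_bundle (end_bundle E) (tensor_power (length K) L)) z (c, i, x, J, (ab, K)) +
     (-1) ^ length J *
       end_bracket (fibre E) (\<lambda>f. \<theta> (c, i, x, [], f)) (\<lambda>f. z (c, i, x, J, f)) (ab, K))"

text \<open>\<open>[\<omega> \<otimes> f, \<omega>' \<otimes> f'] = (-1) ^ (deg \<omega>' * deg f) \<omega> \<and> \<omega>' \<otimes> [f, f']\<close>: the index lists of the
  coefficients of \<open>\<omega>'\<close> and \<open>f\<close> are \<open>nths J (- S)\<close> and the list \<open>K\<close> below.\<close>

definition M_bracket ::
  "('i, 'x, 'f) vbundle \<Rightarrow>
   (('c, 'i \<times> 'j, 'x, 'n, ('f \<times> 'f) \<times> 'g list) coeff_index \<Rightarrow> 'v::comm_ring_1) \<Rightarrow>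
   (('c, 'i \<times> 'j, 'x, 'n, ('f \<times> 'f) \<times> 'g list) coeff_index \<Rightarrow> 'v) \<Rightarrow>
   (('c, 'i \<times> 'j, 'x, 'n, ('f \<times> 'f) \<times> 'g list) coeff_index \<Rightarrow> 'v)" where
  "M_bracket E z w = (\<lambda>(c, i, x, J, f).
     \<Sum>S\<in>Pow {..<length J}. shuffle_sign S *
       end_bracket (fibre E)
         (\<lambda>(ab, K). (-1) ^ (length (nths J (- S)) * length K) * z (c, i, x, nths J S, (ab, K)))
         (\<lambda>f'. w (c, i, x, nths J (- S), f')) f)"

section \<open>Hypercohomology and the map H2(h1)\<close>

definition coset :: "('k \<Rightarrow> 'v::ab_group_add) set \<Rightarrow> ('k \<Rightarrow> 'v) \<Rightarrow> ('k \<Rightarrow> 'v) set" where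
  "coset B z = {w. (\<lambda>k. w k - z k) \<in> B}"

definition Z2 where
  "Z2 X E L \<theta> = {z \<in> M_space X E L 2. M_diff X E L \<theta> z = (\<lambda>_. 0)}"

definition B2 where
  "B2 X E L \<theta> = M_diff X E L \<theta> ` M_space X E L 1"

text \<open>The second hypercohomology space of the complex, computed by the Dolbeault resolution, whose
  total complex is \<open>M\<close>.\<close>

definition HH2 where
  "HH2 X E L \<theta> = coset (B2 X E L \<theta>) ` Z2 X E L \<theta>"

fun word_product ::
  "'f set \<Rightarrow> ('f \<times> 'f \<Rightarrow> complex) list \<Rightarrow> 'f \<times> 'f \<Rightarrow> complex" where
  "word_product R [] (a, b) = (if a = b then 1 else 0)"
| "word_product R (A # As) (a, b) = (\<Sum>m\<in>R. A (a, m) * word_product R As (m, b))"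

definition trace_word :: "'f set \<Rightarrow> ('f \<times> 'f \<Rightarrow> complex) list \<Rightarrow> complex" where
  "trace_word R As = (\<Sum>a\<in>R. word_product R As (a, a))"

definition symmetrize :: "('k list \<Rightarrow> complex) \<Rightarrow> 'k list \<Rightarrow> complex" where
  "symmetrize T K = (\<Sum>\<sigma> | \<sigma> permutes {..<length K}. T (permute_list \<sigma> K)) / fact (length K)"

text \<open>The \<open>k\<close>-th component of \<open>h1\<close> (\<open>k \<ge> 1\<close>). Only the coefficients \<open>(ab, [g])\<close>, that is the
  components with values in the tensor product of End(\<open>E\<close>) and \<open>L\<close>, are used, so \<open>h1\<close> vanishes on
  the others. The trace is computed in an arbitrary frame of \<open>E\<close> around \<open>x\<close>; it does not depend
  on this frame.\<close>

definition h1 ::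
  "('i, 'x, 'f) vbundle \<Rightarrow>
   (('c, 'i \<times> 'j, 'x, 'n, ('f \<times> 'f) \<times> 'g list) coeff_index \<Rightarrow> complex) \<Rightarrow> nat \<Rightarrow>
   (('c, 'i \<times> 'j, 'x, 'n, ('f \<times> 'f) \<times> 'g list) coeff_index \<Rightarrow> complex) \<Rightarrow>
   (('c, 'j, 'x, 'n, 'g list) coeff_index \<Rightarrow> complex)" where
  "h1 E \<theta> k z = (\<lambda>(c, j, x, J, K).
     let i = (SOME i. x \<in> frame_dom E i) in
     if length K = k
     then of_nat k *
       symmetrize (\<lambda>K. trace_word (fibre E)
         ((\<lambda>ab. z (c, (i, j), x, J, (ab, [hd K]))) #
          map (\<lambda>g ab. \<theta> (c, (i, j), x, [], (ab, [g]))) (tl K))) K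
     else 0)"

text \<open>Dolbeault cohomology: the first cohomology of the \<open>k\<close>-th symmetric power of \<open>L\<close>.\<close>

definition sym_B1 where
  "sym_B1 X L k = dbar X (tensor_power k L) ` sym_forms X L k 0"

definition sym_H1 where
  "sym_H1 X L k =
     coset (sym_B1 X L k) ` {\<eta> \<in> sym_forms X L k 1. dbar X (tensor_power k L) \<eta> = (\<lambda>_. 0)}"

text \<open>The \<open>k\<close>-th component of the map induced by \<open>h1\<close> on cohomology: the class that contains
  the images of all representatives.\<close>

definition H2_h1 where
  "H2_h1 X E L \<theta> k C = (THE D. D \<in> sym_H1 X L k \<and> (\<forall>z\<in>C. h1 E \<theta> k z \<in> D))"

definition ker_H2_h1 where
  "ker_H2_h1 X E L \<theta> r =
     {C \<in> HH2 X E L \<theta>. \<forall>k\<in>{1..r}. H2_h1 X E L \<theta> k C = coset (sym_B1 X L k) (\<lambda>_. 0)}"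

section \<open>Local Artinian algebras and tensor products\<close>

definition is_ideal :: "'a::comm_ring_1 set \<Rightarrow> bool" where
  "is_ideal I \<longleftrightarrow> module.subspace (*) I"

definition maximal_ideal :: "'a::comm_ring_1 set \<Rightarrow> bool" where
  "maximal_ideal I \<longleftrightarrow> is_ideal I \<and> I \<noteq> UNIV \<and>
     (\<forall>K. is_ideal K \<and> I \<subseteq> K \<longrightarrow> K = I \<or> K = UNIV)"

definition max_ideal :: "'a::comm_ring_1 set" where
  "max_ideal = (THE I. maximal_ideal I)"

text \<open>Algebras over the complex numbers are commutative rings with a scalar multiplication \<open>s\<close>.\<close>

definition local_artinian_algebra :: "(complex \<Rightarrow> 'a::comm_ring_1 \<Rightarrow> 'a) \<Rightarrow> bool" where
  "local_artinian_algebra s \<longleftrightarrow>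
     vector_space s \<and>
     (\<forall>c x y. s c x * y = s c (x * y)) \<and>
     (\<forall>I :: nat \<Rightarrow> 'a set. (\<forall>n. is_ideal (I n)) \<and> decseq I \<longrightarrow> (\<exists>n. \<forall>k\<ge>n. I k = I n)) \<and>
     (\<exists>!I :: 'a set. maximal_ideal I) \<and>
     (\<forall>x :: 'a. \<exists>!c. x - s c 1 \<in> max_ideal)"

text \<open>The small extension \<open>0 \<rightarrow> J \<rightarrow> B \<rightarrow> A \<rightarrow> 0\<close>, where \<open>J\<close> is the kernel of \<open>\<pi>\<close>.\<close>

definition ext_kernel :: "('b::zero \<Rightarrow> 'a::zero) \<Rightarrow> 'b set" where
  "ext_kernel \<pi> = {x. \<pi> x = 0}"

definition small_extension ::
  "(complex \<Rightarrow> 'b::comm_ring_1 \<Rightarrow> 'b) \<Rightarrow> (complex \<Rightarrow> 'a::comm_ring_1 \<Rightarrow> 'a) \<Rightarrow> ('b \<Rightarrow> 'a) \<Rightarrow> bool"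
  where
  "small_extension sB sA \<pi> \<longleftrightarrow>
     local_artinian_algebra sB \<and> local_artinian_algebra sA \<and>
     \<pi> 1 = 1 \<and> (\<forall>x y. \<pi> (x + y) = \<pi> x + \<pi> y) \<and> (\<forall>x y. \<pi> (x * y) = \<pi> x * \<pi> y) \<and>
     (\<forall>c x. \<pi> (sB c x) = sA c (\<pi> x)) \<and>
     surj \<pi> \<and>
     (\<forall>x\<in>max_ideal. \<forall>y\<in>ext_kernel \<pi>. x * y = 0)"

text \<open>For a space \<open>U\<close> of complex-valued functions on a set of indices and a subspace \<open>V\<close> of an
  algebra, \<open>U \<otimes> V\<close> embeds in the space of functions with values in the algebra, \<open>u \<otimes> v\<close> being
  the function \<open>\<lambda>k. s (u k) v\<close>.\<close>

definition tensor_sum ::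
  "(complex \<Rightarrow> 'a::comm_ring_1 \<Rightarrow> 'a) \<Rightarrow> nat \<Rightarrow> (nat \<Rightarrow> 'k \<Rightarrow> complex) \<Rightarrow> (nat \<Rightarrow> 'a) \<Rightarrow> 'k \<Rightarrow> 'a" where
  "tensor_sum s n u v = (\<lambda>k. \<Sum>t<n. s (u t k) (v t))"

definition tensor ::
  "(complex \<Rightarrow> 'a::comm_ring_1 \<Rightarrow> 'a) \<Rightarrow> ('k \<Rightarrow> complex) set \<Rightarrow> 'a set \<Rightarrow> ('k \<Rightarrow> 'a) set" where
  "tensor s U V = {tensor_sum s n u v | n u v. \<forall>t<n. u t \<in> U \<and> v t \<in> V}"

text \<open>The map \<open>D \<otimes> id\<close> on \<open>U \<otimes> A\<close>, for \<open>D\<close> linear on \<open>U\<close>.\<close>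

definition tensor_map ::
  "(complex \<Rightarrow> 'a::comm_ring_1 \<Rightarrow> 'a) \<Rightarrow> ('k \<Rightarrow> complex) set \<Rightarrow>
   (('k \<Rightarrow> complex) \<Rightarrow> 'l \<Rightarrow> complex) \<Rightarrow> ('k \<Rightarrow> 'a) \<Rightarrow> 'l \<Rightarrow> 'a" where
  "tensor_map s U D z = (THE w. \<exists>n u v. (\<forall>t<n. u t \<in> U) \<and>
     z = tensor_sum s n u v \<and> w = tensor_sum s n (\<lambda>t. D (u t)) v)"

section \<open>Maurer-Cartan elements and obstructions\<close>

definition mc_expr where
  \<comment> \<open>\<open>d z + 1/2 [z, z]\<close> for \<open>z\<close> in \<open>M\<^sup>1 \<otimes> A\<close>\<close>
  "mc_expr X E L \<theta> s z =
     (\<lambda>k. tensor_map s (M_space X E L 1) (M_diff X E L \<theta>) z k + s (1 / 2) (M_bracket E z z k))"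

definition MC where
  "MC X E L \<theta> s = {z \<in> tensor s (M_space X E L 1) max_ideal. mc_expr X E L \<theta> s z = (\<lambda>_. 0)}"

text \<open>\<open>HH2 \<otimes> J\<close> is realised as the quotient of \<open>Z2 \<otimes> J\<close> by \<open>B2 \<otimes> J\<close>. For a subspace \<open>U\<close> of \<open>HH2\<close>,
  \<open>HH2_tensor\<close> is its subspace \<open>U \<otimes> J\<close>.\<close>

definition HH2_tensor where
  "HH2_tensor X E L \<theta> s U J =
     coset (tensor s (B2 X E L \<theta>) J) `
       tensor s {z \<in> Z2 X E L \<theta>. coset (B2 X E L \<theta>) z \<in> U} J"

definition obstruction_class where
  "obstruction_class X E L \<theta> s J z = coset (tensor s (B2 X E L \<theta>) J) (mc_expr X E L \<theta> s z)"

end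

theory Submission
  imports Defs
begin

text \<open>Add \<open>\<theta>\<close> to a lift \<open>z'\<close> of a Maurer-Cartan element: \<open>\<Theta> = \<theta> + z'\<close> is a superconnection form with
  components \<open>A\<close> of type (0,1) and \<open>Y\<close> in \<open>End(E) \<otimes> L\<close>, and the obstruction is its curvature \<open>F\<close>.
  Since \<open>F\<close> takes values in the kernel \<open>J\<close> of the small extension, which the maximal ideal annihilates,
  \<open>F\<close> multiplies \<open>\<Theta>\<close> as it multiplies \<open>\<theta>\<close>. Hence the Bianchi identity says that \<open>F\<close> is a cocycle, and
  the derivative of \<open>Tr Y\<^sup>k\<close> is \<open>k Tr (F \<theta>\<^sup>k\<^sup>-\<^sup>1)\<close>, because commutators with \<open>A\<close> have trace zero. So
  \<open>h1\<close> maps \<open>F\<close> to the exact form \<open>dbar (Tr Y\<^sup>k)\<close>.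

  To return from coefficients in \<open>J\<close> to complex ones, all this is composed with linear functionals
  \<open>\<phi>\<close> on the algebra; the functionals of a dual basis then give \<open>F\<close> as an element of the tensor
  product.\<close>

section \<open>Smooth functions on subsets of the model space\<close>

text \<open>The Maurer-Cartan expression of \<open>z\<close> is exactly the curvature of
  \<open>\<theta> + z\<close> because \<theta> is flat: it is holomorphic and its wedge square
  vanishes. The algebra carries no topology, so an algebra-valued function is differentiated only on
  the complex factors of a finite tensor representation, and functionals show that the result does
  not depend on the representation. Exactness of \<open>h1\<close> on one representative does not
  yet give the value of \<open>H2_h1\<close>, which is a definite description over all
  representatives: \<open>h1\<close> must also send coboundaries to coboundaries. This comes from
  the same trace computation, run over the polynomial ring, where the coefficient of the variable
  replaces the values in \<open>J\<close>. All objects are families of coefficients in charts and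
  frames, so every construction must be shown to transform correctly. The two delicate points are
  that derivatives of the conjugate Jacobian cancel in dbar of a (0,1)-form and that traces do not
  depend on the frame of \<open>E\<close>.\<close>

definition line_differentiable ::
  "complex ^ 'n::finite \<Rightarrow> (complex ^ 'n \<Rightarrow> complex) \<Rightarrow> complex ^ 'n \<Rightarrow> bool" where
  "line_differentiable v f z \<longleftrightarrow> (\<lambda>t::real. f (z + t *\<^sub>R v)) differentiable (at 0)"

lemma line_differentiable_iff:
  "line_differentiable v f z \<longleftrightarrow>
     ((\<lambda>t::real. f (z + t *\<^sub>R v)) has_vector_derivative dir_deriv v f z) (at 0)"
  unfolding line_differentiable_def dir_deriv_def
  by (auto simp: vector_derivative_works differentiableI_vector)

lemma line_differentiableI:
  assumes "((\<lambda>t::real. f (z + t *\<^sub>R v)) has_vector_derivative D) (at 0)"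
  shows "line_differentiable v f z" "dir_deriv v f z = D"
  using assms unfolding line_differentiable_def dir_deriv_def
  by (auto simp: vector_derivative_at differentiableI_vector)

lemma smooth_on_altdef:
  "smooth_on N V f \<longleftrightarrow>
     (\<forall>vs. set vs \<subseteq> real_directions N \<longrightarrow>
        continuous_on V (foldr dir_deriv vs f) \<and>
        (\<forall>z\<in>V. \<forall>v\<in>real_directions N. line_differentiable v (foldr dir_deriv vs f) z))"
  unfolding smooth_on_def line_differentiable_def ..

lemma real_directions_axis:
  "i \<in> N \<Longrightarrow> axis i 1 \<in> real_directions N" "i \<in> N \<Longrightarrow> axis i \<i> \<in> real_directions N"
  by (auto simp: real_directions_def)

lemma real_directions_subset_Basis: "real_directions N \<subseteq> (Basis :: (complex ^ 'n::finite) set)"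
  by (auto simp: real_directions_def Basis_vec_def Basis_complex_def)

lemma finite_real_directions: "finite (real_directions N)"
  by (rule finite_subset[OF real_directions_subset_Basis]) simp

lemma real_directions_in_model_space: "v \<in> real_directions N \<Longrightarrow> v \<in> model_space N"
  by (auto simp: real_directions_def model_space_def axis_def)

lemma model_space_add: "z \<in> model_space N \<Longrightarrow> w \<in> model_space N \<Longrightarrow> z + w \<in> model_space N"
  by (auto simp: model_space_def)

lemma model_space_scaleR: "z \<in> model_space N \<Longrightarrow> t *\<^sub>R z \<in> model_space N"
  by (auto simp: model_space_def)

lemma model_space_sum: "(\<And>i. i \<in> I \<Longrightarrow> f i \<in> model_space N) \<Longrightarrow> sum f I \<in> model_space N"
  by (auto simp: model_space_def)

text \<open>\<open>V\<close> is open only relative to the model space, but lines in the directions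
  of \<open>N\<close> stay in that space. Line derivatives at points of \<open>V\<close> are
  therefore determined by the values on \<open>V\<close>.\<close>

lemma line_eventually_in:
  assumes V: "openin (top_of_set (model_space N)) V" and z: "z \<in> V" and v: "v \<in> real_directions N"
  shows "eventually (\<lambda>t::real. z + t *\<^sub>R v \<in> V) (nhds 0)"
proof -
  obtain U where U: "open U" "V = model_space N \<inter> U"
    using V by (auto simp: openin_open)
  have "((\<lambda>t::real. z + t *\<^sub>R v) \<longlongrightarrow> z + 0 *\<^sub>R v) (nhds 0)"
    by (intro tendsto_intros filterlim_ident)
  then have "eventually (\<lambda>t::real. z + t *\<^sub>R v \<in> U) (nhds 0)"
    using U z by (intro topological_tendstoD) auto
  then show ?thesis
  proof eventually_elim
    case (elim t)
    then show ?case
      using U z v real_directions_in_model_space[OF v] by (auto intro!: model_space_add model_space_scaleR)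
  qed
qed

lemma dir_deriv_cong:
  assumes V: "openin (top_of_set (model_space N)) V" and z: "z \<in> V" and v: "v \<in> real_directions N"
    and eq: "\<And>w. w \<in> V \<Longrightarrow> f w = g w"
  shows "dir_deriv v f z = dir_deriv v g z" "line_differentiable v f z \<longleftrightarrow> line_differentiable v g z"
proof -
  have ev: "eventually (\<lambda>t::real. f (z + t *\<^sub>R v) = g (z + t *\<^sub>R v)) (nhds 0)"
    using line_eventually_in[OF V z v] by eventually_elim (rule eq)
  have *: "((\<lambda>t. f (z + t *\<^sub>R v)) has_vector_derivative D) (at 0) \<longleftrightarrow>
        ((\<lambda>t. g (z + t *\<^sub>R v)) has_vector_derivative D) (at 0)" for D
    by (rule has_vector_derivative_cong_ev) (use ev eq z in \<open>auto elim: eventually_mono\<close>)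
  show "dir_deriv v f z = dir_deriv v g z"
    unfolding dir_deriv_def vector_derivative_def by (simp add: *)
  show "line_differentiable v f z \<longleftrightarrow> line_differentiable v g z"
    using * line_differentiableI(1) unfolding line_differentiable_iff by blast
qed

text \<open>Coinduction principle for smoothness: iterated derivatives stay in the class \<open>C\<close> up to
  equality on \<open>V\<close>.\<close>

lemma smooth_on_coinduct:
  assumes V: "openin (top_of_set (model_space N)) V" and f: "C f"
    and cont: "\<And>g. C g \<Longrightarrow> continuous_on V g"
    and diff: "\<And>g z v. C g \<Longrightarrow> z \<in> V \<Longrightarrow> v \<in> real_directions N \<Longrightarrow> line_differentiable v g z"
    and step: "\<And>g v. C g \<Longrightarrow> v \<in> real_directions N \<Longrightarrow> \<exists>h. C h \<and> (\<forall>z\<in>V. dir_deriv v g z = h z)"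
  shows "smooth_on N V f"
  unfolding smooth_on_altdef
proof (intro allI impI)
  fix vs :: "(complex ^ 'a) list" assume vs: "set vs \<subseteq> real_directions N"
  then have "\<exists>g. C g \<and> (\<forall>z\<in>V. foldr dir_deriv vs f z = g z)"
  proof (induction vs)
    case Nil
    then show ?case using f by auto
  next
    case (Cons v vs)
    then obtain g where g: "C g" "\<forall>z\<in>V. foldr dir_deriv vs f z = g z" by auto
    obtain h where h: "C h" "\<forall>z\<in>V. dir_deriv v g z = h z"
      using step[OF g(1), of v] Cons by auto
    have "foldr dir_deriv (v # vs) f z = h z" if "z \<in> V" for z
      using dir_deriv_cong(1)[OF V that, of v "foldr dir_deriv vs f" g] g h that Cons.prems by auto
    then show ?case using h by auto
  qed
  then obtain g where g: "C g" "\<forall>z\<in>V. foldr dir_deriv vs f z = g z" by auto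
  have "continuous_on V (foldr dir_deriv vs f)"
    using cont[OF g(1)] g(2) by (subst continuous_on_cong[OF refl, of _ _ g]) auto
  moreover have "line_differentiable v (foldr dir_deriv vs f) z"
    if "z \<in> V" "v \<in> real_directions N" for z v
    using diff[OF g(1) that] dir_deriv_cong(2)[OF V that, of "foldr dir_deriv vs f" g] g(2) by auto
  ultimately show "continuous_on V (foldr dir_deriv vs f) \<and>
      (\<forall>z\<in>V. \<forall>v\<in>real_directions N. line_differentiable v (foldr dir_deriv vs f) z)" by blast
qed

lemma smooth_on_continuous: "smooth_on N V f \<Longrightarrow> continuous_on V f"
  unfolding smooth_on_altdef by (drule spec[of _ "[]"]) simp

lemma smooth_on_differentiable:
  "smooth_on N V f \<Longrightarrow> z \<in> V \<Longrightarrow> v \<in> real_directions N \<Longrightarrow> line_differentiable v f z"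
  unfolding smooth_on_altdef by (drule spec[of _ "[]"]) simp

lemma smooth_on_dir_deriv:
  assumes "smooth_on N V f" "v \<in> real_directions N"
  shows "smooth_on N V (dir_deriv v f)"
  unfolding smooth_on_altdef
proof (intro allI impI)
  fix vs assume "set vs \<subseteq> real_directions N"
  then show "continuous_on V (foldr dir_deriv vs (dir_deriv v f)) \<and>
       (\<forall>z\<in>V. \<forall>w\<in>real_directions N. line_differentiable w (foldr dir_deriv vs (dir_deriv v f)) z)"
    \<comment> \<open>\<open>foldr\<close> applies the last entry of the list first, so appending
      \<open>v\<close> makes it the innermost derivative.\<close>
    using assms(1)[unfolded smooth_on_altdef, rule_format, of "vs @ [v]"] assms(2) by auto
qed

lemma smooth_on_cong:
  assumes V: "openin (top_of_set (model_space N)) V" and f: "smooth_on N V f"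
    and eq: "\<And>z. z \<in> V \<Longrightarrow> f z = g z"
  shows "smooth_on N V g"
proof (rule smooth_on_coinduct[OF V, of "\<lambda>g. \<exists>f. smooth_on N V f \<and> (\<forall>z\<in>V. f z = g z)"])
  show "\<exists>f. smooth_on N V f \<and> (\<forall>z\<in>V. f z = g z)" using f eq by auto
next
  fix g assume "\<exists>f. smooth_on N V f \<and> (\<forall>z\<in>V. f z = g z)"
  then obtain f where f: "smooth_on N V f" "\<forall>z\<in>V. f z = g z" by auto
  show "continuous_on V g"
    using smooth_on_continuous[OF f(1)] f(2) continuous_on_cong[OF refl, of V f g] by auto
  show "line_differentiable v g z" if "z \<in> V" "v \<in> real_directions N" for z v
    using smooth_on_differentiable[OF f(1) that] dir_deriv_cong(2)[OF V that, of f g] f(2) by auto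
  show "\<exists>h. (\<exists>f. smooth_on N V f \<and> (\<forall>z\<in>V. f z = h z)) \<and> (\<forall>z\<in>V. dir_deriv v g z = h z)"
    if "v \<in> real_directions N" for v
    using smooth_on_dir_deriv[OF f(1) that] dir_deriv_cong(1)[OF V _ that, of _ f g] f(2) by fastforce
qed

lemma smooth_on_subset: "smooth_on N V f \<Longrightarrow> W \<subseteq> V \<Longrightarrow> smooth_on N W f"
  unfolding smooth_on_def by (meson continuous_on_subset subsetD)

text \<open>For functions that have a formula only near each point, such as a trace computed in a
  frame that is chosen pointwise.\<close>

lemma smooth_on_local:
  assumes "\<And>z. z \<in> V \<Longrightarrow> \<exists>W. openin (top_of_set V) W \<and> z \<in> W \<and> smooth_on N W f"
  shows "smooth_on N V f"
  unfolding smooth_on_altdef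
proof (intro allI impI conjI ballI)
  fix vs :: "(complex ^ 'a) list" assume vs: "set vs \<subseteq> real_directions N"
  show "continuous_on V (foldr dir_deriv vs f)"
    unfolding continuous_on_eq_continuous_within
  proof
    fix z assume "z \<in> V"
    then obtain W where W: "openin (top_of_set V) W" "z \<in> W" "smooth_on N W f" using assms by blast
    then have "continuous_on W (foldr dir_deriv vs f)" using vs by (auto simp: smooth_on_altdef)
    then have "continuous (at z within W) (foldr dir_deriv vs f)"
      using W by (auto simp: continuous_on_eq_continuous_within)
    moreover have "at z within W = at z within V"
    proof -
      obtain U where U: "open U" "W = V \<inter> U" using W(1) by (auto simp: openin_open)
      show ?thesis
        using U W(2) by (intro at_within_nhd[of z U]) auto
    qed
    ultimately show "continuous (at z within V) (foldr dir_deriv vs f)"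
      by (simp add: continuous_within)
  qed
  show "line_differentiable v (foldr dir_deriv vs f) z" if "z \<in> V" "v \<in> real_directions N" for z v
    using assms[OF that(1)] that vs by (auto simp: smooth_on_altdef)
qed

section \<open>Closure properties of smooth functions\<close>

lemma dir_deriv_const: "dir_deriv v (\<lambda>_. c) z = 0" "line_differentiable v (\<lambda>_. c) z"
  using line_differentiableI[of "\<lambda>_. c" z v 0] by auto

lemma dir_deriv_add:
  assumes "line_differentiable v f z" "line_differentiable v g z"
  shows "dir_deriv v (\<lambda>w. f w + g w) z = dir_deriv v f z + dir_deriv v g z"
    "line_differentiable v (\<lambda>w. f w + g w) z"
proof -
  have "((\<lambda>t::real. f (z + t *\<^sub>R v) + g (z + t *\<^sub>R v)) has_vector_derivative
      (dir_deriv v f z + dir_deriv v g z)) (at 0)"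
    using assms[unfolded line_differentiable_iff] by (intro has_vector_derivative_add)
  from line_differentiableI[of "\<lambda>w. f w + g w", OF this]
  show "dir_deriv v (\<lambda>w. f w + g w) z = dir_deriv v f z + dir_deriv v g z"
    "line_differentiable v (\<lambda>w. f w + g w) z" by auto
qed

lemma dir_deriv_mult:
  assumes "line_differentiable v f z" "line_differentiable v g z"
  shows "dir_deriv v (\<lambda>w. f w * g w) z = dir_deriv v f z * g z + f z * dir_deriv v g z"
    "line_differentiable v (\<lambda>w. f w * g w) z"
proof -
  have "((\<lambda>t::real. f (z + t *\<^sub>R v) * g (z + t *\<^sub>R v)) has_vector_derivative
      (f z * dir_deriv v g z + dir_deriv v f z * g z)) (at 0)"
    using has_vector_derivative_mult[OF assms[unfolded line_differentiable_iff]] by simp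
  from line_differentiableI[of "\<lambda>w. f w * g w", OF this]
  show "dir_deriv v (\<lambda>w. f w * g w) z = dir_deriv v f z * g z + f z * dir_deriv v g z"
    "line_differentiable v (\<lambda>w. f w * g w) z" by auto
qed

lemma dir_deriv_cnj:
  assumes "line_differentiable v f z"
  shows "dir_deriv v (\<lambda>w. cnj (f w)) z = cnj (dir_deriv v f z)"
    "line_differentiable v (\<lambda>w. cnj (f w)) z"
proof -
  have "((\<lambda>t::real. cnj (f (z + t *\<^sub>R v))) has_vector_derivative cnj (dir_deriv v f z)) (at 0)"
    using assms[unfolded line_differentiable_iff] by (intro has_vector_derivative_cnj)
  from line_differentiableI[of "\<lambda>w. cnj (f w)", OF this]
  show "dir_deriv v (\<lambda>w. cnj (f w)) z = cnj (dir_deriv v f z)"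
    "line_differentiable v (\<lambda>w. cnj (f w)) z" by auto
qed

lemma smooth_on_const:
  assumes V: "openin (top_of_set (model_space N)) V"
  shows "smooth_on N V (\<lambda>_. c)"
  by (rule smooth_on_coinduct[OF V, of "\<lambda>f. \<exists>c. f = (\<lambda>_. c)"]) (auto simp: dir_deriv_const)

text \<open>The derivative of a product is a sum of two products, so products alone are not closed
  under differentiation; sums of products are, which makes them a class for
  \<open>smooth_on_coinduct\<close>.\<close>

inductive product_span ::
  "((complex ^ 'n::finite \<Rightarrow> complex) \<Rightarrow> bool) \<Rightarrow> (complex ^ 'n \<Rightarrow> complex) \<Rightarrow> bool" for P where
  prod: "P f \<Longrightarrow> P g \<Longrightarrow> product_span P (\<lambda>z. f z * g z)"
| add: "product_span P f \<Longrightarrow> product_span P g \<Longrightarrow> product_span P (\<lambda>z. f z + g z)"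

lemma smooth_on_product_span:
  assumes V: "openin (top_of_set (model_space N)) V" and f: "product_span (smooth_on N V) f"
  shows "smooth_on N V f"
proof (rule smooth_on_coinduct[OF V, of "product_span (smooth_on N V)", OF f])
  fix f assume f: "product_span (smooth_on N V) f"
  then show "continuous_on V f"
    by induction (auto intro!: continuous_intros dest: smooth_on_continuous)
  show diff: "line_differentiable v f z" if "z \<in> V" "v \<in> real_directions N" for z v
    using f that by induction (auto intro!: dir_deriv_mult dir_deriv_add dest: smooth_on_differentiable)
  show "\<exists>h. product_span (smooth_on N V) h \<and> (\<forall>z\<in>V. dir_deriv v f z = h z)"
    if v: "v \<in> real_directions N" for v
    using f
  proof induction
    case (prod f g)
    then have "product_span (smooth_on N V) (\<lambda>z. dir_deriv v f z * g z + f z * dir_deriv v g z)"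
      by (intro product_span.intros smooth_on_dir_deriv v)
    moreover have "\<forall>z\<in>V. dir_deriv v (\<lambda>z. f z * g z) z = dir_deriv v f z * g z + f z * dir_deriv v g z"
      using prod v by (auto intro!: dir_deriv_mult dest: smooth_on_differentiable)
    ultimately show ?case by blast
  next
    case (add f g)
    have diff: "line_differentiable v f z" if "product_span (smooth_on N V) f" "z \<in> V" for f z
      using that v by induction (auto intro!: dir_deriv_mult dir_deriv_add dest: smooth_on_differentiable)
    from add obtain h h' where "product_span (smooth_on N V) h" "\<forall>z\<in>V. dir_deriv v f z = h z"
      "product_span (smooth_on N V) h'" "\<forall>z\<in>V. dir_deriv v g z = h' z" by auto
    then show ?case using add diff
      by (intro exI[of _ "\<lambda>z. h z + h' z"]) (auto simp: dir_deriv_add intro: product_span.add)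
  qed
qed

context
  fixes N :: "'n::finite set" and V :: "(complex ^ 'n) set"
  assumes V: "openin (top_of_set (model_space N)) V"
begin

lemma smooth_on_mult: "smooth_on N V f \<Longrightarrow> smooth_on N V g \<Longrightarrow> smooth_on N V (\<lambda>z. f z * g z)"
  by (rule smooth_on_product_span[OF V], rule product_span.prod)

lemma smooth_on_add:
  assumes "smooth_on N V f" "smooth_on N V g"
  shows "smooth_on N V (\<lambda>z. f z + g z)"
proof -
  \<comment> \<open>The span is generated by products of two functions, hence the factors
    \<open>1\<close>.\<close>
  have "product_span (smooth_on N V) (\<lambda>z. f z * 1 + g z * 1)"
    using assms by (intro product_span.intros smooth_on_const[OF V])
  then show ?thesis using smooth_on_product_span[OF V] by auto
qed

lemma smooth_on_sum:
  "(\<And>i. i \<in> I \<Longrightarrow> smooth_on N V (f i)) \<Longrightarrow> smooth_on N V (\<lambda>z. \<Sum>i\<in>I. f i z)"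
  by (induction I rule: infinite_finite_induct) (auto intro: smooth_on_const[OF V] smooth_on_add)

lemma smooth_on_uminus: "smooth_on N V f \<Longrightarrow> smooth_on N V (\<lambda>z. - f z)"
  using smooth_on_mult[OF smooth_on_const[OF V, of "-1"], of f] by simp

lemma smooth_on_diff:
  "smooth_on N V f \<Longrightarrow> smooth_on N V g \<Longrightarrow> smooth_on N V (\<lambda>z. f z - g z)"
  using smooth_on_add[OF _ smooth_on_uminus, of f g] by simp

lemma smooth_on_wirt_bar: "i \<in> N \<Longrightarrow> smooth_on N V f \<Longrightarrow> smooth_on N V (wirt_bar i f)"
  unfolding wirt_bar_def[abs_def] divide_inverse
  by (intro smooth_on_mult smooth_on_add smooth_on_const[OF V] smooth_on_dir_deriv real_directions_axis)

end

section \<open>Total differentiability and the chain rule\<close>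

lemma sum_real_directions:
  assumes h: "h \<in> model_space N"
  shows "(\<Sum>b\<in>real_directions N. (h \<bullet> b) *\<^sub>R b) = h"
proof -
  have "(\<Sum>b\<in>real_directions N. (h \<bullet> b) *\<^sub>R b) = (\<Sum>b\<in>Basis. (h \<bullet> b) *\<^sub>R b)"
  proof (rule sum.mono_neutral_left)
    show "\<forall>b\<in>Basis - real_directions N. (h \<bullet> b) *\<^sub>R b = 0"
    proof
      fix b :: "complex ^ 'a" assume b: "b \<in> Basis - real_directions N"
      then obtain i e where "b = axis i e" "e \<in> {1, \<i>}"
        by (auto simp: Basis_vec_def Basis_complex_def)
      with b have "i \<notin> N" by (auto simp: real_directions_def)
      with h have "h $ i = 0" by (auto simp: model_space_def)
      then show "(h \<bullet> b) *\<^sub>R b = 0" using \<open>b = axis i e\<close> by (simp add: inner_axis)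
    qed
  qed (auto simp: real_directions_subset_Basis)
  also have "\<dots> = h" by (rule euclidean_representation)
  finally show ?thesis .
qed

text \<open>Mean value inequality for \<open>f (q + s e) - s D\<close> as a function of
  \<open>s\<close>, whose derivative is bounded by \<open>B\<close> along the segment. Both the
  existence of total derivatives and the symmetry of mixed derivatives are reduced to this
  estimate.\<close>

lemma segment_bound:
  assumes diff: "\<And>s. \<bar>s\<bar> \<le> \<bar>c\<bar> \<Longrightarrow> line_differentiable e f (q + s *\<^sub>R e)"
    and bd: "\<And>s. \<bar>s\<bar> \<le> \<bar>c\<bar> \<Longrightarrow> norm (dir_deriv e f (q + s *\<^sub>R e) - D) \<le> B"
  shows "norm (f (q + c *\<^sub>R e) - f q - c *\<^sub>R D) \<le> B * \<bar>c\<bar>"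
proof -
  define g where "g = (\<lambda>s::real. f (q + s *\<^sub>R e) - s *\<^sub>R D)"
  have der: "(g has_vector_derivative (dir_deriv e f (q + s *\<^sub>R e) - D)) (at s)" if "\<bar>s\<bar> \<le> \<bar>c\<bar>" for s
  proof -
    have "((\<lambda>t. f (q + s *\<^sub>R e + t *\<^sub>R e)) has_vector_derivative dir_deriv e f (q + s *\<^sub>R e)) (at (s - s))"
      using diff[OF that] by (simp add: line_differentiable_iff)
    moreover have "((\<lambda>u. u - s) has_vector_derivative 1) (at s)"
      by (auto intro!: derivative_eq_intros)
    ultimately have "((\<lambda>t. f (q + s *\<^sub>R e + t *\<^sub>R e)) \<circ> (\<lambda>u. u - s) has_vector_derivative
        1 *\<^sub>R dir_deriv e f (q + s *\<^sub>R e)) (at s)"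
      by (intro vector_diff_chain_at) auto
    then have "((\<lambda>t. f (q + t *\<^sub>R e)) has_vector_derivative dir_deriv e f (q + s *\<^sub>R e)) (at s)"
      by (simp add: o_def algebra_simps)
    then show ?thesis unfolding g_def
      by (auto intro!: derivative_eq_intros)
  qed
  have "norm (g c - g 0) \<le> B * norm (c - 0)"
  proof (rule differentiable_bound[of "closed_segment 0 c" g "\<lambda>s t. t *\<^sub>R (dir_deriv e f (q + s *\<^sub>R e) - D)" B])
    fix s assume "s \<in> closed_segment 0 c"
    then have s: "\<bar>s\<bar> \<le> \<bar>c\<bar>" by (auto simp: closed_segment_eq_real_ivl split: if_splits)
    show "(g has_derivative (\<lambda>t. t *\<^sub>R (dir_deriv e f (q + s *\<^sub>R e) - D))) (at s within closed_segment 0 c)"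
      using der[OF s] by (auto simp: has_vector_derivative_def intro: has_derivative_at_withinI)
    have "0 \<le> B" using bd[OF s] norm_ge_zero order_trans by blast
    then show "onorm (\<lambda>t. t *\<^sub>R (dir_deriv e f (q + s *\<^sub>R e) - D)) \<le> B"
      using bd[OF s] by (intro onorm_le) (auto simp: mult.commute[of B] intro: mult_left_mono)
  qed auto
  then show ?thesis by (simp add: g_def algebra_simps)
qed

text \<open>Continuous partial derivatives give a total derivative: \<open>z\<close> is joined to
  \<open>y\<close> by a path that changes one real coordinate at a time, and the mean value estimate
  is applied on each leg. The limit is taken within the model space because \<open>V\<close> is open
  only there.\<close>

lemma smooth_on_has_derivative:
  assumes V: "openin (top_of_set (model_space N)) V" and f: "smooth_on N V f" and z: "z \<in> V"
  shows "(f has_derivative (\<lambda>h. \<Sum>b\<in>real_directions N. (h \<bullet> b) *\<^sub>R dir_deriv b f z))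
    (at z within model_space N)"
  unfolding has_derivative_within_alt
proof (intro conjI allI impI)
  show "bounded_linear (\<lambda>h. \<Sum>b\<in>real_directions N. (h \<bullet> b) *\<^sub>R dir_deriv b f z)"
    by (intro bounded_linear_intros)
  fix e :: real assume e: "e > 0"
  define I where "I = real_directions N"
  have fin: "finite I" by (simp add: I_def finite_real_directions)
  \<comment> \<open>There are \<open>card I\<close> legs with an error of at most
    \<open>B * norm h\<close> each; the summand \<open>1\<close> covers dimension 0.\<close>
  define B where "B = e / (card I + 1)"
  have B: "B > 0" using e by (simp add: B_def)
  obtain U where U: "open U" "V = model_space N \<inter> U" using V by (auto simp: openin_open)
  have zm: "z \<in> model_space N" using U z by auto
  have "eventually (\<lambda>w. w \<in> V) (at z within model_space N)"
    using U z by (auto simp: eventually_at_topological)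
  moreover have "\<forall>b\<in>I. eventually (\<lambda>w. norm (dir_deriv b f w - dir_deriv b f z) < B) (at z within model_space N)"
  proof
    fix b assume "b \<in> I"
    then have "continuous_on V (dir_deriv b f)"
      using f by (auto simp: I_def intro: smooth_on_continuous smooth_on_dir_deriv)
    then have "(dir_deriv b f \<longlongrightarrow> dir_deriv b f z) (at z within V)"
      using z by (auto simp: continuous_on_def)
    moreover have "at z within V = at z within model_space N"
      using U z by (intro at_within_nhd[of z U]) auto
    ultimately show "eventually (\<lambda>w. norm (dir_deriv b f w - dir_deriv b f z) < B) (at z within model_space N)"
      using tendstoD[OF _ B] by (fastforce simp: dist_norm)
  qed
  then have "eventually (\<lambda>w. \<forall>b\<in>I. norm (dir_deriv b f w - dir_deriv b f z) < B) (at z within model_space N)"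
    using fin by (simp add: eventually_ball_finite)
  ultimately have "eventually (\<lambda>w. w \<in> V \<and> (\<forall>b\<in>I. norm (dir_deriv b f w - dir_deriv b f z) < B))
      (at z within model_space N)"
    by (rule eventually_conj)
  then obtain d where d: "d > 0" "\<And>w. w \<in> model_space N \<Longrightarrow> dist w z < d \<Longrightarrow>
      w \<in> V \<and> (\<forall>b\<in>I. norm (dir_deriv b f w - dir_deriv b f z) < B)"
    unfolding eventually_at using z B by (metis cancel_comm_monoid_add_class.diff_cancel norm_zero)
  show "\<exists>d>0. \<forall>y\<in>model_space N. norm (y - z) < d \<longrightarrow>
      norm (f y - f z - (\<Sum>b\<in>real_directions N. ((y - z) \<bullet> b) *\<^sub>R dir_deriv b f z)) \<le> e * norm (y - z)"
  \<comment> \<open>All points of the path lie within \<open>(card I + 1) * norm h\<close> of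
    \<open>z\<close>, so this radius keeps them in the ball of radius \<open>d\<close>.\<close>
  proof (intro exI[of _ "d / (card I + 1)"] conjI ballI impI)
    fix y assume y: "y \<in> model_space N" and yz: "norm (y - z) < d / (card I + 1)"
    define h where "h = y - z"
    have hm: "h \<in> model_space N" using y zm by (auto simp: h_def model_space_def)
    have hb: "\<bar>h \<bullet> b\<bar> \<le> norm h" if "b \<in> I" for b
      using that real_directions_subset_Basis by (auto simp: I_def intro!: Basis_le_norm)
    \<comment> \<open>The corner of the path that is reached after moving in the directions of
      \<open>D\<close>.\<close>
    define p where "p D = z + (\<Sum>b\<in>D. (h \<bullet> b) *\<^sub>R b)" for D
    have step: "norm (f (p D) - f z - (\<Sum>b\<in>D. (h \<bullet> b) *\<^sub>R dir_deriv b f z)) \<le> card D * (B * norm h)"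
      if "D \<subseteq> I" for D
      using finite_subset[OF that fin] that
    proof (induction D rule: finite_induct)
      case empty
      then show ?case by (simp add: p_def)
    next
      case (insert b D)
      have bI: "b \<in> I" and DI: "D \<subseteq> I" using insert by auto
      have pin: "p D + s *\<^sub>R b \<in> V \<and> norm (dir_deriv b f (p D + s *\<^sub>R b) - dir_deriv b f z) < B"
        if "\<bar>s\<bar> \<le> \<bar>h \<bullet> b\<bar>" for s
      proof -
        have 1: "p D + s *\<^sub>R b \<in> model_space N"
          using bI DI zm unfolding p_def I_def
          by (intro model_space_add model_space_sum model_space_scaleR)
            (auto intro: real_directions_in_model_space)
        have nb: "norm b' = 1" if "b' \<in> I" for b'
          using that real_directions_subset_Basis norm_Basis by (auto simp: I_def)
        have "norm (p D + s *\<^sub>R b - z) = norm ((\<Sum>b\<in>D. (h \<bullet> b) *\<^sub>R b) + s *\<^sub>R b)"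
          by (simp add: p_def)
        also have "\<dots> \<le> (\<Sum>b\<in>D. norm ((h \<bullet> b) *\<^sub>R b)) + norm (s *\<^sub>R b)"
          by (rule order_trans[OF norm_triangle_ineq add_right_mono[OF norm_sum]])
        also have "\<dots> \<le> (\<Sum>b\<in>D. norm h) + norm h"
          using order_trans[OF that hb[OF bI]] hb DI nb bI by (intro add_mono sum_mono) (auto simp: subset_eq)
        also have "\<dots> = (card D + 1) * norm h" by (simp add: algebra_simps)
        also have "\<dots> \<le> (card I + 1) * norm h"
          using DI fin by (intro mult_right_mono) (auto intro: card_mono)
        also have "\<dots> < d" using yz by (simp add: h_def field_simps)
        finally have "dist (p D + s *\<^sub>R b) z < d" by (simp add: dist_norm)
        then show ?thesis using d(2)[OF 1] bI by blast
      qed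
      have "norm (f (p D + (h \<bullet> b) *\<^sub>R b) - f (p D) - (h \<bullet> b) *\<^sub>R dir_deriv b f z) \<le> B * \<bar>h \<bullet> b\<bar>"
        using pin bI f by (intro segment_bound) (auto simp: I_def intro: smooth_on_differentiable less_imp_le)
      also have "\<dots> \<le> B * norm h" using hb[OF bI] B by (intro mult_left_mono) auto
      finally have 1: "norm (f (p D + (h \<bullet> b) *\<^sub>R b) - f (p D) - (h \<bullet> b) *\<^sub>R dir_deriv b f z) \<le> B * norm h" .
      have 2: "p (insert b D) = p D + (h \<bullet> b) *\<^sub>R b"
        using insert by (simp add: p_def algebra_simps)
      have "f (p (insert b D)) - f z - (\<Sum>b\<in>insert b D. (h \<bullet> b) *\<^sub>R dir_deriv b f z) =
          (f (p D + (h \<bullet> b) *\<^sub>R b) - f (p D) - (h \<bullet> b) *\<^sub>R dir_deriv b f z) +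
          (f (p D) - f z - (\<Sum>b\<in>D. (h \<bullet> b) *\<^sub>R dir_deriv b f z))"
        using insert by (simp add: 2)
      also have "norm \<dots> \<le> B * norm h + card D * (B * norm h)"
        using 1 insert.IH[OF DI] by (intro norm_triangle_mono)
      also have "\<dots> = card (insert b D) * (B * norm h)" using insert by (simp add: algebra_simps)
      finally show ?case .
    qed
    have "p I = y" using sum_real_directions[OF hm] by (simp add: p_def I_def h_def)
    then have "norm (f y - f z - (\<Sum>b\<in>I. (h \<bullet> b) *\<^sub>R dir_deriv b f z)) \<le> card I * (B * norm h)"
      using step[of I] by simp
    also have "\<dots> \<le> e * norm h"
      using e by (simp add: B_def field_simps)
    finally show "norm (f y - f z - (\<Sum>b\<in>real_directions N. ((y - z) \<bullet> b) *\<^sub>R dir_deriv b f z)) \<le> e * norm (y - z)"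
      by (simp add: I_def h_def)
  qed (use d in simp)
qed

text \<open>Directional derivatives only see straight lines, whereas a change of charts turns a
  coordinate line into a curve; total differentiability covers such curves as long as they stay in
  \<open>V\<close>.\<close>

lemma smooth_on_chain:
  assumes V: "openin (top_of_set (model_space N)) V" and f: "smooth_on N V f"
    and \<gamma>: "(\<gamma> has_vector_derivative \<gamma>') (at (0::real))"
    and in_V: "eventually (\<lambda>t. \<gamma> t \<in> V) (nhds 0)"
  shows "((\<lambda>t. f (\<gamma> t)) has_vector_derivative
      (\<Sum>b\<in>real_directions N. (\<gamma>' \<bullet> b) *\<^sub>R dir_deriv b f (\<gamma> 0))) (at 0)"
proof -
  obtain S where S: "open S" "0 \<in> S" "\<And>t. t \<in> S \<Longrightarrow> \<gamma> t \<in> V"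
    using in_V unfolding eventually_nhds by auto
  have VN: "V \<subseteq> model_space N" using V by (auto simp: openin_open)
  have 1: "(f has_derivative (\<lambda>h. \<Sum>b\<in>real_directions N. (h \<bullet> b) *\<^sub>R dir_deriv b f (\<gamma> 0)))
      (at (\<gamma> 0) within \<gamma> ` S)"
    by (rule has_derivative_subset[OF smooth_on_has_derivative[OF V f]]) (use S VN in auto)
  have 2: "(\<gamma> has_derivative (\<lambda>t. t *\<^sub>R \<gamma>')) (at 0 within S)"
    using \<gamma> unfolding has_vector_derivative_def by (rule has_derivative_at_withinI)
  from has_derivative_in_compose[OF 2 1] have "((\<lambda>t. f (\<gamma> t)) has_derivative
      (\<lambda>t. \<Sum>b\<in>real_directions N. ((t *\<^sub>R \<gamma>') \<bullet> b) *\<^sub>R dir_deriv b f (\<gamma> 0))) (at 0)"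
    unfolding at_within_open[OF S(2,1)] .
  then show ?thesis
    unfolding has_vector_derivative_def scaleR_sum_right inner_scaleR_left scaleR_scaleR .
qed

lemma inner_axis_complex: "h \<bullet> axis i (1::complex) = Re (h $ i)" "h \<bullet> axis i \<i> = Im (h $ i)"
  by (simp_all add: inner_axis inner_complex_def)

lemma sum_over_real_directions:
  fixes N :: "'n::finite set"
  shows "(\<Sum>b\<in>real_directions N. g b) = (\<Sum>i\<in>N. g (axis i 1) + g (axis i \<i>))"
proof -
  have "(\<Sum>b\<in>real_directions N. g b) =
      (\<Sum>b\<in>(\<lambda>i::'n. axis i 1) ` N. g b) + (\<Sum>b\<in>(\<lambda>i::'n. axis i \<i>) ` N. g b)"
    unfolding real_directions_def by (rule sum.union_disjoint) (auto simp: axis_eq_axis)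
  also have "\<dots> = (\<Sum>i\<in>N. g (axis i 1)) + (\<Sum>i\<in>N. g (axis i \<i>))"
    by (intro arg_cong2[where f = "(+)"]; subst sum.reindex) (auto simp: inj_on_def axis_eq_axis)
  finally show ?thesis by (simp add: sum.distrib)
qed

text \<open>Here \<open>w\<close> stands for the complex derivative of a holomorphic coordinate,
  whose derivatives along \<open>1\<close> and \<open>\<i>\<close> are \<open>w\<close> and
  \<open>\<i> * w\<close>, and \<open>x\<close>, \<open>y\<close> for the two real partial
  derivatives of the outer function. The antiholomorphic derivative thus picks up the conjugate of
  \<open>w\<close>.\<close>

lemma chain_rule_coefficients:
  fixes w x y :: complex
  shows "(Re w *\<^sub>R x + Im w *\<^sub>R y + \<i> * (Re (\<i> * w) *\<^sub>R x + Im (\<i> * w) *\<^sub>R y)) / 2 =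
    cnj w * ((x + \<i> * y) / 2)"
  by (simp add: complex_eq_iff algebra_simps)

lemma dir_deriv_wirt:
  "dir_deriv (axis i 1) f z = wirt i f z + wirt_bar i f z"
  "dir_deriv (axis i \<i>) f z = \<i> * (wirt i f z - wirt_bar i f z)"
  by (simp_all add: wirt_def wirt_bar_def field_simps)

text \<open>As \<tau> is holomorphic, the terms with holomorphic derivatives of \<open>f\<close>
  drop out of the chain rule.\<close>

lemma wirt_bar_compose:
  fixes V W :: "(complex ^ 'n::finite) set"
  assumes V: "openin (top_of_set (model_space N)) V" and f: "smooth_on N V f"
    and W: "openin (top_of_set (model_space N)) W" and z: "z \<in> W" and b: "b \<in> N"
    and \<tau>: "\<And>a. a \<in> N \<Longrightarrow> hol_on N W (\<lambda>w. \<tau> w $ a)"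
    and \<tau>V: "\<And>w. w \<in> W \<Longrightarrow> \<tau> w \<in> V"
  shows "wirt_bar b (\<lambda>w. f (\<tau> w)) z = (\<Sum>a\<in>N. cnj (wirt b (\<lambda>w. \<tau> w $ a) z) * wirt_bar a f (\<tau> z))"
    and "\<And>v. v \<in> real_directions N \<Longrightarrow> line_differentiable v (\<lambda>w. f (\<tau> w)) z"
proof -
  have VN: "V \<subseteq> model_space N" using V by (auto simp: openin_open)
  have chain: "((\<lambda>t::real. f (\<tau> (z + t *\<^sub>R v))) has_vector_derivative
     (\<Sum>a\<in>N. Re (dir_deriv v (\<lambda>w. \<tau> w $ a) z) *\<^sub>R dir_deriv (axis a 1) f (\<tau> z)
        + Im (dir_deriv v (\<lambda>w. \<tau> w $ a) z) *\<^sub>R dir_deriv (axis a \<i>) f (\<tau> z))) (at 0)"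
    if v: "v \<in> real_directions N" for v
  proof -
    have inV: "eventually (\<lambda>t::real. \<tau> (z + t *\<^sub>R v) \<in> V) (nhds 0)"
      using line_eventually_in[OF W z v] by eventually_elim (rule \<tau>V)
    \<comment> \<open>Holomorphy is assumed for the coordinates in \<open>N\<close> only; the others
      vanish on \<open>W\<close>, because \<tau> maps into \<open>V\<close>, a subset of the model
      space.\<close>
    define \<gamma>' :: "complex ^ 'n" where "\<gamma>' = (\<chi> a. if a \<in> N then dir_deriv v (\<lambda>w. \<tau> w $ a) z else 0)"
    have "((\<lambda>t::real. \<tau> (z + t *\<^sub>R v)) has_vector_derivative \<gamma>') (at 0)"
      unfolding has_vector_derivative_def
    proof (subst has_derivative_componentwise_within, intro ballI)
      fix e :: "complex ^ 'n" assume "e \<in> Basis"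
      then obtain a c where e: "e = axis a c" by (auto simp: Basis_vec_def)
      have "((\<lambda>t::real. \<tau> (z + t *\<^sub>R v) $ a) has_vector_derivative \<gamma>' $ a) (at 0)"
      proof (cases "a \<in> N")
        case True
        then show ?thesis using \<tau>[OF True] z v unfolding \<gamma>'_def hol_on_def
          by (auto dest!: smooth_on_differentiable simp: line_differentiable_iff)
      next
        case False
        have "eventually (\<lambda>t::real. \<tau> (z + t *\<^sub>R v) $ a = 0) (nhds 0)"
          using inV by eventually_elim (use False VN in \<open>auto simp: model_space_def\<close>)
        moreover have "((\<lambda>t::real. 0) has_vector_derivative \<gamma>' $ a) (at 0)"
          using False by (simp add: \<gamma>'_def)
        ultimately show ?thesis
          by (subst has_vector_derivative_cong_ev[where g = "\<lambda>_. 0"])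
            (auto dest: eventually_nhds_x_imp_x elim: eventually_mono)
      qed
      then show "((\<lambda>t. \<tau> (z + t *\<^sub>R v) \<bullet> e) has_derivative (\<lambda>t. (t *\<^sub>R \<gamma>') \<bullet> e)) (at 0)"
        unfolding e inner_axis has_vector_derivative_def
        by (auto intro!: derivative_eq_intros)
    qed
    from smooth_on_chain[OF V f this inV] show ?thesis
      by (simp add: sum_over_real_directions inner_axis_complex \<gamma>'_def)
  qed
  show "\<And>v. v \<in> real_directions N \<Longrightarrow> line_differentiable v (\<lambda>w. f (\<tau> w)) z"
    by (rule line_differentiableI(1)[OF chain])
  note dd = line_differentiableI(2)[OF chain]
  have d1: "dir_deriv (axis b 1) (\<lambda>w. \<tau> w $ a) z = wirt b (\<lambda>w. \<tau> w $ a) z"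
    "dir_deriv (axis b \<i>) (\<lambda>w. \<tau> w $ a) z = \<i> * wirt b (\<lambda>w. \<tau> w $ a) z" if "a \<in> N" for a
    using \<tau>[OF that] z b by (simp_all add: dir_deriv_wirt hol_on_def)
  have "wirt_bar b (\<lambda>w. f (\<tau> w)) z =
     (\<Sum>a\<in>N. (Re (dir_deriv (axis b 1) (\<lambda>w. \<tau> w $ a) z) *\<^sub>R dir_deriv (axis a 1) f (\<tau> z)
        + Im (dir_deriv (axis b 1) (\<lambda>w. \<tau> w $ a) z) *\<^sub>R dir_deriv (axis a \<i>) f (\<tau> z)
        + \<i> * (Re (dir_deriv (axis b \<i>) (\<lambda>w. \<tau> w $ a) z) *\<^sub>R dir_deriv (axis a 1) f (\<tau> z)
        + Im (dir_deriv (axis b \<i>) (\<lambda>w. \<tau> w $ a) z) *\<^sub>R dir_deriv (axis a \<i>) f (\<tau> z))) / 2)"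
    unfolding wirt_bar_def dd[OF real_directions_axis(1)[OF b]] dd[OF real_directions_axis(2)[OF b]]
    by (simp only: sum.distrib[symmetric] sum_distrib_left sum_divide_distrib)
  also have "\<dots> = (\<Sum>a\<in>N. cnj (wirt b (\<lambda>w. \<tau> w $ a) z) * wirt_bar a f (\<tau> z))"
  proof (rule sum.cong[OF refl])
    fix a assume a: "a \<in> N"
    show "(Re (dir_deriv (axis b 1) (\<lambda>w. \<tau> w $ a) z) *\<^sub>R dir_deriv (axis a 1) f (\<tau> z)
        + Im (dir_deriv (axis b 1) (\<lambda>w. \<tau> w $ a) z) *\<^sub>R dir_deriv (axis a \<i>) f (\<tau> z)
        + \<i> * (Re (dir_deriv (axis b \<i>) (\<lambda>w. \<tau> w $ a) z) *\<^sub>R dir_deriv (axis a 1) f (\<tau> z)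
        + Im (dir_deriv (axis b \<i>) (\<lambda>w. \<tau> w $ a) z) *\<^sub>R dir_deriv (axis a \<i>) f (\<tau> z))) / 2 =
      cnj (wirt b (\<lambda>w. \<tau> w $ a) z) * wirt_bar a f (\<tau> z)"
      unfolding d1[OF a] wirt_bar_def by (rule chain_rule_coefficients)
  qed
  finally show "wirt_bar b (\<lambda>w. f (\<tau> w)) z = (\<Sum>a\<in>N. cnj (wirt b (\<lambda>w. \<tau> w $ a) z) * wirt_bar a f (\<tau> z))" .
qed

text \<open>The second difference \<open>f (z + s u + s v) - f (z + s u) - f (z + s v) + f z\<close> is symmetric in
  \<open>u\<close> and \<open>v\<close> and is \<open>s\<^sup>2\<close> times the mixed derivative, up to \<open>o(s\<^sup>2)\<close>.\<close>

lemma second_difference: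
  assumes V: "openin (top_of_set (model_space N)) V" and f: "smooth_on N V f" and z: "z \<in> V"
    and u: "u \<in> real_directions N" and v: "v \<in> real_directions N" and e: "e > 0"
  shows "eventually (\<lambda>s. norm (f (z + s *\<^sub>R u + s *\<^sub>R v) - f (z + s *\<^sub>R u) - f (z + s *\<^sub>R v) + f z
      - s ^ 2 *\<^sub>R dir_deriv v (dir_deriv u f) z) \<le> e * s ^ 2) (at_right (0::real))"
proof -
  let ?p = "dir_deriv v (dir_deriv u f)"
  have "continuous_on V ?p"
    using f u v by (auto intro!: smooth_on_continuous smooth_on_dir_deriv)
  then have "(?p \<longlongrightarrow> ?p z) (at z within V)" using z by (auto simp: continuous_on_def)
  from tendstoD[OF this e] obtain d where d: "d > 0"
    "\<And>w. w \<in> V \<Longrightarrow> dist w z < d \<Longrightarrow> norm (?p w - ?p z) < e"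
    unfolding eventually_at using z e by (metis dist_norm dist_self)
  obtain U where U: "open U" "V = model_space N \<inter> U" using V by (auto simp: openin_open)
  obtain d' where d': "d' > 0" "ball z d' \<subseteq> U" using U z by (meson IntD2 open_contains_ball)
  \<comment> \<open>Half the radius, as two steps of length less than \<open>r\<close> lead away
    from \<open>z\<close>.\<close>
  define r where "r = min d d' / 2"
  have r: "r > 0" using d d' by (simp add: r_def)
  have nuv: "norm u = 1" "norm v = 1" using u v real_directions_subset_Basis norm_Basis by blast+
  have zm: "z \<in> model_space N" using U z by auto
  have near: "z + \<sigma> *\<^sub>R u + t *\<^sub>R v \<in> V \<and> norm (?p (z + \<sigma> *\<^sub>R u + t *\<^sub>R v) - ?p z) < e"
    if "\<bar>\<sigma>\<bar> < r" "\<bar>t\<bar> < r" for \<sigma> t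
  proof -
    have "dist (z + \<sigma> *\<^sub>R u + t *\<^sub>R v) z \<le> \<bar>\<sigma>\<bar> + \<bar>t\<bar>"
      using norm_triangle_ineq[of "\<sigma> *\<^sub>R u" "t *\<^sub>R v"] nuv by (simp add: dist_norm add.assoc)
    then have dd: "dist (z + \<sigma> *\<^sub>R u + t *\<^sub>R v) z < min d d'" using that by (simp add: r_def)
    have "z + \<sigma> *\<^sub>R u + t *\<^sub>R v \<in> model_space N"
      using zm u v real_directions_in_model_space by (blast intro: model_space_add model_space_scaleR)
    then have "z + \<sigma> *\<^sub>R u + t *\<^sub>R v \<in> V" using dd d' U by (auto simp: dist_commute subset_eq)
    then show ?thesis using d(2) dd by auto
  qed
  show ?thesis
    unfolding eventually_at_right_field
  proof (intro exI[of _ r] conjI allI impI r)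
    fix s assume s: "0 < s" "s < r"
    \<comment> \<open>The second difference is the increment of \<open>g\<close> along
      \<open>u\<close>. The mean value estimate is used twice: along \<open>u\<close> for
      \<open>g\<close>, and along \<open>v\<close> for \<open>dir_deriv u f\<close>, to bound the
      derivative of \<open>g\<close>.\<close>
    define g where "g = (\<lambda>w. f (w + s *\<^sub>R v) - f w)"
    have ld: "line_differentiable u f (z + \<sigma> *\<^sub>R u + t *\<^sub>R v)" if "\<bar>\<sigma>\<bar> < r" "\<bar>t\<bar> < r" for \<sigma> t
      using near[OF that] f u by (auto intro: smooth_on_differentiable)
    have g: "line_differentiable u g (z + \<sigma> *\<^sub>R u)"
      "dir_deriv u g (z + \<sigma> *\<^sub>R u) = dir_deriv u f (z + \<sigma> *\<^sub>R u + s *\<^sub>R v) - dir_deriv u f (z + \<sigma> *\<^sub>R u)"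
      if \<sigma>: "\<bar>\<sigma>\<bar> < r" for \<sigma>
    proof -
      have 1: "((\<lambda>t. f (z + \<sigma> *\<^sub>R u + s *\<^sub>R v + t *\<^sub>R u)) has_vector_derivative
          dir_deriv u f (z + \<sigma> *\<^sub>R u + s *\<^sub>R v)) (at 0)"
        using ld[of \<sigma> s] \<sigma> s by (simp add: line_differentiable_iff)
      have 2: "((\<lambda>t. f (z + \<sigma> *\<^sub>R u + t *\<^sub>R u)) has_vector_derivative dir_deriv u f (z + \<sigma> *\<^sub>R u)) (at 0)"
        using ld[of \<sigma> 0] \<sigma> r by (simp add: line_differentiable_iff)
      have "((\<lambda>t. g (z + \<sigma> *\<^sub>R u + t *\<^sub>R u)) has_vector_derivative
          dir_deriv u f (z + \<sigma> *\<^sub>R u + s *\<^sub>R v) - dir_deriv u f (z + \<sigma> *\<^sub>R u)) (at 0)"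
        using has_vector_derivative_diff[OF 1 2] by (simp add: g_def add_ac)
      from line_differentiableI[OF this]
      show "line_differentiable u g (z + \<sigma> *\<^sub>R u)"
        "dir_deriv u g (z + \<sigma> *\<^sub>R u) = dir_deriv u f (z + \<sigma> *\<^sub>R u + s *\<^sub>R v) - dir_deriv u f (z + \<sigma> *\<^sub>R u)"
        by auto
    qed
    have "norm (g (z + s *\<^sub>R u) - g z - s *\<^sub>R (s *\<^sub>R ?p z)) \<le> (e * \<bar>s\<bar>) * \<bar>s\<bar>"
    proof (rule segment_bound)
      fix \<sigma> assume "\<bar>\<sigma>\<bar> \<le> \<bar>s\<bar>"
      then have \<sigma>: "\<bar>\<sigma>\<bar> < r" using s by auto
      show "line_differentiable u g (z + \<sigma> *\<^sub>R u)" by (rule g[OF \<sigma>])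
      show "norm (dir_deriv u g (z + \<sigma> *\<^sub>R u) - s *\<^sub>R ?p z) \<le> e * \<bar>s\<bar>"
        unfolding g(2)[OF \<sigma>]
      proof (rule segment_bound)
        fix t assume "\<bar>t\<bar> \<le> \<bar>s\<bar>"
        then have t: "\<bar>t\<bar> < r" using s by auto
        show "line_differentiable v (dir_deriv u f) (z + \<sigma> *\<^sub>R u + t *\<^sub>R v)"
          using near[OF \<sigma> t] f u v by (auto intro!: smooth_on_differentiable smooth_on_dir_deriv)
        show "norm (?p (z + \<sigma> *\<^sub>R u + t *\<^sub>R v) - ?p z) \<le> e" using near[OF \<sigma> t] by auto
      qed
    qed
    then show "norm (f (z + s *\<^sub>R u + s *\<^sub>R v) - f (z + s *\<^sub>R u) - f (z + s *\<^sub>R v) + f z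
      - s ^ 2 *\<^sub>R ?p z) \<le> e * s ^ 2"
      using s by (simp add: g_def power2_eq_square algebra_simps)
  qed
qed

lemma dir_deriv_commute:
  assumes V: "openin (top_of_set (model_space N)) V" and f: "smooth_on N V f" and z: "z \<in> V"
    and u: "u \<in> real_directions N" and v: "v \<in> real_directions N"
  shows "dir_deriv v (dir_deriv u f) z = dir_deriv u (dir_deriv v f) z" (is "?p = ?q")
proof (rule ccontr)
  assume neq: "?p \<noteq> ?q"
  \<comment> \<open>Both mixed derivatives describe the same second difference up to
    \<open>e * s ^ 2\<close>, so they differ by at most \<open>2 * e\<close>, which is only half of
    their distance.\<close>
  define e where "e = norm (?p - ?q) / 4"
  have e: "e > 0" using neq by (simp add: e_def)
  have "eventually (\<lambda>s::real. s > 0 \<and>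
     norm (f (z + s *\<^sub>R u + s *\<^sub>R v) - f (z + s *\<^sub>R u) - f (z + s *\<^sub>R v) + f z - s ^ 2 *\<^sub>R ?p) \<le> e * s ^ 2 \<and>
     norm (f (z + s *\<^sub>R v + s *\<^sub>R u) - f (z + s *\<^sub>R v) - f (z + s *\<^sub>R u) + f z - s ^ 2 *\<^sub>R ?q) \<le> e * s ^ 2)
     (at_right 0)"
    by (intro eventually_conj second_difference[OF V f z u v e] second_difference[OF V f z v u e]
        eventually_at_right_less)
  then obtain s :: real where s: "s > 0"
     "norm (f (z + s *\<^sub>R u + s *\<^sub>R v) - f (z + s *\<^sub>R u) - f (z + s *\<^sub>R v) + f z - s ^ 2 *\<^sub>R ?p) \<le> e * s ^ 2"
     "norm (f (z + s *\<^sub>R v + s *\<^sub>R u) - f (z + s *\<^sub>R v) - f (z + s *\<^sub>R u) + f z - s ^ 2 *\<^sub>R ?q) \<le> e * s ^ 2"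
    using eventually_happens[of _ "at_right (0::real)"] by auto
  have "s ^ 2 * norm (?p - ?q) = norm (s ^ 2 *\<^sub>R (?p - ?q))" by simp
  also have "s ^ 2 *\<^sub>R (?p - ?q) =
    (f (z + s *\<^sub>R v + s *\<^sub>R u) - f (z + s *\<^sub>R v) - f (z + s *\<^sub>R u) + f z - s ^ 2 *\<^sub>R ?q) -
    (f (z + s *\<^sub>R u + s *\<^sub>R v) - f (z + s *\<^sub>R u) - f (z + s *\<^sub>R v) + f z - s ^ 2 *\<^sub>R ?p)"
    by (simp add: algebra_simps)
  also have "norm \<dots> \<le> e * s ^ 2 + e * s ^ 2"
    using s by (intro order_trans[OF norm_triangle_ineq4 add_mono])
  finally have "s ^ 2 * norm (?p - ?q) \<le> s ^ 2 * (2 * e)" by (simp add: algebra_simps)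
  then have "norm (?p - ?q) \<le> 2 * e" using s by simp
  then show False using neq by (simp add: e_def)
qed

section \<open>Wirtinger derivatives\<close>

lemma
  assumes "line_differentiable (axis i 1) f z" "line_differentiable (axis i \<i>) f z"
    and "line_differentiable (axis i 1) g z" "line_differentiable (axis i \<i>) g z"
  shows wirt_bar_add: "wirt_bar i (\<lambda>w. f w + g w) z = wirt_bar i f z + wirt_bar i g z"
    and wirt_bar_mult: "wirt_bar i (\<lambda>w. f w * g w) z = wirt_bar i f z * g z + f z * wirt_bar i g z"
  using assms by (simp_all add: wirt_bar_def dir_deriv_add dir_deriv_mult field_simps)

lemma wirt_bar_const: "wirt_bar i (\<lambda>_. c) z = 0"
  by (simp add: wirt_bar_def dir_deriv_const)

lemma wirt_bar_cnj:
  assumes "line_differentiable (axis i 1) f z" "line_differentiable (axis i \<i>) f z"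
  shows "wirt_bar i (\<lambda>w. cnj (f w)) z = cnj (wirt i f z)"
  unfolding wirt_bar_def wirt_def dir_deriv_cnj(1)[OF assms(1)] dir_deriv_cnj(1)[OF assms(2)] by simp

lemma wirt_bar_cong:
  assumes V: "openin (top_of_set (model_space N)) V" and z: "z \<in> V" and i: "i \<in> N"
    and eq: "\<And>w. w \<in> V \<Longrightarrow> f w = g w"
  shows "wirt_bar i f z = wirt_bar i g z"
proof -
  have "dir_deriv v f z = dir_deriv v g z" if "v \<in> real_directions N" for v
    by (rule dir_deriv_cong(1)[OF V z that]) (rule eq)
  then show ?thesis using real_directions_axis[OF i] by (simp add: wirt_bar_def)
qed

lemma smooth_on_cnj:
  assumes V: "openin (top_of_set (model_space N)) V" and f: "smooth_on N V f"
  shows "smooth_on N V (\<lambda>z. cnj (f z))"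
proof (rule smooth_on_coinduct[OF V, of "\<lambda>g. \<exists>f. smooth_on N V f \<and> g = (\<lambda>z. cnj (f z))"])
  show "\<exists>f'. smooth_on N V f' \<and> (\<lambda>z. cnj (f z)) = (\<lambda>z. cnj (f' z))" using f by blast
next
  fix g assume "\<exists>f. smooth_on N V f \<and> g = (\<lambda>z. cnj (f z))"
  then obtain f where f: "smooth_on N V f" "g = (\<lambda>z. cnj (f z))" by blast
  show "continuous_on V g" unfolding f(2) by (intro continuous_intros smooth_on_continuous[OF f(1)])
  show "line_differentiable v g z" if "z \<in> V" "v \<in> real_directions N" for z v
    unfolding f(2) by (intro dir_deriv_cnj smooth_on_differentiable[OF f(1)] that)
  show "\<exists>h. (\<exists>f. smooth_on N V f \<and> h = (\<lambda>z. cnj (f z))) \<and> (\<forall>z\<in>V. dir_deriv v g z = h z)"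
    if v: "v \<in> real_directions N" for v
    using f(2) smooth_on_dir_deriv[OF f(1) v] dir_deriv_cnj(1)[OF smooth_on_differentiable[OF f(1) _ v]]
    by (intro exI[of _ "\<lambda>z. cnj (dir_deriv v f z)"]) auto
qed

lemma wirt_bar_commute:
  assumes V: "openin (top_of_set (model_space N)) V" and f: "smooth_on N V f" and z: "z \<in> V"
    and i: "i \<in> N" and j: "j \<in> N"
  shows "wirt_bar i (wirt_bar j f) z = wirt_bar j (wirt_bar i f) z"
proof -
  have dd: "dir_deriv v (wirt_bar k f) z =
      (dir_deriv v (dir_deriv (axis k 1) f) z + \<i> * dir_deriv v (dir_deriv (axis k \<i>) f) z) / 2"
    if v: "v \<in> real_directions N" and k: "k \<in> N" for v k
  proof -
    have 1: "line_differentiable v (dir_deriv (axis k 1) f) z" "line_differentiable v (dir_deriv (axis k \<i>) f) z"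
      using f z v real_directions_axis[OF k] by (auto intro: smooth_on_differentiable smooth_on_dir_deriv)
    have 2: "wirt_bar k f = (\<lambda>w. dir_deriv (axis k 1) f w * (1 / 2) + dir_deriv (axis k \<i>) f w * (\<i> / 2))"
      by (auto simp: wirt_bar_def field_simps)
    have 3: "dir_deriv v (\<lambda>w. g w * k) z = dir_deriv v g z * k" "line_differentiable v (\<lambda>w. g w * k) z"
      if "line_differentiable v g z" for g k
      using dir_deriv_mult[OF that dir_deriv_const(2)[of v k z]] by (simp_all add: dir_deriv_const)
    show ?thesis unfolding 2 dir_deriv_add(1)[OF 3(2)[OF 1(1)] 3(2)[OF 1(2)]] 3(1)[OF 1(1)] 3(1)[OF 1(2)]
      by (simp add: add_divide_distrib)
  qed
  note R = real_directions_axis[OF i] real_directions_axis[OF j]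
  show ?thesis
    using dir_deriv_commute[OF V f z R(1) R(3)] dir_deriv_commute[OF V f z R(1) R(4)]
      dir_deriv_commute[OF V f z R(2) R(3)] dir_deriv_commute[OF V f z R(2) R(4)]
    unfolding wirt_bar_def[of i "wirt_bar j f"] wirt_bar_def[of j "wirt_bar i f"]
      dd[OF R(1) j] dd[OF R(2) j] dd[OF R(3) i] dd[OF R(4) i]
    by (simp add: field_simps)
qed

section \<open>Calculus on a complex manifold\<close>

text \<open>The operator acts on functions of the point rather than of the coordinate, so that
  coefficient functions given in different charts can be multiplied and compared directly.\<close>

definition chart_dbar :: "('c, 'x, 'n::finite) manifold \<Rightarrow> 'c \<Rightarrow> 'n \<Rightarrow> ('x \<Rightarrow> complex) \<Rightarrow> 'x \<Rightarrow> complex" where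
  "chart_dbar X c b \<phi> x = wirt_bar b (\<lambda>z. \<phi> (chart_inv X c z)) (chart X c x)"

definition chart_diff :: "('c, 'x, 'n::finite) manifold \<Rightarrow> 'c \<Rightarrow> 'n \<Rightarrow> ('x \<Rightarrow> complex) \<Rightarrow> 'x \<Rightarrow> bool" where
  "chart_diff X c b \<phi> x \<longleftrightarrow> line_differentiable (axis b 1) (\<lambda>z. \<phi> (chart_inv X c z)) (chart X c x) \<and>
     line_differentiable (axis b \<i>) (\<lambda>z. \<phi> (chart_inv X c z)) (chart X c x)"

definition chart_smooth :: "('c, 'x, 'n::finite) manifold \<Rightarrow> 'c \<Rightarrow> 'x set \<Rightarrow> ('x \<Rightarrow> complex) \<Rightarrow> bool" where
  "chart_smooth X c U \<phi> \<longleftrightarrow>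
     smooth_on (coords X) (chart X c ` (chart_dom X c \<inter> U)) (\<lambda>z. \<phi> (chart_inv X c z))"

lemma chart_dbar_add: "chart_diff X c b f x \<Longrightarrow> chart_diff X c b g x \<Longrightarrow>
    chart_dbar X c b (\<lambda>x. f x + g x) x = chart_dbar X c b f x + chart_dbar X c b g x"
  by (simp add: chart_dbar_def chart_diff_def wirt_bar_add)

lemma chart_diff_add: "chart_diff X c b f x \<Longrightarrow> chart_diff X c b g x \<Longrightarrow> chart_diff X c b (\<lambda>x. f x + g x) x"
  by (simp add: chart_diff_def dir_deriv_add)

lemma chart_diff_mult: "chart_diff X c b f x \<Longrightarrow> chart_diff X c b g x \<Longrightarrow> chart_diff X c b (\<lambda>x. f x * g x) x"
  by (simp add: chart_diff_def dir_deriv_mult)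

lemma chart_diff_const: "chart_diff X c b (\<lambda>_. k) x"
  by (simp add: chart_diff_def dir_deriv_const)

lemma chart_dbar_const: "chart_dbar X c b (\<lambda>_. k) x = 0"
  by (simp add: chart_dbar_def wirt_bar_const)

context
  fixes X :: "('c, 'x::t2_space, 'n::finite) manifold"
  assumes X: "complex_manifold X"
begin

lemma chart_inv_chart: "x \<in> chart_dom X c \<Longrightarrow> chart_inv X c (chart X c x) = x"
  using X by (auto simp: complex_manifold_def homeomorphism_def)

lemma open_chart_dom: "open (chart_dom X c)"
  using X by (auto simp: complex_manifold_def)

lemma openin_chart_image:
  assumes "open U"
  shows "openin (top_of_set (model_space (coords X))) (chart X c ` (chart_dom X c \<inter> U))"
proof -
  have h: "homeomorphism (chart_dom X c) (chart X c ` chart_dom X c) (chart X c) (chart_inv X c)"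
    and o: "openin (top_of_set (model_space (coords X))) (chart X c ` chart_dom X c)"
    using X by (auto simp: complex_manifold_def)
  have "openin (top_of_set (chart X c ` chart_dom X c)) (chart X c ` (chart_dom X c \<inter> U))"
    using assms by (intro homeomorphism_imp_open_map[OF h]) auto
  then show ?thesis using o by (rule openin_trans)
qed

lemma chart_dbar_mult:
  "chart_diff X c b f x \<Longrightarrow> chart_diff X c b g x \<Longrightarrow> x \<in> chart_dom X c \<Longrightarrow>
    chart_dbar X c b (\<lambda>x. f x * g x) x = chart_dbar X c b f x * g x + f x * chart_dbar X c b g x"
  by (simp add: chart_dbar_def chart_diff_def wirt_bar_mult chart_inv_chart)

lemma chart_dbar_cmult: "chart_diff X c b f x \<Longrightarrow> x \<in> chart_dom X c \<Longrightarrow>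
    chart_dbar X c b (\<lambda>x. k * f x) x = k * chart_dbar X c b f x"
  by (simp add: chart_dbar_mult chart_diff_const chart_dbar_const)

lemma chart_diff_sum: "(\<And>i. i \<in> I \<Longrightarrow> chart_diff X c b (f i) x) \<Longrightarrow> chart_diff X c b (\<lambda>x. \<Sum>i\<in>I. f i x) x"
  by (induction I rule: infinite_finite_induct) (auto intro: chart_diff_const chart_diff_add)

lemma chart_dbar_sum: "(\<And>i. i \<in> I \<Longrightarrow> chart_diff X c b (f i) x) \<Longrightarrow>
    chart_dbar X c b (\<lambda>x. \<Sum>i\<in>I. f i x) x = (\<Sum>i\<in>I. chart_dbar X c b (f i) x)"
  by (induction I rule: infinite_finite_induct) (auto simp: chart_dbar_const chart_dbar_add chart_diff_sum)

lemma chart_dbar_cong: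
  assumes "open U" "x \<in> chart_dom X c" "x \<in> U" "b \<in> coords X"
    and "\<And>y. y \<in> chart_dom X c \<Longrightarrow> y \<in> U \<Longrightarrow> f y = g y"
  shows "chart_dbar X c b f x = chart_dbar X c b g x"
  unfolding chart_dbar_def using assms
  by (intro wirt_bar_cong[OF openin_chart_image[OF assms(1)]]) (auto simp: chart_inv_chart)

lemma chart_smooth_cong:
  assumes "open U" "chart_smooth X c U f"
    and "\<And>y. y \<in> chart_dom X c \<Longrightarrow> y \<in> U \<Longrightarrow> f y = g y"
  shows "chart_smooth X c U g"
  using assms(2) unfolding chart_smooth_def
  by (rule smooth_on_cong[OF openin_chart_image[OF assms(1)]]) (auto simp: chart_inv_chart assms(3))

lemma chart_smooth_subset: "chart_smooth X c U f \<Longrightarrow> U' \<subseteq> U \<Longrightarrow> chart_smooth X c U' f"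
  unfolding chart_smooth_def by (rule smooth_on_subset) auto

lemma chart_smooth_local:
  assumes "\<And>x. x \<in> chart_dom X c \<Longrightarrow> x \<in> U \<Longrightarrow> \<exists>W. open W \<and> x \<in> W \<and> chart_smooth X c (U \<inter> W) f"
  shows "chart_smooth X c U f"
  unfolding chart_smooth_def
proof (rule smooth_on_local)
  fix z assume "z \<in> chart X c ` (chart_dom X c \<inter> U)"
  then obtain x where x: "x \<in> chart_dom X c" "x \<in> U" "z = chart X c x" by auto
  with assms obtain W where W: "open W" "x \<in> W" "chart_smooth X c (U \<inter> W) f" by blast
  let ?A = "chart X c ` (chart_dom X c \<inter> U)" and ?B = "chart X c ` (chart_dom X c \<inter> (U \<inter> W))"
  \<comment> \<open>Injectivity of the chart turns the image of an intersection into an intersection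
    of images.\<close>
  have B: "?B = ?A \<inter> chart X c ` (chart_dom X c \<inter> W)"
  proof (intro equalityI subsetI)
    fix y assume "y \<in> ?A \<inter> chart X c ` (chart_dom X c \<inter> W)"
    then obtain u w where uw: "u \<in> chart_dom X c" "u \<in> U" "y = chart X c u"
      "w \<in> chart_dom X c" "w \<in> W" "y = chart X c w" by auto
    then have "u = w" by (metis chart_inv_chart)
    then show "y \<in> ?B" using uw by auto
  qed auto
  obtain O' where O': "open O'" "chart X c ` (chart_dom X c \<inter> W) = model_space (coords X) \<inter> O'"
    using openin_chart_image[OF W(1)] by (auto simp: openin_open)
  moreover have "?A \<subseteq> model_space (coords X)"
    using openin_chart_image[OF open_UNIV, of c] by (auto simp: openin_open)
  ultimately have "?B = ?A \<inter> O'" unfolding B O'(2) by blast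
  then have "openin (top_of_set ?A) ?B" using O' by (auto simp: openin_open)
  then show "\<exists>W. openin (top_of_set ?A) W \<and> z \<in> W \<and> smooth_on (coords X) W (\<lambda>z. f (chart_inv X c z))"
    using W x by (intro exI[of _ ?B]) (auto simp: chart_smooth_def)
qed

context
  fixes U :: "'x set"
  assumes U: "open U"
begin

lemma chart_smooth_chart_diff:
  "chart_smooth X c U f \<Longrightarrow> x \<in> chart_dom X c \<Longrightarrow> x \<in> U \<Longrightarrow> b \<in> coords X \<Longrightarrow> chart_diff X c b f x"
  unfolding chart_smooth_def chart_diff_def by (auto intro!: smooth_on_differentiable real_directions_axis)

lemma chart_smooth_const: "chart_smooth X c U (\<lambda>_. k)"
  unfolding chart_smooth_def by (rule smooth_on_const[OF openin_chart_image[OF U]])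

lemma chart_smooth_add: "chart_smooth X c U f \<Longrightarrow> chart_smooth X c U g \<Longrightarrow> chart_smooth X c U (\<lambda>x. f x + g x)"
  unfolding chart_smooth_def by (rule smooth_on_add[OF openin_chart_image[OF U]])

lemma chart_smooth_diff: "chart_smooth X c U f \<Longrightarrow> chart_smooth X c U g \<Longrightarrow> chart_smooth X c U (\<lambda>x. f x - g x)"
  unfolding chart_smooth_def by (rule smooth_on_diff[OF openin_chart_image[OF U]])

lemma chart_smooth_mult: "chart_smooth X c U f \<Longrightarrow> chart_smooth X c U g \<Longrightarrow> chart_smooth X c U (\<lambda>x. f x * g x)"
  unfolding chart_smooth_def by (rule smooth_on_mult[OF openin_chart_image[OF U]])

lemma chart_smooth_sum:
  "(\<And>i. i \<in> I \<Longrightarrow> chart_smooth X c U (f i)) \<Longrightarrow> chart_smooth X c U (\<lambda>x. \<Sum>i\<in>I. f i x)"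
  unfolding chart_smooth_def by (rule smooth_on_sum[OF openin_chart_image[OF U]])

lemma chart_smooth_chart_dbar: "b \<in> coords X \<Longrightarrow> chart_smooth X c U f \<Longrightarrow> chart_smooth X c U (chart_dbar X c b f)"
  unfolding chart_smooth_def chart_dbar_def[abs_def]
  by (rule smooth_on_cong[OF openin_chart_image[OF U] smooth_on_wirt_bar[OF openin_chart_image[OF U]]])
    (auto simp: chart_inv_chart)

lemma chart_dbar_commute:
  assumes f: "chart_smooth X c U f" and x: "x \<in> chart_dom X c" "x \<in> U" and a: "a \<in> coords X" and b: "b \<in> coords X"
  shows "chart_dbar X c a (chart_dbar X c b f) x = chart_dbar X c b (chart_dbar X c a f) x"
proof -
  let ?F = "\<lambda>z. f (chart_inv X c z)"
  note V = openin_chart_image[OF U, of c]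
  have z: "chart X c x \<in> chart X c ` (chart_dom X c \<inter> U)" using x by auto
  have *: "chart_dbar X c a (chart_dbar X c b f) x = wirt_bar a (wirt_bar b ?F) (chart X c x)"
    if "a \<in> coords X" "b \<in> coords X" for a b
    unfolding chart_dbar_def[of X c a] unfolding chart_dbar_def[abs_def]
    by (rule wirt_bar_cong[OF V z that(1)]) (auto simp: chart_inv_chart)
  show ?thesis
    unfolding *[OF a b] *[OF b a] using f a b z by (intro wirt_bar_commute[OF V]) (auto simp: chart_smooth_def)
qed

text \<open>The change of charts is holomorphic, so dbar transforms by the conjugate Jacobian alone.
  Smoothness is assumed in the chart \<open>c\<close> and differentiability obtained in
  \<open>d\<close>, since the coefficients of a form are known to be smooth in their own
  chart.\<close>

lemma change_chart:
  assumes f: "chart_smooth X c U f" and x: "x \<in> chart_dom X c" "x \<in> chart_dom X d" "x \<in> U" and b: "b \<in> coords X"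
  shows "chart_dbar X d b f x = (\<Sum>a\<in>coords X. cnj (jacobian X c d x a b) * chart_dbar X c a f x)"
    and "chart_diff X d b f x"
proof -
  define \<tau> where "\<tau> z = chart X c (chart_inv X d z)" for z
  define W where "W = chart X d ` (chart_dom X d \<inter> (chart_dom X c \<inter> U))"
  let ?V = "chart X c ` (chart_dom X c \<inter> U)"
  let ?F = "\<lambda>z. f (chart_inv X c z)"
  note V = openin_chart_image[OF U, of c]
  have W: "openin (top_of_set (model_space (coords X))) W"
    unfolding W_def by (intro openin_chart_image open_Int open_chart_dom U)
  have \<tau>: "hol_on (coords X) W (\<lambda>z. \<tau> z $ a)" if "a \<in> coords X" for a
  proof -
    have "hol_on (coords X) (chart X d ` (chart_dom X c \<inter> chart_dom X d)) (\<lambda>z. \<tau> z $ a)"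
      using X that by (auto simp: complex_manifold_def \<tau>_def)
    moreover have "W \<subseteq> chart X d ` (chart_dom X c \<inter> chart_dom X d)" by (auto simp: W_def)
    ultimately show ?thesis by (auto simp: hol_on_def intro: smooth_on_subset)
  qed
  have \<tau>V: "\<tau> z \<in> ?V" if "z \<in> W" for z
    using that by (auto simp: W_def \<tau>_def chart_inv_chart)
  have z: "chart X d x \<in> W" using x by (auto simp: W_def)
  have \<tau>x: "\<tau> (chart X d x) = chart X c x" using x by (simp add: \<tau>_def chart_inv_chart)
  have eq: "?F (\<tau> z) = f (chart_inv X d z)" if "z \<in> W" for z
    using that by (auto simp: W_def \<tau>_def chart_inv_chart)
  note comp = wirt_bar_compose[OF V f[unfolded chart_smooth_def] W z b, of \<tau>]
  have "chart_dbar X d b f x = wirt_bar b (\<lambda>z. ?F (\<tau> z)) (chart X d x)"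
    unfolding chart_dbar_def using eq by (intro wirt_bar_cong[OF W z b]) auto
  also have "\<dots> = (\<Sum>a\<in>coords X. cnj (wirt b (\<lambda>w. \<tau> w $ a) (chart X d x)) * wirt_bar a ?F (\<tau> (chart X d x)))"
    by (rule comp(1)) (use \<tau> \<tau>V in auto)
  finally show "chart_dbar X d b f x = (\<Sum>a\<in>coords X. cnj (jacobian X c d x a b) * chart_dbar X c a f x)"
    unfolding \<tau>x by (simp add: jacobian_def chart_dbar_def \<tau>_def)
  have "line_differentiable v (\<lambda>z. f (chart_inv X d z)) (chart X d x)"
    if v: "v \<in> real_directions (coords X)" for v
  proof -
    have "line_differentiable v (\<lambda>z. ?F (\<tau> z)) (chart X d x)"
      by (rule comp(2)) (use \<tau> \<tau>V v in auto)
    moreover have "line_differentiable v (\<lambda>z. ?F (\<tau> z)) (chart X d x) \<longleftrightarrow>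
        line_differentiable v (\<lambda>z. f (chart_inv X d z)) (chart X d x)"
      by (rule dir_deriv_cong(2)[OF W z v]) (rule eq)
    ultimately show ?thesis by blast
  qed
  then show "chart_diff X d b f x"
    unfolding chart_diff_def using real_directions_axis[OF b] by blast
qed

end

text \<open>The conjugate Jacobian is the antiholomorphic derivative of the conjugate transition functions,
  so its derivatives are symmetric.\<close>

lemma conjugate_jacobian:
  assumes x: "x \<in> chart_dom X c" "x \<in> chart_dom X d" and N: "a \<in> coords X" "b \<in> coords X" "b' \<in> coords X"
  shows "chart_diff X d b' (\<lambda>x. cnj (jacobian X c d x a b)) x"
    and "chart_dbar X d b' (\<lambda>x. cnj (jacobian X c d x a b)) x = chart_dbar X d b (\<lambda>x. cnj (jacobian X c d x a b')) x"
proof -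
  define t where "t x = cnj (chart X c x $ a)" for x
  have U: "open (chart_dom X c)" by (rule open_chart_dom)
  have hol: "hol_on (coords X) (chart X d ` (chart_dom X c \<inter> chart_dom X d)) (\<lambda>z. chart X c (chart_inv X d z) $ a)"
    using X N by (auto simp: complex_manifold_def)
  then have s: "smooth_on (coords X) (chart X d ` (chart_dom X d \<inter> chart_dom X c)) (\<lambda>z. chart X c (chart_inv X d z) $ a)"
    by (simp add: hol_on_def Int_commute)
  have sm: "chart_smooth X d (chart_dom X c) t"
    unfolding chart_smooth_def t_def by (rule smooth_on_cnj[OF openin_chart_image[OF U] s])
  have eq: "cnj (jacobian X c d y a b) = chart_dbar X d b t y"
    if "y \<in> chart_dom X d" "y \<in> chart_dom X c" "b \<in> coords X" for y b
    unfolding jacobian_def chart_dbar_def t_def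
    using that by (intro wirt_bar_cnj[symmetric] smooth_on_differentiable[OF s] real_directions_axis) auto
  show "chart_diff X d b' (\<lambda>x. cnj (jacobian X c d x a b)) x"
    by (rule chart_smooth_chart_diff[OF U chart_smooth_cong[OF U chart_smooth_chart_dbar[OF U N(2) sm]]]) (use eq x N in auto)
  have "chart_dbar X d b' (\<lambda>x. cnj (jacobian X c d x a b)) x = chart_dbar X d b' (chart_dbar X d b t) x"
    by (rule chart_dbar_cong[OF U x(2) x(1) N(3)]) (use eq N in auto)
  also have "\<dots> = chart_dbar X d b (chart_dbar X d b' t) x"
    using x N by (intro chart_dbar_commute[OF U sm])
  also have "\<dots> = chart_dbar X d b (\<lambda>x. cnj (jacobian X c d x a b')) x"
    by (rule chart_dbar_cong[OF U x(2) x(1) N(2)]) (use eq N in auto)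
  finally show "chart_dbar X d b' (\<lambda>x. cnj (jacobian X c d x a b)) x = chart_dbar X d b (\<lambda>x. cnj (jacobian X c d x a b')) x" .
qed

end

section \<open>Holomorphic transition functions\<close>

definition chart_hol :: "('c, 'x, 'n::finite) manifold \<Rightarrow> 'c \<Rightarrow> 'x set \<Rightarrow> ('x \<Rightarrow> complex) \<Rightarrow> bool" where
  "chart_hol X c U \<phi> \<longleftrightarrow> chart_smooth X c U \<phi> \<and> (\<forall>x\<in>chart_dom X c \<inter> U. \<forall>b\<in>coords X. chart_dbar X c b \<phi> x = 0)"

lemma hol_on_chart_hol:
  "hol_on (coords X) (chart X c ` (chart_dom X c \<inter> U)) (\<lambda>z. \<phi> (chart_inv X c z)) \<longleftrightarrow> chart_hol X c U \<phi>"
  by (auto simp: hol_on_def chart_hol_def chart_smooth_def chart_dbar_def)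

text \<open>The part of the bundle axioms that enters when the transformation law of a form is
  differentiated. It passes to End(\<open>E\<close>), tensor products and tensor powers without a
  new verification of the cocycle law.\<close>

definition transition_hol ::
  "('c, 'x::t2_space, 'n::finite) manifold \<Rightarrow> ('i, 'x, 'f) vbundle \<Rightarrow> bool" where
  "transition_hol X F \<longleftrightarrow> finite (fibre F) \<and> (\<forall>i. open (frame_dom F i)) \<and>
     (\<forall>c i j. \<forall>a\<in>fibre F. \<forall>b\<in>fibre F.
        chart_hol X c (frame_dom F i \<inter> frame_dom F j) (\<lambda>x. transition F i j x a b))"

context
  fixes X :: "('c, 'x::t2_space, 'n::finite) manifold"
  assumes X: "complex_manifold X"
begin

lemma chart_hol_subset: "chart_hol X c U f \<Longrightarrow> U' \<subseteq> U \<Longrightarrow> chart_hol X c U' f"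
  by (auto simp: chart_hol_def intro: chart_smooth_subset[OF X])

lemma chart_hol_const: "open U \<Longrightarrow> chart_hol X c U (\<lambda>_. k)"
  by (auto simp: chart_hol_def chart_dbar_const intro: chart_smooth_const[OF X])

lemma chart_hol_mult: "open U \<Longrightarrow> chart_hol X c U f \<Longrightarrow> chart_hol X c U g \<Longrightarrow> chart_hol X c U (\<lambda>x. f x * g x)"
  by (auto simp: chart_hol_def chart_dbar_mult[OF X] chart_smooth_chart_diff[OF X] intro: chart_smooth_mult[OF X])

lemma chart_hol_prod:
  "open U \<Longrightarrow> (\<And>i. i \<in> I \<Longrightarrow> chart_hol X c U (f i)) \<Longrightarrow> chart_hol X c U (\<lambda>x. \<Prod>i\<in>I. f i x)"
  by (induction I rule: infinite_finite_induct) (auto intro: chart_hol_const chart_hol_mult)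

lemma transition_hol_bundle: "holomorphic_bundle X F \<Longrightarrow> transition_hol X F"
  unfolding holomorphic_bundle_def transition_hol_def
  by (simp add: Int_assoc hol_on_chart_hol[symmetric])

lemma transition_hol_end: "transition_hol X E \<Longrightarrow> transition_hol X (end_bundle E)"
  unfolding transition_hol_def end_bundle_def
  by (auto intro!: chart_hol_mult) (metis Int_commute)

lemma transition_hol_tensor:
  fixes F :: "('i, 'x, 'f) vbundle" and G :: "('j, 'x, 'g) vbundle"
  assumes "transition_hol X F" "transition_hol X G"
  shows "transition_hol X (tensor_bundle F G)"
  unfolding transition_hol_def
proof (intro conjI allI ballI)
  show "finite (fibre (tensor_bundle F G))"
    using assms by (auto simp: transition_hol_def tensor_bundle_def)
  show "open (frame_dom (tensor_bundle F G) i)" for i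
    using assms by (auto simp: transition_hol_def tensor_bundle_def intro!: open_Int split: prod.split)
  fix c and i j :: "'i \<times> 'j" and a b :: "'f \<times> 'g"
  assume ab: "a \<in> fibre (tensor_bundle F G)" "b \<in> fibre (tensor_bundle F G)"
  obtain i1 i2 j1 j2 a1 a2 b1 b2 where e: "i = (i1, i2)" "j = (j1, j2)" "a = (a1, a2)" "b = (b1, b2)"
    by (metis surj_pair)
  have o: "open (frame_dom (tensor_bundle F G) i \<inter> frame_dom (tensor_bundle F G) j)"
    using assms by (auto simp: transition_hol_def tensor_bundle_def intro!: open_Int split: prod.split)
  have "chart_hol X c (frame_dom F i1 \<inter> frame_dom F j1) (\<lambda>x. transition F i1 j1 x a1 b1)"
    "chart_hol X c (frame_dom G i2 \<inter> frame_dom G j2) (\<lambda>x. transition G i2 j2 x a2 b2)"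
    using assms ab unfolding e by (auto simp: transition_hol_def tensor_bundle_def)
  then have "chart_hol X c (frame_dom (tensor_bundle F G) i \<inter> frame_dom (tensor_bundle F G) j)
      (\<lambda>x. transition F i1 j1 x a1 b1 * transition G i2 j2 x a2 b2)"
    by (intro chart_hol_mult[OF o]; elim chart_hol_subset) (auto simp: tensor_bundle_def e)
  then show "chart_hol X c (frame_dom (tensor_bundle F G) i \<inter> frame_dom (tensor_bundle F G) j)
      (\<lambda>x. transition (tensor_bundle F G) i j x a b)"
    by (simp add: tensor_bundle_def e)
qed

lemma transition_hol_power: "transition_hol X L \<Longrightarrow> transition_hol X (tensor_power k L)"
  unfolding transition_hol_def tensor_power_def
  using finite_lists_length_eq[of "fibre L" k]
  by (auto intro!: chart_hol_prod simp: subset_eq conj_commute)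

end

section \<open>Forms of low degree\<close>

lemma sum_lists_0: "(\<Sum>J\<in>{J. length J = 0 \<and> set J \<subseteq> A}. f J) = f []"
proof -
  have "{J. length J = 0 \<and> set J \<subseteq> A} = {[]}" by auto
  then show ?thesis by simp
qed

lemma sum_lists_Suc:
  assumes "finite A"
  shows "(\<Sum>J\<in>{J. length J = Suc n \<and> set J \<subseteq> A}. f J) =
    (\<Sum>a\<in>A. \<Sum>J\<in>{J. length J = n \<and> set J \<subseteq> A}. f (a # J))"
proof -
  have fin: "finite {J. length J = n \<and> set J \<subseteq> A}"
    using finite_lists_length_eq[OF assms, of n] by (simp add: conj_commute)
  have "{J. length J = Suc n \<and> set J \<subseteq> A} = (\<lambda>(a, J). a # J) ` (A \<times> {J. length J = n \<and> set J \<subseteq> A})"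
    by (auto simp: length_Suc_conv image_iff)
  then have "(\<Sum>J\<in>{J. length J = Suc n \<and> set J \<subseteq> A}. f J) =
      (\<Sum>p\<in>A \<times> {J. length J = n \<and> set J \<subseteq> A}. f (fst p # snd p))"
    by (simp add: sum.reindex inj_on_def case_prod_unfold)
  also have "\<dots> = (\<Sum>a\<in>A. \<Sum>J\<in>{J. length J = n \<and> set J \<subseteq> A}. f (a # J))"
    by (simp add: sum.cartesian_product case_prod_unfold)
  finally show ?thesis .
qed

lemma sum_lists_1: "finite A \<Longrightarrow> (\<Sum>J\<in>{J. length J = Suc 0 \<and> set J \<subseteq> A}. f J) = (\<Sum>a\<in>A. f [a])"
  by (simp only: sum_lists_Suc sum_lists_0)

lemma sum_lists_2: "finite A \<Longrightarrow>
    (\<Sum>J\<in>{J. length J = 2 \<and> set J \<subseteq> A}. f J) = (\<Sum>a\<in>A. \<Sum>b\<in>A. f [a, b])"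
  by (simp only: numeral_2_eq_2 sum_lists_Suc sum_lists_0)

lemma lessThan_2: "{..<2::nat} = {0, Suc 0}" "{..<Suc (Suc 0)} = {0, Suc 0}"
  by auto

lemma length_nths_delete: "t < length J \<Longrightarrow> length (nths J (- {t})) = length J - 1"
proof -
  assume t: "t < length J"
  have "{i. i < length J \<and> i \<in> - {t}} = {..<length J} - {t}" by auto
  then show ?thesis using t by (simp add: length_nths)
qed

lemma alternating_le1:
  assumes "\<And>J. f J \<noteq> 0 \<Longrightarrow> length J \<le> 1"
  shows "alternating f"
  unfolding alternating_def
proof (intro allI impI)
  fix K :: "'a list" and \<sigma> assume \<sigma>: "\<sigma> permutes {..<length K}"
  show "f (permute_list \<sigma> K) = of_int (sign \<sigma>) * f K"
  proof (cases "length K \<le> 1")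
    case True
    then have "{..<length K} = {} \<or> {..<length K} = {0}" by auto
    then have "\<sigma> = id" using \<sigma> permutes_empty permutes_sing by metis
    then show ?thesis by simp
  next
    case False
    then have "f (permute_list \<sigma> K) = 0" "f K = 0"
      using assms[of "permute_list \<sigma> K"] assms[of K] by auto
    then show ?thesis by simp
  qed
qed

lemma alternating_2:
  assumes 0: "\<And>J. f J \<noteq> 0 \<Longrightarrow> length J = 2" and swap: "\<And>a b. f [a, b] = - f [b, a]"
  shows "alternating f"
  unfolding alternating_def
proof (intro allI impI)
  fix K :: "'a list" and \<sigma> assume \<sigma>: "\<sigma> permutes {..<length K}"
  show "f (permute_list \<sigma> K) = of_int (sign \<sigma>) * f K"
  proof (cases "length K = 2")
    case True
    then obtain a b where K: "K = [a, b]"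
      by (metis (no_types, opaque_lifting) One_nat_def Suc_1 length_0_conv length_Suc_conv)
    have "\<sigma> = id \<or> \<sigma> = Transposition.transpose 0 (Suc 0)"
      using \<sigma> unfolding K by (simp add: lessThan_2 permutes_doubleton_iff)
    then show ?thesis
      using swap[of b a] by (auto simp: K permute_list_def sign_swap_id)
  next
    case False
    then have "f (permute_list \<sigma> K) = 0" "f K = 0"
      using 0[of "permute_list \<sigma> K"] 0[of K] by auto
    then show ?thesis by simp
  qed
qed

lemma
  assumes "\<omega> \<in> forms X F p"
  shows formsD_support: "\<omega> (c, i, x, J, f) \<noteq> 0 \<Longrightarrow>
      x \<in> chart_dom X c \<and> x \<in> frame_dom F i \<and> length J = p \<and> set J \<subseteq> coords X \<and> f \<in> fibre F"
    and formsD_alternating: "alternating (\<lambda>J. \<omega> (c, i, x, J, f))"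
    and formsD_smooth: "chart_smooth X c (frame_dom F i) (\<lambda>x. \<omega> (c, i, x, J, f))"
    and formsD_transform: "x \<in> chart_dom X c \<Longrightarrow> x \<in> chart_dom X d \<Longrightarrow> x \<in> frame_dom F i \<Longrightarrow>
      x \<in> frame_dom F j \<Longrightarrow> length J = p \<Longrightarrow> set J \<subseteq> coords X \<Longrightarrow> f \<in> fibre F \<Longrightarrow>
      \<omega> (d, j, x, J, f) =
            (\<Sum>J' \<in> {J'. length J' = p \<and> set J' \<subseteq> coords X}. \<Sum>f' \<in> fibre F.
               (\<Prod>t<p. cnj (jacobian X c d x (J' ! t) (J ! t))) *
               transition F j i x f f' * \<omega> (c, i, x, J', f'))"
proof -
  note * = assms[unfolded forms_def mem_Collect_eq]
  note 1 = *[THEN conjunct1] and 2 = *[THEN conjunct2, THEN conjunct1]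
    and 3 = *[THEN conjunct2, THEN conjunct2, THEN conjunct1]
    and 4 = *[THEN conjunct2, THEN conjunct2, THEN conjunct2]
  show "x \<in> chart_dom X c \<and> x \<in> frame_dom F i \<and> length J = p \<and> set J \<subseteq> coords X \<and> f \<in> fibre F"
    if "\<omega> (c, i, x, J, f) \<noteq> 0"
    using 1[rule_format, OF that] by simp
  show "alternating (\<lambda>J. \<omega> (c, i, x, J, f))" using 2 by simp
  show "chart_smooth X c (frame_dom F i) (\<lambda>x. \<omega> (c, i, x, J, f))"
    unfolding chart_smooth_def using 3[rule_format, of c i J f] by simp
  show "\<omega> (d, j, x, J, f) =
            (\<Sum>J' \<in> {J'. length J' = p \<and> set J' \<subseteq> coords X}. \<Sum>f' \<in> fibre F.
               (\<Prod>t<p. cnj (jacobian X c d x (J' ! t) (J ! t))) *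
               transition F j i x f f' * \<omega> (c, i, x, J', f'))"
    if "x \<in> chart_dom X c" "x \<in> chart_dom X d" "x \<in> frame_dom F i"
      "x \<in> frame_dom F j" "length J = p" "set J \<subseteq> coords X" "f \<in> fibre F"
    using 4[rule_format, of x c d i j J f] that by simp
qed

lemma formsI:
  assumes "\<And>c i x J f. \<omega> (c, i, x, J, f) \<noteq> 0 \<Longrightarrow>
      x \<in> chart_dom X c \<and> x \<in> frame_dom F i \<and> length J = p \<and> set J \<subseteq> coords X \<and> f \<in> fibre F"
    and "\<And>c i x f. alternating (\<lambda>J. \<omega> (c, i, x, J, f))"
    and "\<And>c i J f. chart_smooth X c (frame_dom F i) (\<lambda>x. \<omega> (c, i, x, J, f))"
    and "\<And>c d i j x J f. x \<in> chart_dom X c \<Longrightarrow> x \<in> chart_dom X d \<Longrightarrow> x \<in> frame_dom F i \<Longrightarrow>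
      x \<in> frame_dom F j \<Longrightarrow> length J = p \<Longrightarrow> set J \<subseteq> coords X \<Longrightarrow> f \<in> fibre F \<Longrightarrow>
      \<omega> (d, j, x, J, f) =
            (\<Sum>J' \<in> {J'. length J' = p \<and> set J' \<subseteq> coords X}. \<Sum>f' \<in> fibre F.
               (\<Prod>t<p. cnj (jacobian X c d x (J' ! t) (J ! t))) *
               transition F j i x f f' * \<omega> (c, i, x, J', f'))"
  shows "\<omega> \<in> forms X F p"
  unfolding forms_def mem_Collect_eq
  apply (intro conjI)
  subgoal apply (intro allI impI) subgoal premises p for c i x J f using assms(1)[OF p] by simp done
  subgoal using assms(2) by simp
  subgoal using assms(3) by (simp add: chart_smooth_def)
  subgoal apply (intro allI impI, elim IntE) subgoal premises p for c d i j x J f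
      using assms(4)[of x c d i j J f] p by simp
    done
  done

lemma dbar_eq:
  "dbar X F \<omega> (c, i, x, J, f) =
    (if x \<in> chart_dom X c \<and> x \<in> frame_dom F i \<and> set J \<subseteq> coords X
     then \<Sum>t<length J. (-1) ^ t * chart_dbar X c (J ! t) (\<lambda>x. \<omega> (c, i, x, nths J (- {t}), f)) x else 0)"
  by (simp add: dbar_def chart_dbar_def)

lemma dbar_nonzero:
  assumes \<omega>: "\<omega> \<in> forms X F p" and nz: "dbar X F \<omega> (c, i, x, J, f) \<noteq> 0"
  shows "x \<in> chart_dom X c \<and> x \<in> frame_dom F i \<and> length J = Suc p \<and> set J \<subseteq> coords X \<and> f \<in> fibre F"
proof -
  from nz have *: "x \<in> chart_dom X c" "x \<in> frame_dom F i" "set J \<subseteq> coords X"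
    and "(\<Sum>t<length J. (-1) ^ t * chart_dbar X c (J ! t) (\<lambda>x. \<omega> (c, i, x, nths J (- {t}), f)) x) \<noteq> 0"
    by (auto simp: dbar_eq split: if_splits)
  then obtain t where t: "t < length J" "chart_dbar X c (J ! t) (\<lambda>x. \<omega> (c, i, x, nths J (- {t}), f)) x \<noteq> 0"
    by (metis (no_types, lifting) lessThan_iff mult_zero_right sum.neutral)
  \<comment> \<open>A function with a nonzero derivative at \<open>x\<close> is nonzero somewhere,
    possibly at another point \<open>y\<close>; only the conditions on the indices are taken from
    there.\<close>
  then obtain y where "\<omega> (c, i, y, nths J (- {t}), f) \<noteq> 0"
    using chart_dbar_const by (metis (no_types, lifting) ext)
  from formsD_support[OF \<omega> this] * t show ?thesis by (auto simp: length_nths_delete)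
qed

context
  fixes X :: "('c, 'x::t2_space, 'n::finite) manifold" and F :: "('i, 'x, 'f) vbundle"
  assumes X: "complex_manifold X" and F: "transition_hol X F"
begin

lemma open_frame_dom: "open (frame_dom F i)"
  using F by (simp add: transition_hol_def)

lemma dbar_chart_smooth:
  assumes \<omega>: "\<omega> \<in> forms X F p"
  shows "chart_smooth X c (frame_dom F i) (\<lambda>x. dbar X F \<omega> (c, i, x, J, f))"
proof (cases "set J \<subseteq> coords X")
  case True
  have "chart_smooth X c (frame_dom F i)
      (\<lambda>x. \<Sum>t<length J. (-1) ^ t * chart_dbar X c (J ! t) (\<lambda>x. \<omega> (c, i, x, nths J (- {t}), f)) x)"
    using True by (intro chart_smooth_sum[OF X] chart_smooth_mult[OF X] chart_smooth_const[OF X] chart_smooth_chart_dbar[OF X]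
        open_frame_dom formsD_smooth[OF \<omega>]) auto
  then show ?thesis
    by (rule chart_smooth_cong[OF X open_frame_dom]) (simp add: dbar_eq True)
next
  case False
  then show ?thesis by (simp add: dbar_eq chart_smooth_const[OF X open_frame_dom])
qed

lemma form_chart_diff:
  assumes "\<omega> \<in> forms X F p" "x \<in> chart_dom X c" "x \<in> frame_dom F i" "b \<in> coords X"
  shows "chart_diff X c b (\<lambda>x. \<omega> (c, i, x, J, f)) x"
  using chart_smooth_chart_diff[OF X open_frame_dom formsD_smooth[OF assms(1)]] assms by blast

lemma form_change_chart:
  assumes "\<omega> \<in> forms X F p" "x \<in> chart_dom X c" "x \<in> chart_dom X d" "x \<in> frame_dom F i" "b \<in> coords X"
  shows "chart_dbar X d b (\<lambda>x. \<omega> (c, i, x, J, f)) x =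
      (\<Sum>a\<in>coords X. cnj (jacobian X c d x a b) * chart_dbar X c a (\<lambda>x. \<omega> (c, i, x, J, f)) x)"
    and "chart_diff X d b (\<lambda>x. \<omega> (c, i, x, J, f)) x"
  using change_chart[OF X open_frame_dom formsD_smooth[OF assms(1)]] assms by blast+

lemma transition_chart_dbar:
  assumes "x \<in> chart_dom X c" "x \<in> frame_dom F i" "x \<in> frame_dom F j" "b \<in> coords X"
    "f \<in> fibre F" "f' \<in> fibre F"
  shows "chart_dbar X c b (\<lambda>x. transition F i j x f f') x = 0"
    and "chart_diff X c b (\<lambda>x. transition F i j x f f') x"
proof -
  have *: "chart_hol X c (frame_dom F i \<inter> frame_dom F j) (\<lambda>x. transition F i j x f f')"
    using F assms by (simp add: transition_hol_def)
  show "chart_dbar X c b (\<lambda>x. transition F i j x f f') x = 0"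
    using * assms by (simp add: chart_hol_def)
  show "chart_diff X c b (\<lambda>x. transition F i j x f f') x"
    using * assms open_frame_dom
    by (intro chart_smooth_chart_diff[OF X, of "frame_dom F i \<inter> frame_dom F j"]) (auto simp: chart_hol_def)
qed

lemma transition_times:
  assumes "x \<in> chart_dom X c" "x \<in> frame_dom F i" "x \<in> frame_dom F j" "b \<in> coords X"
    "f \<in> fibre F" "f' \<in> fibre F" "chart_diff X c b g x"
  shows "chart_dbar X c b (\<lambda>x. transition F i j x f f' * g x) x = transition F i j x f f' * chart_dbar X c b g x"
    and "chart_diff X c b (\<lambda>x. transition F i j x f f' * g x) x"
  using assms transition_chart_dbar by (simp_all add: chart_dbar_mult[OF X] chart_diff_mult)

text \<open>Holomorphic transition functions pass through dbar, and the change of charts contributes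
  the conjugate Jacobian.\<close>

lemma dbar_forms_0:
  assumes \<omega>: "\<omega> \<in> forms X F 0"
  shows "dbar X F \<omega> \<in> forms X F (Suc 0)"
proof (rule formsI)
  show "x \<in> chart_dom X c \<and> x \<in> frame_dom F i \<and> length J = Suc 0 \<and> set J \<subseteq> coords X \<and> f \<in> fibre F"
    if "dbar X F \<omega> (c, i, x, J, f) \<noteq> 0" for c i x J f
    using dbar_nonzero[OF \<omega> that] .
  then show "alternating (\<lambda>J. dbar X F \<omega> (c, i, x, J, f))" for c i x f
    by (intro alternating_le1) fastforce
  show "chart_smooth X c (frame_dom F i) (\<lambda>x. dbar X F \<omega> (c, i, x, J, f))" for c i J f
    by (rule dbar_chart_smooth[OF \<omega>])
  fix c d i j x and J :: "'n list" and f
  assume x: "x \<in> chart_dom X c" "x \<in> chart_dom X d" "x \<in> frame_dom F i" "x \<in> frame_dom F j"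
    and J: "length J = Suc 0" "set J \<subseteq> coords X" and f: "f \<in> fibre F"
  then obtain b where b: "J = [b]" "b \<in> coords X" by (auto simp: length_Suc_conv)
  let ?O = "chart_dom X c \<inter> frame_dom F i \<inter> frame_dom F j"
  have O: "open ?O" using open_frame_dom open_chart_dom[OF X] by auto
  have "dbar X F \<omega> (d, j, x, J, f) = chart_dbar X d b (\<lambda>x. \<omega> (d, j, x, [], f)) x"
    using x b by (simp add: dbar_eq nths_Cons)
  also have "\<dots> = chart_dbar X d b (\<lambda>x. \<Sum>f'\<in>fibre F. transition F j i x f f' * \<omega> (c, i, x, [], f')) x"
  proof (rule chart_dbar_cong[OF X O x(2) _ b(2)])
    show "x \<in> ?O" using x by auto
    show "\<omega> (d, j, y, [], f) = (\<Sum>f'\<in>fibre F. transition F j i y f f' * \<omega> (c, i, y, [], f'))"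
      if "y \<in> chart_dom X d" "y \<in> ?O" for y
      using that formsD_transform[OF \<omega>, of y c d i j "[]" f] f
      unfolding sum_lists_0 by simp
  qed
  also have "\<dots> = (\<Sum>f'\<in>fibre F. transition F j i x f f' * chart_dbar X d b (\<lambda>x. \<omega> (c, i, x, [], f')) x)"
    using x b f form_change_chart(2)[OF \<omega>] by (simp add: chart_dbar_sum[OF X] transition_times)
  also have "\<dots> = (\<Sum>f'\<in>fibre F. transition F j i x f f' *
      (\<Sum>a\<in>coords X. cnj (jacobian X c d x a b) * chart_dbar X c a (\<lambda>x. \<omega> (c, i, x, [], f')) x))"
    using x b by (intro sum.cong refl arg_cong2[where f = "(*)"] form_change_chart(1)[OF \<omega>]) auto
  also have "\<dots> = (\<Sum>a\<in>coords X. \<Sum>f'\<in>fibre F. cnj (jacobian X c d x a b) * transition F j i x f f' *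
      chart_dbar X c a (\<lambda>x. \<omega> (c, i, x, [], f')) x)"
    unfolding sum_distrib_left by (subst sum.swap) (simp add: mult_ac)
  also have "\<dots> = (\<Sum>a\<in>coords X. \<Sum>f'\<in>fibre F. cnj (jacobian X c d x a b) * transition F j i x f f' *
      dbar X F \<omega> (c, i, x, [a], f'))"
    using x by (intro sum.cong refl) (simp add: dbar_eq nths_Cons)
  finally show "dbar X F \<omega> (d, j, x, J, f) =
     (\<Sum>J'\<in>{J'. length J' = Suc 0 \<and> set J' \<subseteq> coords X}. \<Sum>f'\<in>fibre F.
       (\<Prod>t<Suc 0. cnj (jacobian X c d x (J' ! t) (J ! t))) * transition F j i x f f' *
       dbar X F \<omega> (c, i, x, J', f'))"
    unfolding sum_lists_1[OF finite[of "coords X"]] by (simp add: b)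
qed

text \<open>Differentiating the transformation law of a (0,1)-form also produces derivatives of the
  conjugate Jacobian. They are symmetric in the two form indices and cancel when dbar
  antisymmetrizes.\<close>

lemma dbar_forms_1:
  assumes \<omega>: "\<omega> \<in> forms X F (Suc 0)"
  shows "dbar X F \<omega> \<in> forms X F 2"
proof (rule formsI)
  have dbar2: "dbar X F \<omega> (c, i, x, [a, b], f) =
      (if x \<in> chart_dom X c \<and> x \<in> frame_dom F i \<and> a \<in> coords X \<and> b \<in> coords X
       then chart_dbar X c a (\<lambda>x. \<omega> (c, i, x, [b], f)) x - chart_dbar X c b (\<lambda>x. \<omega> (c, i, x, [a], f)) x else 0)"
    for c i x a b f
    by (simp add: dbar_eq nths_Cons)
  show supp: "x \<in> chart_dom X c \<and> x \<in> frame_dom F i \<and> length J = 2 \<and> set J \<subseteq> coords X \<and> f \<in> fibre F"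
    if "dbar X F \<omega> (c, i, x, J, f) \<noteq> 0" for c i x J f
    using dbar_nonzero[OF \<omega> that] by simp
  show "alternating (\<lambda>J. dbar X F \<omega> (c, i, x, J, f))" for c i x f
    by (rule alternating_2) (use supp in \<open>auto simp: dbar2\<close>)
  show "chart_smooth X c (frame_dom F i) (\<lambda>x. dbar X F \<omega> (c, i, x, J, f))" for c i J f
    by (rule dbar_chart_smooth[OF \<omega>])
  fix c d i j x and J :: "'n list" and f
  assume x: "x \<in> chart_dom X c" "x \<in> chart_dom X d" "x \<in> frame_dom F i" "x \<in> frame_dom F j"
    and J: "length J = 2" "set J \<subseteq> coords X" and f: "f \<in> fibre F"
  then obtain p q where pq: "J = [p, q]" "p \<in> coords X" "q \<in> coords X"
    by (auto simp: length_Suc_conv numeral_2_eq_2)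
  let ?O = "chart_dom X c \<inter> frame_dom F i \<inter> frame_dom F j"
  have O: "open ?O" using open_frame_dom open_chart_dom[OF X] by auto
  let ?j = "\<lambda>a b x. cnj (jacobian X c d x a b)"
  let ?T = "\<lambda>f' x. transition F j i x f f'"
  let ?w = "\<lambda>a f' x. \<omega> (c, i, x, [a], f')"
  have deriv: "chart_dbar X d b (\<lambda>x. \<omega> (d, j, x, [b'], f)) x =
      (\<Sum>a\<in>coords X. \<Sum>f'\<in>fibre F. chart_dbar X d b (?j a b') x * (?T f' x * ?w a f' x)) +
      (\<Sum>a\<in>coords X. \<Sum>f'\<in>fibre F. \<Sum>a'\<in>coords X. ?j a' b x * ?j a b' x * (?T f' x * chart_dbar X c a' (?w a f') x))"
    if b: "b \<in> coords X" "b' \<in> coords X" for b b'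
  proof -
    have "chart_dbar X d b (\<lambda>x. \<omega> (d, j, x, [b'], f)) x =
        chart_dbar X d b (\<lambda>x. \<Sum>a\<in>coords X. \<Sum>f'\<in>fibre F. ?j a b' x * (?T f' x * ?w a f' x)) x"
    proof (rule chart_dbar_cong[OF X O x(2) _ b(1)])
      show "x \<in> ?O" using x by auto
      show "\<omega> (d, j, y, [b'], f) = (\<Sum>a\<in>coords X. \<Sum>f'\<in>fibre F. ?j a b' y * (?T f' y * ?w a f' y))"
        if "y \<in> chart_dom X d" "y \<in> ?O" for y
        using that formsD_transform[OF \<omega>, of y c d i j "[b']" f] f b
        unfolding sum_lists_1[OF finite[of "coords X"]] by (simp add: mult.assoc)
    qed
    also have "\<dots> = (\<Sum>a\<in>coords X. \<Sum>f'\<in>fibre F.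
        chart_dbar X d b (?j a b') x * (?T f' x * ?w a f' x) + ?j a b' x * (?T f' x * chart_dbar X d b (?w a f') x))"
    proof -
      have c: "chart_diff X d b (?j a b') x" if "a \<in> coords X" for a
        by (rule conjugate_jacobian(1)[OF X x(1,2) that b(2,1)])
      have t: "chart_dbar X d b (\<lambda>x. ?T f' x * ?w a f' x) x = ?T f' x * chart_dbar X d b (?w a f') x"
        "chart_diff X d b (\<lambda>x. ?T f' x * ?w a f' x) x" if "f' \<in> fibre F" for a f'
        using transition_times[OF x(2,4,3) b(1) f that form_change_chart(2)[OF \<omega> x(1,2,3) b(1)]] by auto
      have m: "chart_dbar X d b (\<lambda>x. ?j a b' x * (?T f' x * ?w a f' x)) x =
          chart_dbar X d b (?j a b') x * (?T f' x * ?w a f' x) + ?j a b' x * (?T f' x * chart_dbar X d b (?w a f') x)"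
        "chart_diff X d b (\<lambda>x. ?j a b' x * (?T f' x * ?w a f' x)) x"
        if "a \<in> coords X" "f' \<in> fibre F" for a f'
        using chart_dbar_mult[OF X c[OF that(1)] t(2)[OF that(2)] x(2)] chart_diff_mult[OF c[OF that(1)] t(2)[OF that(2)]]
        by (simp_all add: t(1)[OF that(2)])
      show ?thesis
        by (subst chart_dbar_sum[OF X], intro chart_diff_sum[OF X] m(2); assumption?)
          (intro sum.cong refl, subst chart_dbar_sum[OF X], auto simp: m)
    qed
    also have "\<dots> = (\<Sum>a\<in>coords X. \<Sum>f'\<in>fibre F.
        chart_dbar X d b (?j a b') x * (?T f' x * ?w a f' x) +
        (\<Sum>a'\<in>coords X. ?j a' b x * ?j a b' x * (?T f' x * chart_dbar X c a' (?w a f') x)))"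
      unfolding form_change_chart(1)[OF \<omega> x(1,2,3) b(1)] by (simp add: sum_distrib_left mult_ac)
    finally show ?thesis by (simp add: sum.distrib)
  qed
  have sym: "chart_dbar X d p (?j a q) x = chart_dbar X d q (?j a p) x" if "a \<in> coords X" for a
    by (rule conjugate_jacobian(2)[OF X x(1,2) that pq(3,2)])
  have "dbar X F \<omega> (d, j, x, J, f) =
     (\<Sum>a\<in>coords X. \<Sum>f'\<in>fibre F. \<Sum>a'\<in>coords X. ?j a' p x * ?j a q x * (?T f' x * chart_dbar X c a' (?w a f') x)) -
     (\<Sum>a\<in>coords X. \<Sum>f'\<in>fibre F. \<Sum>a'\<in>coords X. ?j a' q x * ?j a p x * (?T f' x * chart_dbar X c a' (?w a f') x))"
    unfolding pq(1) dbar2 deriv[OF pq(2,3)] deriv[OF pq(3,2)] using x pq sym by simp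
  also have "(\<Sum>a\<in>coords X. \<Sum>f'\<in>fibre F. \<Sum>a'\<in>coords X. ?j a' p x * ?j a q x * (?T f' x * chart_dbar X c a' (?w a f') x))
     = (\<Sum>a'\<in>coords X. \<Sum>a\<in>coords X. \<Sum>f'\<in>fibre F. ?j a' p x * ?j a q x * (?T f' x * chart_dbar X c a' (?w a f') x))"
    by (rule trans[OF sum.cong[OF refl sum.swap] sum.swap])
  also have "(\<Sum>a\<in>coords X. \<Sum>f'\<in>fibre F. \<Sum>a'\<in>coords X. ?j a' q x * ?j a p x * (?T f' x * chart_dbar X c a' (?w a f') x))
     = (\<Sum>a\<in>coords X. \<Sum>a'\<in>coords X. \<Sum>f'\<in>fibre F. ?j a p x * ?j a' q x * (?T f' x * chart_dbar X c a' (?w a f') x))"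
    by (rule trans[OF sum.cong[OF refl sum.swap]]) (simp add: mult_ac)
  finally have "dbar X F \<omega> (d, j, x, J, f) = (\<Sum>a\<in>coords X. \<Sum>a'\<in>coords X. \<Sum>f'\<in>fibre F.
      ?j a p x * ?j a' q x * ?T f' x * (chart_dbar X c a (?w a' f') x - chart_dbar X c a' (?w a f') x))"
    by (simp add: sum_subtractf[symmetric] algebra_simps)
  also have "\<dots> = (\<Sum>a\<in>coords X. \<Sum>a'\<in>coords X. \<Sum>f'\<in>fibre F.
      ?j a p x * ?j a' q x * ?T f' x * dbar X F \<omega> (c, i, x, [a, a'], f'))"
    using x by (intro sum.cong refl) (simp add: dbar2)
  finally show "dbar X F \<omega> (d, j, x, J, f) =
     (\<Sum>J'\<in>{J'. length J' = 2 \<and> set J' \<subseteq> coords X}. \<Sum>f'\<in>fibre F.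
       (\<Prod>t<2. cnj (jacobian X c d x (J' ! t) (J ! t))) * transition F j i x f f' *
       dbar X F \<omega> (c, i, x, J', f'))"
    unfolding sum_lists_2[OF finite[of "coords X"]] by (simp add: pq lessThan_2)
qed

lemma forms_zero: "(\<lambda>_. 0) \<in> forms X F p"
  by (rule formsI) (auto simp: alternating_def chart_smooth_const[OF X open_frame_dom])

lemma forms_lin:
  assumes "\<omega> \<in> forms X F p" "\<eta> \<in> forms X F p"
  shows "(\<lambda>k. s * \<omega> k + \<eta> k) \<in> forms X F p"
proof (rule formsI)
  show "x \<in> chart_dom X c \<and> x \<in> frame_dom F i \<and> length J = p \<and> set J \<subseteq> coords X \<and> f \<in> fibre F"
    if "s * \<omega> (c, i, x, J, f) + \<eta> (c, i, x, J, f) \<noteq> 0" for c i x J f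
    using formsD_support[OF assms(1), of c i x J f] formsD_support[OF assms(2), of c i x J f] that by force
  show "alternating (\<lambda>J. s * \<omega> (c, i, x, J, f) + \<eta> (c, i, x, J, f))" for c i x f
    using formsD_alternating[OF assms(1), of c i x f] formsD_alternating[OF assms(2), of c i x f]
    by (simp add: alternating_def algebra_simps)
  show "chart_smooth X c (frame_dom F i) (\<lambda>x. s * \<omega> (c, i, x, J, f) + \<eta> (c, i, x, J, f))" for c i J f
    by (intro chart_smooth_add[OF X open_frame_dom] chart_smooth_mult[OF X open_frame_dom]
      chart_smooth_const[OF X open_frame_dom] formsD_smooth[OF assms(1)] formsD_smooth[OF assms(2)])
  fix c d i j x and J :: "'n list" and f
  assume *: "x \<in> chart_dom X c" "x \<in> chart_dom X d" "x \<in> frame_dom F i" "x \<in> frame_dom F j"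
    "length J = p" "set J \<subseteq> coords X" "f \<in> fibre F"
  show "s * \<omega> (d, j, x, J, f) + \<eta> (d, j, x, J, f) =
     (\<Sum>J'\<in>{J'. length J' = p \<and> set J' \<subseteq> coords X}. \<Sum>f'\<in>fibre F.
       (\<Prod>t<p. cnj (jacobian X c d x (J' ! t) (J ! t))) * transition F j i x f f' *
       (s * \<omega> (c, i, x, J', f') + \<eta> (c, i, x, J', f')))"
    unfolding formsD_transform[OF assms(1) *] formsD_transform[OF assms(2) *]
    by (simp add: sum_distrib_left sum.distrib[symmetric] algebra_simps)
qed

lemma dbar_lin:
  assumes "\<omega> \<in> forms X F p" "\<eta> \<in> forms X F p"
  shows "dbar X F (\<lambda>k. s * \<omega> k + \<eta> k) = (\<lambda>k. s * dbar X F \<omega> k + dbar X F \<eta> k)"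
proof
  fix k :: "'c \<times> 'i \<times> 'x \<times> 'n list \<times> 'f"
  obtain c i x J f where k: "k = (c, i, x, J, f)" by (metis surj_pair)
  show "dbar X F (\<lambda>k. s * \<omega> k + \<eta> k) k = s * dbar X F \<omega> k + dbar X F \<eta> k"
  proof (cases "x \<in> chart_dom X c \<and> x \<in> frame_dom F i \<and> set J \<subseteq> coords X")
    case True
    have "chart_dbar X c (J ! t) (\<lambda>x. s * \<omega> (c, i, x, K, f) + \<eta> (c, i, x, K, f)) x =
        s * chart_dbar X c (J ! t) (\<lambda>x. \<omega> (c, i, x, K, f)) x + chart_dbar X c (J ! t) (\<lambda>x. \<eta> (c, i, x, K, f)) x"
      if "t < length J" for t K
    proof -
      have b: "J ! t \<in> coords X" using True that by auto
      have d: "chart_diff X c (J ! t) (\<lambda>x. \<omega> (c, i, x, K, f)) x" "chart_diff X c (J ! t) (\<lambda>x. \<eta> (c, i, x, K, f)) x"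
        using form_chart_diff assms True b by auto
      have "chart_dbar X c (J ! t) (\<lambda>x. s * \<omega> (c, i, x, K, f) + \<eta> (c, i, x, K, f)) x =
        chart_dbar X c (J ! t) (\<lambda>x. s * \<omega> (c, i, x, K, f)) x + chart_dbar X c (J ! t) (\<lambda>x. \<eta> (c, i, x, K, f)) x"
        by (intro chart_dbar_add chart_diff_mult chart_diff_const d)
      then show ?thesis using True by (simp add: chart_dbar_cmult[OF X d(1)])
    qed
    then show ?thesis unfolding k dbar_eq using True
      by (simp add: sum_distrib_left sum.distrib[symmetric] algebra_simps)
  qed (auto simp: k dbar_eq)
qed

end

section \<open>Matrices with coefficients in a commutative ring\<close>

definition mat_mult :: "'f set \<Rightarrow> ('f \<times> 'f \<Rightarrow> 'v::comm_ring_1) \<Rightarrow> ('f \<times> 'f \<Rightarrow> 'v) \<Rightarrow> 'f \<times> 'f \<Rightarrow> 'v" where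
  "mat_mult R A B = (\<lambda>(a, b). \<Sum>m\<in>R. A (a, m) * B (m, b))"

definition mat_comm :: "'f set \<Rightarrow> ('f \<times> 'f \<Rightarrow> 'v::comm_ring_1) \<Rightarrow> ('f \<times> 'f \<Rightarrow> 'v) \<Rightarrow> 'f \<times> 'f \<Rightarrow> 'v" where
  "mat_comm R A B = (\<lambda>ab. mat_mult R A B ab - mat_mult R B A ab)"

definition mat_conj :: "'f set \<Rightarrow> ('f \<Rightarrow> 'f \<Rightarrow> complex) \<Rightarrow> ('f \<Rightarrow> 'f \<Rightarrow> complex) \<Rightarrow>
    ('f \<times> 'f \<Rightarrow> complex) \<Rightarrow> 'f \<times> 'f \<Rightarrow> complex" where
  "mat_conj R g g' A = (\<lambda>(a, b). \<Sum>a'\<in>R. \<Sum>b'\<in>R. g a a' * g' b' b * A (a', b'))"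

lemma mat_mult_zero: "mat_mult R (\<lambda>_. 0) B = (\<lambda>_. 0)" "mat_mult R A (\<lambda>_. 0) = (\<lambda>_. 0)"
  by (auto simp: mat_mult_def)

lemma mat_comm_zero: "mat_comm R (\<lambda>_. 0) B = (\<lambda>_. 0)" "mat_comm R A (\<lambda>_. 0) = (\<lambda>_. 0)"
  by (auto simp: mat_comm_def mat_mult_zero)

lemma mat_mult_assoc: "mat_mult R (mat_mult R A B) C = mat_mult R A (mat_mult R B C)"
proof
  fix ab :: "'a \<times> 'a" obtain a b where ab: "ab = (a, b)" by (metis surj_pair)
  show "mat_mult R (mat_mult R A B) C ab = mat_mult R A (mat_mult R B C) ab"
    unfolding ab mat_mult_def by (simp add: sum_distrib_left sum_distrib_right mult.assoc) (rule sum.swap)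
qed

lemma mat_mult_lin:
  "mat_mult R (\<lambda>ab. A ab + B ab) C = (\<lambda>ab. mat_mult R A C ab + mat_mult R B C ab)"
  "mat_mult R C (\<lambda>ab. A ab + B ab) = (\<lambda>ab. mat_mult R C A ab + mat_mult R C B ab)"
  "mat_mult R (\<lambda>ab. A ab - B ab) C = (\<lambda>ab. mat_mult R A C ab - mat_mult R B C ab)"
  "mat_mult R C (\<lambda>ab. A ab - B ab) = (\<lambda>ab. mat_mult R C A ab - mat_mult R C B ab)"
  "mat_mult R (\<lambda>ab. - A ab) C = (\<lambda>ab. - mat_mult R A C ab)"
  "mat_mult R C (\<lambda>ab. - A ab) = (\<lambda>ab. - mat_mult R C A ab)"
  by (auto simp: mat_mult_def sum.distrib sum_subtractf sum_negf algebra_simps)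

lemma mat_mult_cmult:
  "mat_mult R (\<lambda>ab. k * A ab) C = (\<lambda>ab. k * mat_mult R A C ab)"
  "mat_mult R C (\<lambda>ab. k * A ab) = (\<lambda>ab. k * mat_mult R C A ab)"
  by (auto simp: mat_mult_def sum_distrib_left mult_ac)

lemma mat_mult_sum:
  "mat_mult R (\<lambda>ab. \<Sum>i\<in>I. A i ab) C = (\<lambda>ab. \<Sum>i\<in>I. mat_mult R (A i) C ab)"
  "mat_mult R C (\<lambda>ab. \<Sum>i\<in>I. A i ab) = (\<lambda>ab. \<Sum>i\<in>I. mat_mult R C (A i) ab)"
  by (auto simp: mat_mult_def sum_distrib_left sum_distrib_right intro: sum.swap)

lemma mat_comm_bilinear_sum:
  "mat_comm R (\<lambda>ab. \<Sum>i\<in>I. s i * A i ab) (\<lambda>ab. \<Sum>k\<in>K. t k * B k ab) =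
    (\<lambda>ab. \<Sum>i\<in>I. \<Sum>k\<in>K. s i * t k * mat_comm R (A i) (B k) ab)"
proof
  fix ab
  have "mat_mult R (\<lambda>ab. \<Sum>i\<in>I. s i * A i ab) (\<lambda>ab. \<Sum>k\<in>K. t k * B k ab) ab =
      (\<Sum>i\<in>I. \<Sum>k\<in>K. s i * t k * mat_mult R (A i) (B k) ab)"
    unfolding mat_mult_sum mat_mult_cmult by (simp add: mult_ac sum_distrib_left)
  moreover have "mat_mult R (\<lambda>ab. \<Sum>k\<in>K. t k * B k ab) (\<lambda>ab. \<Sum>i\<in>I. s i * A i ab) ab =
      (\<Sum>i\<in>I. \<Sum>k\<in>K. s i * t k * mat_mult R (B k) (A i) ab)"
    unfolding mat_mult_sum mat_mult_cmult by (subst sum.swap) (simp add: mult_ac sum_distrib_left)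
  ultimately show "mat_comm R (\<lambda>ab. \<Sum>i\<in>I. s i * A i ab) (\<lambda>ab. \<Sum>k\<in>K. t k * B k ab) ab =
      (\<Sum>i\<in>I. \<Sum>k\<in>K. s i * t k * mat_comm R (A i) (B k) ab)"
    by (simp add: mat_comm_def sum_subtractf[symmetric] right_diff_distrib)
qed

lemma mat_comm_cmult: "mat_comm R (\<lambda>ab. k * A ab) B = (\<lambda>ab. k * mat_comm R A B ab)"
  by (auto simp: mat_comm_def mat_mult_cmult algebra_simps)

lemma mat_comm_cong:
  assumes "\<And>a b. a \<in> R \<Longrightarrow> b \<in> R \<Longrightarrow> A (a, b) = A' (a, b)" "\<And>a b. a \<in> R \<Longrightarrow> b \<in> R \<Longrightarrow> B (a, b) = B' (a, b)"
    and "a \<in> R" "b \<in> R"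
  shows "mat_comm R A B (a, b) = mat_comm R A' B' (a, b)"
  unfolding mat_comm_def mat_mult_def using assms by simp

lemma mat_comm_nonzero:
  assumes "mat_comm R A B (a, b) \<noteq> 0"
  obtains m where "A (a, m) \<noteq> 0 \<and> B (m, b) \<noteq> 0 \<or> B (a, m) \<noteq> 0 \<and> A (m, b) \<noteq> 0"
proof -
  have "\<exists>m. A (a, m) \<noteq> 0 \<and> B (m, b) \<noteq> 0 \<or> B (a, m) \<noteq> 0 \<and> A (m, b) \<noteq> 0"
  proof (rule ccontr)
    assume *: "\<not> ?thesis"
    have "A (a, m) * B (m, b) = 0" "B (a, m) * A (m, b) = 0" for m
      using * by (cases "A (a, m) = 0"; cases "B (a, m) = 0"; force)+
    then show False using assms by (simp add: mat_comm_def mat_mult_def)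
  qed
  then show ?thesis using that by blast
qed

lemma mat_conj_diff: "mat_conj R g g' (\<lambda>ab. A ab - B ab) ab = mat_conj R g g' A ab - mat_conj R g g' B ab"
  by (simp add: mat_conj_def case_prod_unfold sum_subtractf right_diff_distrib)

lemma mat_conj_eq_mat_mult: "mat_conj R g g' A = mat_mult R (\<lambda>(a, b). g a b) (mat_mult R A (\<lambda>(a, b). g' a b))"
  by (auto simp: mat_conj_def mat_mult_def sum_distrib_left mult_ac)

lemma mat_mult_unit:
  assumes "\<And>b c. b \<in> R \<Longrightarrow> c \<in> R \<Longrightarrow> U (b, c) = (if b = c then 1 else 0)" "finite R"
  shows "mat_mult R A (mat_mult R U C) = mat_mult R A C"
proof -
  have "mat_mult R U C (m, b) = C (m, b)" if "m \<in> R" for m b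
  proof -
    have "mat_mult R U C (m, b) = (\<Sum>n\<in>R. if m = n then C (n, b) else 0)"
      unfolding mat_mult_def prod.case using assms(1) that by (intro sum.cong) auto
    then show ?thesis using assms(2) that by simp
  qed
  then show ?thesis unfolding mat_mult_def[of R A] by (auto intro!: sum.cong)
qed

lemma mat_conj_mat_mult:
  assumes inv: "\<And>b c. b \<in> R \<Longrightarrow> c \<in> R \<Longrightarrow> (\<Sum>m\<in>R. g' b m * g m c) = (if b = c then 1 else 0)"
    and R: "finite R"
  shows "mat_mult R (mat_conj R g g' A) (mat_conj R g g' B) = mat_conj R g g' (mat_mult R A B)"
proof -
  let ?G = "\<lambda>(a, b). g a b" and ?G' = "\<lambda>(a, b). g' a b"
  have U: "mat_mult R ?G' ?G (b, c) = (if b = c then 1 else 0)" if "b \<in> R" "c \<in> R" for b c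
    using inv[OF that] by (simp add: mat_mult_def)
  have "mat_mult R (mat_conj R g g' A) (mat_conj R g g' B) = mat_mult R ?G (mat_mult R A (mat_mult R (mat_mult R ?G' ?G) (mat_mult R B ?G')))"
    unfolding mat_conj_eq_mat_mult by (simp only: mat_mult_assoc)
  also have "mat_mult R A (mat_mult R (mat_mult R ?G' ?G) (mat_mult R B ?G')) = mat_mult R A (mat_mult R B ?G')"
    by (rule mat_mult_unit) (use U R in auto)
  also have "mat_mult R ?G (mat_mult R A (mat_mult R B ?G')) = mat_conj R g g' (mat_mult R A B)"
    unfolding mat_conj_eq_mat_mult by (simp only: mat_mult_assoc)
  finally show ?thesis .
qed

text \<open>Conjugation is compatible with commutators, and the weights \<open>s\<close> and
  \<open>t\<close> carry the transformation of a form index or of an index in \<open>L\<close>. In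
  this way one statement serves all types of bracket components.\<close>

lemma mat_comm_transform:
  assumes inv: "\<And>b c. b \<in> R \<Longrightarrow> c \<in> R \<Longrightarrow> (\<Sum>m\<in>R. g' b m * g m c) = (if b = c then 1 else 0)"
    and R: "finite R"
    and A: "\<And>a b. a \<in> R \<Longrightarrow> b \<in> R \<Longrightarrow> A' (a, b) = (\<Sum>i\<in>I. s i * mat_conj R g g' (A i) (a, b))"
    and B: "\<And>a b. a \<in> R \<Longrightarrow> b \<in> R \<Longrightarrow> B' (a, b) = (\<Sum>k\<in>K. t k * mat_conj R g g' (B k) (a, b))"
    and ab: "a \<in> R" "b \<in> R"
  shows "mat_comm R A' B' (a, b) = (\<Sum>i\<in>I. \<Sum>k\<in>K. s i * t k * mat_conj R g g' (mat_comm R (A i) (B k)) (a, b))"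
proof -
  have *: "mat_comm R (mat_conj R g g' A) (mat_conj R g g' B) ab = mat_conj R g g' (mat_comm R A B) ab" for A B ab
  proof -
    have "mat_mult R (mat_conj R g g' A) (mat_conj R g g' B) = mat_conj R g g' (mat_mult R A B)" for A B
      by (rule mat_conj_mat_mult) (use inv R in auto)
    then show ?thesis by (simp only: mat_comm_def mat_conj_diff)
  qed
  have "mat_comm R A' B' (a, b) =
      mat_comm R (\<lambda>ab. \<Sum>i\<in>I. s i * mat_conj R g g' (A i) ab) (\<lambda>ab. \<Sum>k\<in>K. t k * mat_conj R g g' (B k) ab) (a, b)"
    by (rule mat_comm_cong) (use A B ab in auto)
  also have "\<dots> = (\<Sum>i\<in>I. \<Sum>k\<in>K. s i * t k * mat_conj R g g' (mat_comm R (A i) (B k)) (a, b))"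
    unfolding mat_comm_bilinear_sum * ..
  finally show ?thesis .
qed

section \<open>The bracket on elements of degree one\<close>

lemma shuffle_sign_simps: "shuffle_sign {} = 1" "shuffle_sign {t} = (-1) ^ t" "shuffle_sign {0, Suc 0} = 1"
proof -
  have "{(s, u). s \<in> {t} \<and> u \<notin> {t} \<and> u < s} = {t} \<times> {..<t}" by auto
  then show "shuffle_sign {t} = (-1) ^ t" unfolding shuffle_sign_def by (simp add: card_cartesian_product)
  have "{(s, u). s \<in> {0, Suc 0} \<and> u \<notin> {0, Suc 0} \<and> u < s} = {}" by auto
  then show "shuffle_sign {0, Suc 0} = 1" by (simp only: shuffle_sign_def card.empty power_0)
qed (simp add: shuffle_sign_def)

lemma sum_Pow_simps:
  "(\<Sum>T\<in>Pow {..<0::nat}. f T) = f {}"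
  "(\<Sum>T\<in>Pow {..<Suc 0}. f T) = f {} + f {0}"
  "(\<Sum>T\<in>Pow {..<Suc (Suc 0)}. f T) = f {} + f {0} + f {Suc 0} + f {0, Suc 0}"
proof -
  have "Pow {..<Suc 0} = {{}, {0}}" by (auto simp: lessThan_Suc Pow_insert)
  then show "(\<Sum>T\<in>Pow {..<Suc 0}. f T) = f {} + f {0}" by simp
  have "Pow {..<Suc (Suc 0)} = {{}, {0}, {Suc 0}, {0, Suc 0}}"
    by (auto simp add: lessThan_2 Pow_insert)
  then show "(\<Sum>T\<in>Pow {..<Suc (Suc 0)}. f T) = f {} + f {0} + f {Suc 0} + f {0, Suc 0}"
    by (simp add: add.assoc doubleton_eq_iff)
qed simp

lemma end_bracket_alt:
  "end_bracket R u v (ab, K) = (\<Sum>T\<in>Pow {..<length K}. shuffle_sign T *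
     mat_comm R (\<lambda>ab. u (ab, nths K T)) (\<lambda>ab. v (ab, nths K (- T))) ab)"
proof -
  obtain a b where "ab = (a, b)" by (metis surj_pair)
  then show ?thesis by (simp add: end_bracket_def mat_comm_def mat_mult_def sum_subtractf)
qed

lemma M_bracket_alt:
  "M_bracket E z w (c, i, x, J, (ab, K)) =
    (\<Sum>S\<in>Pow {..<length J}. shuffle_sign S * (\<Sum>T\<in>Pow {..<length K}. shuffle_sign T *
      ((-1) ^ (length (nths J (- S)) * length (nths K T)) *
       mat_comm (fibre E) (\<lambda>ab. z (c, i, x, nths J S, (ab, nths K T)))
         (\<lambda>ab. w (c, i, x, nths J (- S), (ab, nths K (- T)))) ab)))"
  unfolding M_bracket_def by (simp add: end_bracket_alt mat_comm_cmult)

text \<open>The value type is left open, since the notion is applied both to complex elements of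
  \<open>M_space X E L 1\<close> and to algebra-valued ones.\<close>

definition degree_one ::
  "(('c, 'i, 'x, 'n, ('f \<times> 'f) \<times> 'g list) coeff_index \<Rightarrow> 'v::zero) \<Rightarrow> bool" where
  "degree_one z \<longleftrightarrow> (\<forall>c i x J ab K. length J + length K \<noteq> 1 \<longrightarrow> z (c, i, x, J, (ab, K)) = 0)"

lemma degree_oneD: "degree_one z \<Longrightarrow> length J + length K \<noteq> 1 \<Longrightarrow> z (c, i, x, J, (ab, K)) = 0"
  unfolding degree_one_def by blast

lemma length_nths_complement: "length (nths J S) + length (nths J (- S)) = length J"
proof -
  have "{i. i < length J \<and> i \<in> S} \<union> {i. i < length J \<and> i \<in> - S} = {..<length J}" by auto
  moreover have "card ({i. i < length J \<and> i \<in> S} \<union> {i. i < length J \<and> i \<in> - S}) =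
      card {i. i < length J \<and> i \<in> S} + card {i. i < length J \<and> i \<in> - S}"
    by (rule card_Un_disjoint) auto
  ultimately show ?thesis by (simp add: length_nths)
qed

lemma M_bracket_degree_two:
  assumes z: "degree_one z" and w: "degree_one w" and "length J + length K \<noteq> 2"
  shows "M_bracket E z w (c, i, x, J, (ab, K)) = 0"
proof -
  have "mat_comm (fibre E) (\<lambda>ab. z (c, i, x, nths J S, (ab, nths K T)))
         (\<lambda>ab. w (c, i, x, nths J (- S), (ab, nths K (- T)))) ab = 0" for S T
  proof (cases "length (nths J S) + length (nths K T) = 1")
    case True
    then have "length (nths J (- S)) + length (nths K (- T)) \<noteq> 1"
      using assms(3) length_nths_complement[of J S] length_nths_complement[of K T] by linarith
    then show ?thesis by (simp add: degree_oneD[OF w] mat_comm_zero)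
  qed (simp add: degree_oneD[OF z] mat_comm_zero)
  then show ?thesis by (simp add: M_bracket_alt)
qed

text \<open>In degree one each factor must take exactly one of the two indices, so only two
  splittings survive. The minus sign is a shuffle sign in the first and third formula and the sign
  from exchanging form degree and exterior degree in the mixed one.\<close>

lemma M_bracket_components:
  assumes z: "degree_one z" and w: "degree_one w"
  shows "M_bracket E z w (c, i, x, [b, b'], (ab, [])) =
      mat_comm (fibre E) (\<lambda>ab. z (c, i, x, [b], (ab, []))) (\<lambda>ab. w (c, i, x, [b'], (ab, []))) ab -
      mat_comm (fibre E) (\<lambda>ab. z (c, i, x, [b'], (ab, []))) (\<lambda>ab. w (c, i, x, [b], (ab, []))) ab"
    and "M_bracket E z w (c, i, x, [b], (ab, [g])) =
      mat_comm (fibre E) (\<lambda>ab. z (c, i, x, [b], (ab, []))) (\<lambda>ab. w (c, i, x, [], (ab, [g]))) ab -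
      mat_comm (fibre E) (\<lambda>ab. z (c, i, x, [], (ab, [g]))) (\<lambda>ab. w (c, i, x, [b], (ab, []))) ab"
    and "M_bracket E z w (c, i, x, [], (ab, [g, g'])) =
      mat_comm (fibre E) (\<lambda>ab. z (c, i, x, [], (ab, [g]))) (\<lambda>ab. w (c, i, x, [], (ab, [g']))) ab -
      mat_comm (fibre E) (\<lambda>ab. z (c, i, x, [], (ab, [g']))) (\<lambda>ab. w (c, i, x, [], (ab, [g]))) ab"
  by (simp_all add: M_bracket_alt sum_Pow_simps shuffle_sign_simps nths_Cons degree_oneD[OF z]
      degree_oneD[OF w] mat_comm_zero)

section \<open>Transformation of End-valued forms\<close>

definition ext_bundle :: "('i, 'x, 'f) vbundle \<Rightarrow> ('j, 'x, 'g) vbundle \<Rightarrow> nat \<Rightarrow> ('i \<times> 'j, 'x, ('f \<times> 'f) \<times> 'g list) vbundle"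
  where "ext_bundle E L q = tensor_bundle (end_bundle E) (tensor_power q L)"

lemma frame_dom_ext_bundle: "x \<in> frame_dom (ext_bundle E L q) i \<longleftrightarrow> x \<in> frame_dom E (fst i) \<and> x \<in> frame_dom L (snd i)"
  by (auto simp: ext_bundle_def tensor_bundle_def end_bundle_def tensor_power_def split: prod.split)

lemma fibre_ext_bundle: "((a, b), K) \<in> fibre (ext_bundle E L q) \<longleftrightarrow>
    a \<in> fibre E \<and> b \<in> fibre E \<and> length K = q \<and> set K \<subseteq> fibre L"
  by (auto simp: ext_bundle_def tensor_bundle_def end_bundle_def tensor_power_def)

definition end_conj where
  "end_conj E j i x = mat_conj (fibre E) (transition E (fst j) (fst i) x) (transition E (fst i) (fst j) x)"

lemma sum_fibre_ext_bundle:
  "(\<Sum>f'\<in>fibre (ext_bundle E L q). P * transition (ext_bundle E L q) j i x ((a, b), K) f' * h f') =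
   (\<Sum>K'\<in>{K. length K = q \<and> set K \<subseteq> fibre L}. P * (\<Prod>t<q. transition L (snd j) (snd i) x (K ! t) (K' ! t)) *
     end_conj E j i x (\<lambda>ab. h (ab, K')) (a, b))"
proof -
  have "(\<Sum>f'\<in>fibre (ext_bundle E L q). P * transition (ext_bundle E L q) j i x ((a, b), K) f' * h f') =
     (\<Sum>ab'\<in>fibre E \<times> fibre E. \<Sum>K'\<in>{K. length K = q \<and> set K \<subseteq> fibre L}.
        P * transition (ext_bundle E L q) j i x ((a, b), K) (ab', K') * h (ab', K'))"
    by (simp add: sum.cartesian_product ext_bundle_def tensor_bundle_def end_bundle_def tensor_power_def
        case_prod_unfold)
  also have "\<dots> = (\<Sum>K'\<in>{K. length K = q \<and> set K \<subseteq> fibre L}. \<Sum>ab'\<in>fibre E \<times> fibre E.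
        P * transition (ext_bundle E L q) j i x ((a, b), K) (ab', K') * h (ab', K'))"
    by (rule sum.swap)
  also have "\<dots> = (\<Sum>K'\<in>{K. length K = q \<and> set K \<subseteq> fibre L}. P * (\<Prod>t<q. transition L (snd j) (snd i) x (K ! t) (K' ! t)) *
     end_conj E j i x (\<lambda>ab. h (ab, K')) (a, b))"
  proof (intro sum.cong refl)
    fix K'
    show "(\<Sum>ab'\<in>fibre E \<times> fibre E. P * transition (ext_bundle E L q) j i x ((a, b), K) (ab', K') * h (ab', K')) =
      P * (\<Prod>t<q. transition L (snd j) (snd i) x (K ! t) (K' ! t)) * end_conj E j i x (\<lambda>ab. h (ab, K')) (a, b)"
      unfolding end_conj_def mat_conj_def
      by (simp add: sum.cartesian_product ext_bundle_def tensor_bundle_def end_bundle_def tensor_power_def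
          case_prod_unfold sum_distrib_left mult_ac)
  qed
  finally show ?thesis .
qed

lemma transition_hol_ext_bundle:
  "complex_manifold X \<Longrightarrow> holomorphic_bundle X E \<Longrightarrow> holomorphic_bundle X L \<Longrightarrow> transition_hol X (ext_bundle E L q)"
  unfolding ext_bundle_def
  by (intro transition_hol_tensor transition_hol_end transition_hol_power transition_hol_bundle)

lemma ext_forms_ext_bundle: "ext_forms X E L p q =
    {\<omega> \<in> forms X (ext_bundle E L q) p. \<forall>c i x J ab. alternating (\<lambda>K. \<omega> (c, i, x, J, (ab, K)))}"
  by (simp add: ext_forms_def ext_bundle_def)

lemma M_component_apply: "M_component p q z (c, i, x, J, (ab, K)) =
    (if length J = p \<and> length K = q then z (c, i, x, J, (ab, K)) else 0)"
  by (simp add: M_component_def)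

lemma M_spaceD_zero:
  assumes "z \<in> M_space X E L n" "length J + length K \<noteq> n"
  shows "z (c, i, x, J, (ab, K)) = 0"
proof -
  have "M_component (length J) (length K) z = (\<lambda>_. 0)" using assms by (auto simp: M_space_def)
  then show ?thesis using M_component_apply[of "length J" "length K" z c i x J ab K] by simp
qed

lemma M_spaceD:
  "z \<in> M_space X E L n \<Longrightarrow> p + q = n \<Longrightarrow> M_component p q z \<in> ext_forms X E L p q"
  unfolding M_space_def by (auto dest!: spec[of _ p] spec[of _ q])

lemma M_spaceI:
  assumes "\<And>p q. p + q = n \<Longrightarrow> M_component p q z \<in> ext_forms X E L p q"
    and "\<And>c i x J ab K. length J + length K \<noteq> n \<Longrightarrow> z (c, i, x, J, (ab, K)) = 0"
  shows "z \<in> M_space X E L n"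
proof -
  have "M_component p q z = (\<lambda>_. 0)" if "p + q \<noteq> n" for p q
    using assms(2) that by (auto simp: M_component_def)
  then show ?thesis using assms(1) by (auto simp: M_space_def)
qed

lemma M_space_degree_one: "z \<in> M_space X E L 1 \<Longrightarrow> degree_one z"
  unfolding degree_one_def by (intro allI impI M_spaceD_zero[of z X E L 1])

lemma M_space_support:
  assumes z: "z \<in> M_space X E L n" and nz: "z (c, i, x, J, ((a, b), K)) \<noteq> 0"
  shows "x \<in> chart_dom X c \<and> x \<in> frame_dom E (fst i) \<and> x \<in> frame_dom L (snd i) \<and> set J \<subseteq> coords X \<and>
    a \<in> fibre E \<and> b \<in> fibre E \<and> set K \<subseteq> fibre L"
proof -
  have n: "length J + length K = n" using M_spaceD_zero[OF z] nz by blast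
  have 1: "M_component (length J) (length K) z \<in> forms X (ext_bundle E L (length K)) (length J)"
    using M_spaceD[OF z n] by (simp add: ext_forms_ext_bundle)
  have 2: "M_component (length J) (length K) z (c, i, x, J, ((a, b), K)) \<noteq> 0"
    using nz by (simp add: M_component_apply)
  show ?thesis using formsD_support[OF 1 2] by (auto simp: frame_dom_ext_bundle fibre_ext_bundle)
qed

context
  fixes X :: "('c, 'x::t2_space, 'n::finite) manifold" and E :: "('i, 'x, 'f) vbundle"
    and L :: "('j, 'x, 'g) vbundle"
  assumes X: "complex_manifold X" and E: "holomorphic_bundle X E" and L: "holomorphic_bundle X L"
begin

lemmas hol_ext_bundle = transition_hol_ext_bundle[OF X E L]

lemma finite_fibres: "finite (fibre E)" "finite (fibre L)"
  using E L by (auto simp: holomorphic_bundle_def)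

abbreviation (input) "fd \<equiv> \<lambda>i. frame_dom (ext_bundle E L 0) i"

lemma frame_dom_ext_bundle_any: "frame_dom (ext_bundle E L q) i = frame_dom (ext_bundle E L 0) i"
  by (auto simp: frame_dom_ext_bundle)

lemma open_fd: "open (fd i)"
  using open_frame_dom[OF X hol_ext_bundle] .

lemma M_space_smooth:
  assumes z: "z \<in> M_space X E L n"
  shows "chart_smooth X c (fd i) (\<lambda>x. z (c, i, x, J, (ab, K)))"
proof (cases "length J + length K = n")
  case True
  have 1: "M_component (length J) (length K) z \<in> forms X (ext_bundle E L (length K)) (length J)"
    using M_spaceD[OF z True] by (simp add: ext_forms_ext_bundle)
  show ?thesis
    using formsD_smooth[OF 1, of c i J "(ab, K)"] by (simp add: M_component_apply frame_dom_ext_bundle_any[of "length K"])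
next
  case False
  then show ?thesis using M_spaceD_zero[OF z False] chart_smooth_const[OF X open_fd] by simp
qed

lemma M_space_chart_diff:
  assumes "z \<in> M_space X E L n" "x \<in> chart_dom X c" "x \<in> frame_dom E (fst i)" "x \<in> frame_dom L (snd i)"
    "b \<in> coords X"
  shows "chart_diff X c b (\<lambda>x. z (c, i, x, J, (ab, K))) x"
  using chart_smooth_chart_diff[OF X open_fd M_space_smooth[OF assms(1)]] assms by (auto simp: frame_dom_ext_bundle)

lemma M_space_transform:
  assumes z: "z \<in> M_space X E L n" and "length J + length K = n"
    and x: "x \<in> chart_dom X c" "x \<in> chart_dom X d" "x \<in> frame_dom E (fst i)" "x \<in> frame_dom L (snd i)"
      "x \<in> frame_dom E (fst j)" "x \<in> frame_dom L (snd j)"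
    and J: "set J \<subseteq> coords X" and K: "set K \<subseteq> fibre L" and ab: "a \<in> fibre E" "b \<in> fibre E"
  shows "z (d, j, x, J, ((a, b), K)) =
    (\<Sum>J'\<in>{J'. length J' = length J \<and> set J' \<subseteq> coords X}. \<Sum>K'\<in>{K'. length K' = length K \<and> set K' \<subseteq> fibre L}.
      (\<Prod>t<length J. cnj (jacobian X c d x (J' ! t) (J ! t))) *
      (\<Prod>t<length K. transition L (snd j) (snd i) x (K ! t) (K' ! t)) *
      end_conj E j i x (\<lambda>ab. z (c, i, x, J', (ab, K'))) (a, b))"
proof -
  let ?w = "M_component (length J) (length K) z"
  have w: "?w \<in> forms X (ext_bundle E L (length K)) (length J)"
    using M_spaceD[OF z assms(2)] by (simp add: ext_forms_ext_bundle)
  have "z (d, j, x, J, ((a, b), K)) = ?w (d, j, x, J, ((a, b), K))"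
    by (simp add: M_component_apply)
  also have "\<dots> = (\<Sum>J'\<in>{J'. length J' = length J \<and> set J' \<subseteq> coords X}. \<Sum>K'\<in>{K'. length K' = length K \<and> set K' \<subseteq> fibre L}.
      (\<Prod>t<length J. cnj (jacobian X c d x (J' ! t) (J ! t))) *
      (\<Prod>t<length K. transition L (snd j) (snd i) x (K ! t) (K' ! t)) *
      end_conj E j i x (\<lambda>ab. ?w (c, i, x, J', (ab, K'))) (a, b))"
    by (subst formsD_transform[OF w, of x c d i j J "((a, b), K)"])
      (use x J K ab in \<open>auto simp: frame_dom_ext_bundle fibre_ext_bundle sum_fibre_ext_bundle\<close>)
  also have "\<dots> = (\<Sum>J'\<in>{J'. length J' = length J \<and> set J' \<subseteq> coords X}. \<Sum>K'\<in>{K'. length K' = length K \<and> set K' \<subseteq> fibre L}.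
      (\<Prod>t<length J. cnj (jacobian X c d x (J' ! t) (J ! t))) *
      (\<Prod>t<length K. transition L (snd j) (snd i) x (K ! t) (K' ! t)) *
      end_conj E j i x (\<lambda>ab. z (c, i, x, J', (ab, K'))) (a, b))"
    by (intro sum.cong refl) (simp add: M_component_apply)
  finally show ?thesis .
qed

lemma component_ext_formsI:
  assumes supp: "\<And>c i x J a b K. length J = p \<Longrightarrow> length K = q \<Longrightarrow> z (c, i, x, J, ((a, b), K)) \<noteq> 0 \<Longrightarrow>
      x \<in> chart_dom X c \<and> x \<in> frame_dom E (fst i) \<and> x \<in> frame_dom L (snd i) \<and> set J \<subseteq> coords X \<and>
      a \<in> fibre E \<and> b \<in> fibre E \<and> set K \<subseteq> fibre L"
    and altJ: "\<And>c i x ab K. alternating (\<lambda>J. M_component p q z (c, i, x, J, (ab, K)))"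
    and altK: "\<And>c i x J ab. alternating (\<lambda>K. M_component p q z (c, i, x, J, (ab, K)))"
    and smooth: "\<And>c i J ab K. length J = p \<Longrightarrow> length K = q \<Longrightarrow> chart_smooth X c (fd i) (\<lambda>x. z (c, i, x, J, (ab, K)))"
    and law: "\<And>c d i j x J a b K. x \<in> chart_dom X c \<Longrightarrow> x \<in> chart_dom X d \<Longrightarrow> x \<in> frame_dom E (fst i) \<Longrightarrow>
      x \<in> frame_dom L (snd i) \<Longrightarrow> x \<in> frame_dom E (fst j) \<Longrightarrow> x \<in> frame_dom L (snd j) \<Longrightarrow>
      length J = p \<Longrightarrow> length K = q \<Longrightarrow> set J \<subseteq> coords X \<Longrightarrow> set K \<subseteq> fibre L \<Longrightarrow>
      a \<in> fibre E \<Longrightarrow> b \<in> fibre E \<Longrightarrow> z (d, j, x, J, ((a, b), K)) =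
    (\<Sum>J'\<in>{J'. length J' = p \<and> set J' \<subseteq> coords X}. \<Sum>K'\<in>{K'. length K' = q \<and> set K' \<subseteq> fibre L}.
      (\<Prod>t<p. cnj (jacobian X c d x (J' ! t) (J ! t))) *
      (\<Prod>t<q. transition L (snd j) (snd i) x (K ! t) (K' ! t)) *
      end_conj E j i x (\<lambda>ab. z (c, i, x, J', (ab, K'))) (a, b))"
  shows "M_component p q z \<in> ext_forms X E L p q"
proof -
  have "M_component p q z \<in> forms X (ext_bundle E L q) p"
  proof (rule formsI)
    show "x \<in> chart_dom X c \<and> x \<in> frame_dom (ext_bundle E L q) i \<and> length J = p \<and> set J \<subseteq> coords X \<and> f \<in> fibre (ext_bundle E L q)"
      if "M_component p q z (c, i, x, J, f) \<noteq> 0" for c i x J f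
    proof -
      obtain a b K where f: "f = ((a, b), K)" by (metis surj_pair)
      show ?thesis using that supp[of J K c i x a b]
        by (auto simp: f M_component_apply frame_dom_ext_bundle fibre_ext_bundle split: if_splits)
    qed
    show "alternating (\<lambda>J. M_component p q z (c, i, x, J, f))" for c i x f
      using altJ[of c i x "fst f" "snd f"] by simp
    show "chart_smooth X c (frame_dom (ext_bundle E L q) i) (\<lambda>x. M_component p q z (c, i, x, J, f))" for c i J f
      using smooth[of J "snd f" c i "fst f"] chart_smooth_const[OF X open_fd[of i], of c 0]
      unfolding frame_dom_ext_bundle_any[of q]
      by (cases f; cases "length J = p \<and> length (snd f) = q") (auto simp: M_component_apply)
    fix c d i j x and J :: "'n list" and f
    assume *: "x \<in> chart_dom X c" "x \<in> chart_dom X d" "x \<in> frame_dom (ext_bundle E L q) i"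
      "x \<in> frame_dom (ext_bundle E L q) j" "length J = p" "set J \<subseteq> coords X" "f \<in> fibre (ext_bundle E L q)"
    obtain a b K where f: "f = ((a, b), K)" by (metis surj_pair)
    show "M_component p q z (d, j, x, J, f) =
       (\<Sum>J'\<in>{J'. length J' = p \<and> set J' \<subseteq> coords X}. \<Sum>f'\<in>fibre (ext_bundle E L q).
         (\<Prod>t<p. cnj (jacobian X c d x (J' ! t) (J ! t))) * transition (ext_bundle E L q) j i x f f' *
         M_component p q z (c, i, x, J', f'))"
    proof -
      have K: "length K = q" "set K \<subseteq> fibre L" and ab: "a \<in> fibre E" "b \<in> fibre E"
        using *(7) by (auto simp: f fibre_ext_bundle)
      have i: "x \<in> frame_dom E (fst i)" "x \<in> frame_dom L (snd i)" "x \<in> frame_dom E (fst j)" "x \<in> frame_dom L (snd j)"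
        using *(3,4) by (auto simp: frame_dom_ext_bundle)
      have "M_component p q z (d, j, x, J, f) = z (d, j, x, J, ((a, b), K))"
        using *(5) K by (simp add: f M_component_apply)
      also note law[OF *(1,2) i *(5) K(1) *(6) K(2) ab]
      finally show ?thesis unfolding f sum_fibre_ext_bundle
        by (simp only:) (intro sum.cong refl, simp add: M_component_apply)
    qed
  qed
  then show ?thesis using altK by (simp add: ext_forms_ext_bundle)
qed

lemma M_space_lin:
  assumes z: "z \<in> M_space X E L n" and w: "w \<in> M_space X E L n"
  shows "(\<lambda>k. s * z k + w k) \<in> M_space X E L n"
proof (rule M_spaceI)
  fix p q assume "p + q = n"
  then have *: "M_component p q z \<in> ext_forms X E L p q" "M_component p q w \<in> ext_forms X E L p q"
    using M_spaceD z w by blast+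
  have "M_component p q (\<lambda>k. s * z k + w k) = (\<lambda>k. s * M_component p q z k + M_component p q w k)"
    by (auto simp: M_component_def)
  then show "M_component p q (\<lambda>k. s * z k + w k) \<in> ext_forms X E L p q"
    using * forms_lin[OF X hol_ext_bundle] unfolding ext_forms_ext_bundle by (auto simp: alternating_def algebra_simps)
qed (simp add: M_spaceD_zero[OF z] M_spaceD_zero[OF w])

lemma M_component_zero: "M_component p q (\<lambda>_. 0) = (\<lambda>_. 0)"
  by (auto simp: M_component_def)

lemma M_space_zero: "(\<lambda>_. 0) \<in> M_space X E L n"
proof (rule M_spaceI)
  show "M_component p q (\<lambda>_. 0) \<in> ext_forms X E L p q" for p q
    unfolding M_component_zero ext_forms_ext_bundle using forms_zero[OF X hol_ext_bundle] by (auto simp: alternating_def)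
qed simp

lemma M_space_sum:
  "(\<And>i. i \<in> I \<Longrightarrow> f i \<in> M_space X E L n) \<Longrightarrow> (\<lambda>k. \<Sum>i\<in>I. s i * f i k) \<in> M_space X E L n"
proof (induction I rule: infinite_finite_induct)
  case (insert i I)
  then have "(\<lambda>k. s i * f i k + (\<Sum>i\<in>I. s i * f i k)) \<in> M_space X E L n"
    by (intro M_space_lin) auto
  then show ?case using insert by simp
qed (auto simp: M_space_zero)

lemma transition_inverse:
  assumes "x \<in> frame_dom E i" "x \<in> frame_dom E j" "b \<in> fibre E" "c \<in> fibre E"
  shows "(\<Sum>m\<in>fibre E. transition E i j x b m * transition E j i x m c) = (if b = c then 1 else 0)"
proof -
  note h = E[unfolded holomorphic_bundle_def, THEN conjunct2, THEN conjunct2, THEN conjunct2]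
  note unit = h[THEN conjunct1, rule_format]
    and cocycle = h[THEN conjunct2, THEN conjunct1, rule_format]
  have "transition E i i x b c = (\<Sum>m\<in>fibre E. transition E i j x b m * transition E j i x m c)"
    by (rule cocycle) (use assms in auto)
  then show ?thesis using unit[OF assms(1,3,4)] by simp
qed

lemma M1_transform:
  assumes z: "z \<in> M_space X E L 1"
    and x: "x \<in> chart_dom X c" "x \<in> chart_dom X d" "x \<in> frame_dom E (fst i)" "x \<in> frame_dom L (snd i)"
      "x \<in> frame_dom E (fst j)" "x \<in> frame_dom L (snd j)"
    and ab: "a \<in> fibre E" "b \<in> fibre E"
  shows "p \<in> coords X \<Longrightarrow> z (d, j, x, [p], ((a, b), [])) =
      (\<Sum>p'\<in>coords X. cnj (jacobian X c d x p' p) * end_conj E j i x (\<lambda>ab. z (c, i, x, [p'], (ab, []))) (a, b))"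
    and "g \<in> fibre L \<Longrightarrow> z (d, j, x, [], ((a, b), [g])) =
      (\<Sum>g'\<in>fibre L. transition L (snd j) (snd i) x g g' * end_conj E j i x (\<lambda>ab. z (c, i, x, [], (ab, [g']))) (a, b))"
proof -
  note * = M_space_transform[OF z _ x _ _ ab]
  show "z (d, j, x, [p], ((a, b), [])) =
      (\<Sum>p'\<in>coords X. cnj (jacobian X c d x p' p) * end_conj E j i x (\<lambda>ab. z (c, i, x, [p'], (ab, []))) (a, b))"
    if "p \<in> coords X"
    using *[of "[p]" "[]"] that
    by (simp add: sum_lists_1 sum_lists_0[simplified] cong del: sum.cong_simp)
  show "z (d, j, x, [], ((a, b), [g])) =
      (\<Sum>g'\<in>fibre L. transition L (snd j) (snd i) x g g' * end_conj E j i x (\<lambda>ab. z (c, i, x, [], (ab, [g']))) (a, b))"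
    if "g \<in> fibre L"
    using *[of "[]" "[g]"] that
    by (simp add: sum_lists_1 finite_fibres sum_lists_0[simplified] cong del: sum.cong_simp)
qed

lemma M_bracket_smooth:
  assumes z: "z \<in> M_space X E L n" and w: "w \<in> M_space X E L m"
  shows "chart_smooth X c (fd i) (\<lambda>x. M_bracket E z w (c, i, x, J, (ab, K)))"
proof -
  obtain a b where ab: "ab = (a, b)" by (metis surj_pair)
  show ?thesis
    unfolding M_bracket_alt mat_comm_def mat_mult_def ab prod.case
    by (intro chart_smooth_sum[OF X open_fd] chart_smooth_mult[OF X open_fd] chart_smooth_const[OF X open_fd]
        chart_smooth_diff[OF X open_fd] M_space_smooth[OF z] M_space_smooth[OF w])
qed

lemma set_nths_union: "set K = set (nths K S) \<union> set (nths K (- S))"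
  unfolding set_nths set_conv_nth[of K] by blast

lemma M_bracket_support:
  assumes z: "z \<in> M_space X E L n" and w: "w \<in> M_space X E L m"
    and nz: "M_bracket E z w (c, i, x, J, ((a, b), K)) \<noteq> 0"
  shows "x \<in> chart_dom X c \<and> x \<in> frame_dom E (fst i) \<and> x \<in> frame_dom L (snd i) \<and> set J \<subseteq> coords X \<and>
    a \<in> fibre E \<and> b \<in> fibre E \<and> set K \<subseteq> fibre L"
proof -
  from nz obtain S T where "mat_comm (fibre E) (\<lambda>ab. z (c, i, x, nths J S, (ab, nths K T)))
         (\<lambda>ab. w (c, i, x, nths J (- S), (ab, nths K (- T)))) (a, b) \<noteq> 0"
    unfolding M_bracket_alt by (metis (no_types, lifting) mult_zero_right sum.neutral)
  then consider m where "z (c, i, x, nths J S, ((a, m), nths K T)) \<noteq> 0"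
      "w (c, i, x, nths J (- S), ((m, b), nths K (- T))) \<noteq> 0"
    | m where "w (c, i, x, nths J (- S), ((a, m), nths K (- T))) \<noteq> 0"
      "z (c, i, x, nths J S, ((m, b), nths K T)) \<noteq> 0"
    by (rule mat_comm_nonzero) blast
  then show ?thesis
    by cases (auto dest!: M_space_support[OF z] M_space_support[OF w]
        simp: set_nths_union[of J S] set_nths_union[of K T])
qed

end

section \<open>The differential of M as dbar plus the bracket with \<theta>\<close>

lemma mat_mult_affine: "mat_mult R (\<lambda>ab. s * A ab + B ab) C ab = s * mat_mult R A C ab + mat_mult R B C ab"
  "mat_mult R C (\<lambda>ab. s * A ab + B ab) ab = s * mat_mult R C A ab + mat_mult R C B ab"
  by (simp_all add: mat_mult_lin mat_mult_cmult)

lemma mat_comm_lin_right: "mat_comm R C (\<lambda>ab. s * A ab + B ab) ab = s * mat_comm R C A ab + mat_comm R C B ab"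
  unfolding mat_comm_def mat_mult_affine by (simp add: algebra_simps)

lemma M_bracket_lin_right:
  "M_bracket E u (\<lambda>k. s * z k + w k) k = s * M_bracket E u z k + M_bracket E u w k"
proof -
  obtain c i x J ab K where k: "k = (c, i, x, J, (ab, K))" by (metis surj_pair)
  show ?thesis
    unfolding k M_bracket_alt mat_comm_lin_right
    by (simp add: distrib_left sum.distrib sum_distrib_left mult.left_commute)
qed

definition M_dbar :: "('c, 'x, 'n::finite) manifold \<Rightarrow> ('i, 'x, 'f) vbundle \<Rightarrow> ('j, 'x, 'g) vbundle \<Rightarrow>
   (('c, 'i \<times> 'j, 'x, 'n, ('f \<times> 'f) \<times> 'g list) coeff_index \<Rightarrow> complex) \<Rightarrow>
   (('c, 'i \<times> 'j, 'x, 'n, ('f \<times> 'f) \<times> 'g list) coeff_index \<Rightarrow> complex)" where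
  "M_dbar X E L z = (\<lambda>(c, i, x, J, (ab, K)). dbar X (ext_bundle E L (length K)) z (c, i, x, J, (ab, K)))"

lemma M_dbar_eq: "M_dbar X E L z (c, i, x, J, (ab, K)) =
    (if x \<in> chart_dom X c \<and> x \<in> frame_dom E (fst i) \<and> x \<in> frame_dom L (snd i) \<and> set J \<subseteq> coords X
     then \<Sum>t<length J. (-1) ^ t * chart_dbar X c (J ! t) (\<lambda>x. z (c, i, x, nths J (- {t}), (ab, K))) x else 0)"
  by (simp add: M_dbar_def dbar_eq frame_dom_ext_bundle)

lemma theta_support:
  assumes "\<theta> \<in> ext_forms X E L 0 1" "\<theta> (c, i, x, J, (ab, K)) \<noteq> 0"
  shows "J = [] \<and> length K = 1"
proof -
  have 1: "\<theta> \<in> forms X (ext_bundle E L 1) 0" using assms(1) by (simp add: ext_forms_ext_bundle)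
  show ?thesis using formsD_support[OF 1 assms(2)] by (cases ab) (auto simp: fibre_ext_bundle)
qed

text \<open>\<theta> has no form index and exactly one index in \<open>L\<close>, so in the bracket
  only \<open>S = {}\<close> and index lists \<open>nths K T\<close> of length one survive; the
  remaining sign is \<open>(-1) ^ length J\<close>, as in \<open>M_diff\<close>. This makes the
  Maurer-Cartan expression a curvature.\<close>

lemma M_diff_eq:
  assumes \<theta>: "\<theta> \<in> ext_forms X E L 0 1"
  shows "M_diff X E L \<theta> z k = M_dbar X E L z k + M_bracket E \<theta> z k"
proof -
  obtain c i x J ab K where k: "k = (c, i, x, J, (ab, K))" by (metis surj_pair)
  define g where "g S T = shuffle_sign T * ((-1) ^ (length (nths J (- S)) * length (nths K T)) *
       mat_comm (fibre E) (\<lambda>ab. \<theta> (c, i, x, nths J S, (ab, nths K T)))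
         (\<lambda>ab. z (c, i, x, nths J (- S), (ab, nths K (- T)))) ab)" for S T
  have g0: "g S T = 0" if "\<not> (nths J S = [] \<and> length (nths K T) = 1)" for S T
  proof -
    have "(\<lambda>ab. \<theta> (c, i, x, nths J S, (ab, nths K T))) = (\<lambda>_. 0)"
      using theta_support[OF \<theta>] that by blast
    then show ?thesis by (simp add: g_def mat_comm_zero)
  qed
  have "M_bracket E \<theta> z k = (\<Sum>S\<in>Pow {..<length J}. shuffle_sign S * (\<Sum>T\<in>Pow {..<length K}. g S T))"
    unfolding k M_bracket_alt g_def ..
  also have "\<dots> = (\<Sum>S\<in>{{}}. shuffle_sign S * (\<Sum>T\<in>Pow {..<length K}. g S T))"
  proof (rule sum.mono_neutral_right)
    show "\<forall>S\<in>Pow {..<length J} - {{}}. shuffle_sign S * (\<Sum>T\<in>Pow {..<length K}. g S T) = 0"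
    proof
      fix S assume S: "S \<in> Pow {..<length J} - {{}}"
      then obtain t where "t \<in> S" "t < length J" by auto
      then have "set (nths J S) \<noteq> {}" unfolding set_nths by blast
      then have "g S T = 0" for T by (intro g0) auto
      then show "shuffle_sign S * (\<Sum>T\<in>Pow {..<length K}. g S T) = 0" by simp
    qed
  qed auto
  also have "\<dots> = (\<Sum>T\<in>Pow {..<length K}. g {} T)" by (simp add: shuffle_sign_simps)
  also have "\<dots> = (\<Sum>T\<in>Pow {..<length K}. (-1) ^ length J * (shuffle_sign T *
       mat_comm (fibre E) (\<lambda>ab. \<theta> (c, i, x, [], (ab, nths K T))) (\<lambda>ab. z (c, i, x, J, (ab, nths K (- T)))) ab))"
  proof (intro sum.cong refl)
    fix T
    show "g {} T = (-1) ^ length J * (shuffle_sign T *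
       mat_comm (fibre E) (\<lambda>ab. \<theta> (c, i, x, [], (ab, nths K T))) (\<lambda>ab. z (c, i, x, J, (ab, nths K (- T)))) ab)"
    proof (cases "length (nths K T) = 1")
      case True
      then show ?thesis by (simp add: g_def nths_all)
    next
      case False
      then have "(\<lambda>ab. \<theta> (c, i, x, [], (ab, nths K T))) = (\<lambda>_. 0)"
        using theta_support[OF \<theta>] by blast
      then show ?thesis using g0[of "{}" T] False by (simp add: mat_comm_zero)
    qed
  qed
  also have "\<dots> = (-1) ^ length J * end_bracket (fibre E) (\<lambda>f. \<theta> (c, i, x, [], f)) (\<lambda>f. z (c, i, x, J, f)) (ab, K)"
    by (simp add: end_bracket_alt sum_distrib_left)
  finally show ?thesis by (simp add: k M_diff_def M_dbar_def ext_bundle_def)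
qed

context
  fixes X :: "('c, 'x::t2_space, 'n::finite) manifold" and E :: "('i, 'x, 'f) vbundle"
    and L :: "('j, 'x, 'g) vbundle"
  assumes X: "complex_manifold X" and E: "holomorphic_bundle X E" and L: "holomorphic_bundle X L"
begin

lemma end_conj_diff: "end_conj E j i x (\<lambda>ab. A ab - B ab) ab = end_conj E j i x A ab - end_conj E j i x B ab"
  by (simp add: end_conj_def mat_conj_diff)

lemma mat_comm_end_conj:
  assumes x: "x \<in> frame_dom E (fst i)" "x \<in> frame_dom E (fst j)"
    and A: "\<And>a b. a \<in> fibre E \<Longrightarrow> b \<in> fibre E \<Longrightarrow> A' (a, b) = (\<Sum>m\<in>I. s m * end_conj E j i x (A m) (a, b))"
    and B: "\<And>a b. a \<in> fibre E \<Longrightarrow> b \<in> fibre E \<Longrightarrow> B' (a, b) = (\<Sum>m\<in>K. t m * end_conj E j i x (B m) (a, b))"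
    and ab: "a \<in> fibre E" "b \<in> fibre E"
  shows "mat_comm (fibre E) A' B' (a, b) =
    (\<Sum>m\<in>I. \<Sum>k\<in>K. s m * t k * end_conj E j i x (mat_comm (fibre E) (A m) (B k)) (a, b))"
  unfolding end_conj_def
proof (rule mat_comm_transform)
  show "(\<Sum>m\<in>fibre E. transition E (fst i) (fst j) x b m * transition E (fst j) (fst i) x m c) =
      (if b = c then 1 else 0)" if "b \<in> fibre E" "c \<in> fibre E" for b c
    using that x by (intro transition_inverse[OF X E L])
qed (use A B ab finite_fibres(1)[OF X E L] in \<open>simp_all add: end_conj_def\<close>)

text \<open>Checked type by type on the explicit components. Both commutators expand into double
  sums over the old indices, and exchanging the order of summation in the second one reassembles the
  bracket in the old chart and frame.\<close>

lemma M_bracket_M2: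
  assumes z: "z \<in> M_space X E L 1" and w: "w \<in> M_space X E L 1"
  shows "M_bracket E z w \<in> M_space X E L 2"
proof (rule M_spaceI)
  note deg = M_space_degree_one[OF z] M_space_degree_one[OF w]
  note comps = M_bracket_components[OF deg, of E]
  show "M_bracket E z w (c, i, x, J, ab, K) = 0" if "length J + length K \<noteq> 2" for c i x J ab K
    by (rule M_bracket_degree_two[OF deg that])
  fix p q :: nat assume "p + q = 2"
  then consider (20) "p = 2" "q = 0" | (11) "p = 1" "q = 1" | (02) "p = 0" "q = 2" by linarith
  note pq = this
  show "M_component p q (M_bracket E z w) \<in> ext_forms X E L p q"
  proof (rule component_ext_formsI[OF X E L])
    show "x \<in> chart_dom X c \<and> x \<in> frame_dom E (fst i) \<and> x \<in> frame_dom L (snd i) \<and> set J \<subseteq> coords X \<and>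
      a \<in> fibre E \<and> b \<in> fibre E \<and> set K \<subseteq> fibre L"
      if "M_bracket E z w (c, i, x, J, ((a, b), K)) \<noteq> 0" for c i x J a b K
      by (rule M_bracket_support[OF X E L z w that])
    show "chart_smooth X c (frame_dom (ext_bundle E L 0) i) (\<lambda>x. M_bracket E z w (c, i, x, J, (ab, K)))" for c i J ab K
      by (rule M_bracket_smooth[OF X E L z w])
    show "alternating (\<lambda>J. M_component p q (M_bracket E z w) (c, i, x, J, (ab, K)))" for c i x ab K
    proof (cases "p = 2")
      case True
      then have "q = 0" using \<open>p + q = 2\<close> by simp
      with True show ?thesis
        by (intro alternating_2) (auto simp: M_component_apply comps split: if_splits)
    next
      case False
      then have "p \<le> 1" using \<open>p + q = 2\<close> by simp
      then show ?thesis by (intro alternating_le1) (auto simp: M_component_apply split: if_splits)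
    qed
    show "alternating (\<lambda>K. M_component p q (M_bracket E z w) (c, i, x, J, (ab, K)))" for c i x J ab
    proof (cases "q = 2")
      case True
      then have "p = 0" using \<open>p + q = 2\<close> by simp
      with True show ?thesis
        by (intro alternating_2) (auto simp: M_component_apply comps split: if_splits)
    next
      case False
      then have "q \<le> 1" using \<open>p + q = 2\<close> by simp
      then show ?thesis by (intro alternating_le1) (auto simp: M_component_apply split: if_splits)
    qed
    fix c d i j x and J :: "'n list" and a b and K :: "'g list"
    assume x: "x \<in> chart_dom X c" "x \<in> chart_dom X d" "x \<in> frame_dom E (fst i)"
      "x \<in> frame_dom L (snd i)" "x \<in> frame_dom E (fst j)" "x \<in> frame_dom L (snd j)"
      and J: "length J = p" and K: "length K = q" and J': "set J \<subseteq> coords X" and K': "set K \<subseteq> fibre L"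
      and ab: "a \<in> fibre E" "b \<in> fibre E"
    note tz = M1_transform[OF X E L z x] and tw = M1_transform[OF X E L w x]
    note finite_fibres(2)[OF X E L, simp]
    let ?j = "\<lambda>m b. cnj (jacobian X c d x m b)" and ?l = "transition L (snd j) (snd i) x"
    let ?C = "mat_comm (fibre E)"
    let ?e = "\<lambda>A. end_conj E j i x A (a, b)"
    from pq show "M_bracket E z w (d, j, x, J, ((a, b), K)) =
        (\<Sum>J'\<in>{J'. length J' = p \<and> set J' \<subseteq> coords X}. \<Sum>K'\<in>{K'. length K' = q \<and> set K' \<subseteq> fibre L}.
          (\<Prod>t<p. cnj (jacobian X c d x (J' ! t) (J ! t))) *
          (\<Prod>t<q. transition L (snd j) (snd i) x (K ! t) (K' ! t)) *
          end_conj E j i x (\<lambda>ab. M_bracket E z w (c, i, x, J', (ab, K'))) (a, b))" (is "_ = ?R")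
    proof cases
      case 20
      then obtain r s where rs: "J = [r, s]" "r \<in> coords X" "s \<in> coords X" and K0: "K = []"
        using J K J' by (auto simp: length_Suc_conv numeral_2_eq_2)
      let ?A = "\<lambda>m ab. z (c, i, x, [m], (ab, []))" and ?B = "\<lambda>m ab. w (c, i, x, [m], (ab, []))"
      have C: "?C (\<lambda>ab. z (d, j, x, [r], (ab, []))) (\<lambda>ab. w (d, j, x, [s], (ab, []))) (a, b) =
          (\<Sum>m\<in>coords X. \<Sum>n\<in>coords X. ?j m r * ?j n s * ?e (?C (?A m) (?B n)))"
        if "r \<in> coords X" "s \<in> coords X" for r s
        by (rule mat_comm_end_conj[OF x(3,5)]) (use tz(1) tw(1) that ab in auto)
      have "M_bracket E z w (d, j, x, J, ((a, b), K)) =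
          (\<Sum>m\<in>coords X. \<Sum>n\<in>coords X. ?j m r * ?j n s * ?e (?C (?A m) (?B n))) -
          (\<Sum>n\<in>coords X. \<Sum>m\<in>coords X. ?j n s * ?j m r * ?e (?C (?A n) (?B m)))"
        unfolding rs(1) K0 comps C[OF rs(2,3)] C[OF rs(3,2)] ..
      also have "(\<Sum>n\<in>coords X. \<Sum>m\<in>coords X. ?j n s * ?j m r * ?e (?C (?A n) (?B m))) =
          (\<Sum>m\<in>coords X. \<Sum>n\<in>coords X. ?j n s * ?j m r * ?e (?C (?A n) (?B m)))"
        by (rule sum.swap)
      also have "(\<Sum>m\<in>coords X. \<Sum>n\<in>coords X. ?j m r * ?j n s * ?e (?C (?A m) (?B n))) - \<dots> =
          (\<Sum>m\<in>coords X. \<Sum>n\<in>coords X. ?j m r * ?j n s *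
            ?e (\<lambda>ab. M_bracket E z w (c, i, x, [m, n], (ab, []))))"
        unfolding comps end_conj_diff sum_subtractf[symmetric] by (simp add: algebra_simps)
      also have "\<dots> = ?R"
        unfolding 20 sum_lists_2[OF finite[of "coords X"]] sum_lists_0 by (simp add: rs(1) K0 lessThan_2)
      finally show ?thesis .
    next
      case 11
      then obtain r g where rs: "J = [r]" "r \<in> coords X" and g: "K = [g]" "g \<in> fibre L"
        using J K J' K' by (auto simp: length_Suc_conv)
      let ?A = "\<lambda>m ab. z (c, i, x, [m], (ab, []))" and ?B = "\<lambda>m ab. w (c, i, x, [m], (ab, []))"
      let ?Y = "\<lambda>h ab. z (c, i, x, [], (ab, [h]))" and ?W = "\<lambda>h ab. w (c, i, x, [], (ab, [h]))"
      have C: "?C (\<lambda>ab. z (d, j, x, [r], (ab, []))) (\<lambda>ab. w (d, j, x, [], (ab, [g]))) (a, b) =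
          (\<Sum>m\<in>coords X. \<Sum>h\<in>fibre L. ?j m r * ?l g h * ?e (?C (?A m) (?W h)))"
        by (rule mat_comm_end_conj[OF x(3,5)]) (use tz(1) tw(2) rs g ab in auto)
      have D: "?C (\<lambda>ab. z (d, j, x, [], (ab, [g]))) (\<lambda>ab. w (d, j, x, [r], (ab, []))) (a, b) =
          (\<Sum>h\<in>fibre L. \<Sum>m\<in>coords X. ?l g h * ?j m r * ?e (?C (?Y h) (?B m)))"
        by (rule mat_comm_end_conj[OF x(3,5)]) (use tz(2) tw(1) rs g ab in auto)
      have "M_bracket E z w (d, j, x, J, ((a, b), K)) =
          (\<Sum>m\<in>coords X. \<Sum>h\<in>fibre L. ?j m r * ?l g h * ?e (?C (?A m) (?W h))) -
          (\<Sum>m\<in>coords X. \<Sum>h\<in>fibre L. ?l g h * ?j m r * ?e (?C (?Y h) (?B m)))"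
        unfolding rs(1) g(1) comps C D by (subst (2) sum.swap) simp
      also have "\<dots> = (\<Sum>m\<in>coords X. \<Sum>h\<in>fibre L. ?j m r * ?l g h *
            ?e (\<lambda>ab. M_bracket E z w (c, i, x, [m], (ab, [h]))))"
        unfolding comps end_conj_diff sum_subtractf[symmetric] by (simp add: algebra_simps)
      also have "\<dots> = ?R"
        unfolding 11 One_nat_def sum_lists_1[OF finite[of "coords X"]] sum_lists_1[OF finite_fibres(2)[OF X E L]]
        by (simp add: rs(1) g)
      finally show ?thesis .
    next
      case 02
      then obtain g h where gh: "K = [g, h]" "g \<in> fibre L" "h \<in> fibre L" and J0: "J = []"
        using J K K' by (auto simp: length_Suc_conv numeral_2_eq_2)
      let ?A = "\<lambda>m ab. z (c, i, x, [], (ab, [m]))" and ?B = "\<lambda>m ab. w (c, i, x, [], (ab, [m]))"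
      have C: "?C (\<lambda>ab. z (d, j, x, [], (ab, [r]))) (\<lambda>ab. w (d, j, x, [], (ab, [s]))) (a, b) =
          (\<Sum>m\<in>fibre L. \<Sum>n\<in>fibre L. ?l r m * ?l s n * ?e (?C (?A m) (?B n)))"
        if "r \<in> fibre L" "s \<in> fibre L" for r s
        by (rule mat_comm_end_conj[OF x(3,5)]) (use tz(2) tw(2) that ab in auto)
      have "M_bracket E z w (d, j, x, J, ((a, b), K)) =
          (\<Sum>m\<in>fibre L. \<Sum>n\<in>fibre L. ?l g m * ?l h n * ?e (?C (?A m) (?B n))) -
          (\<Sum>n\<in>fibre L. \<Sum>m\<in>fibre L. ?l h n * ?l g m * ?e (?C (?A n) (?B m)))"
        unfolding gh(1) J0 comps C[OF gh(2,3)] C[OF gh(3,2)] ..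
      also have "(\<Sum>n\<in>fibre L. \<Sum>m\<in>fibre L. ?l h n * ?l g m * ?e (?C (?A n) (?B m))) =
          (\<Sum>m\<in>fibre L. \<Sum>n\<in>fibre L. ?l h n * ?l g m * ?e (?C (?A n) (?B m)))"
        by (rule sum.swap)
      also have "(\<Sum>m\<in>fibre L. \<Sum>n\<in>fibre L. ?l g m * ?l h n * ?e (?C (?A m) (?B n))) - \<dots> =
          (\<Sum>m\<in>fibre L. \<Sum>n\<in>fibre L. ?l g m * ?l h n *
            ?e (\<lambda>ab. M_bracket E z w (c, i, x, [], (ab, [m, n]))))"
        unfolding comps end_conj_diff sum_subtractf[symmetric] by (simp add: algebra_simps)
      also have "\<dots> = ?R"
        unfolding 02 sum_lists_2[OF finite_fibres(2)[OF X E L]] sum_lists_0 by (simp add: gh(1) J0 lessThan_2)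
      finally show ?thesis .
    qed
  qed
qed

text \<open>For positive \<open>p\<close>, the component of type \<open>(p, q)\<close> is dbar of
  the component of type \<open>(p - 1, q)\<close>, a form of degree 0 or 1, for which the
  transformation law of dbar has been established.\<close>

lemma M_dbar_M2:
  assumes z: "z \<in> M_space X E L 1"
  shows "M_dbar X E L z \<in> M_space X E L 2"
proof (rule M_spaceI)
  show zero: "M_dbar X E L z (c, i, x, J, (ab, K)) = 0" if "length J + length K \<noteq> 2" for c i x J ab K
  proof -
    have "z (c, i, y, nths J (- {t}), (ab, K)) = 0" if "t < length J" for t y
      using \<open>length J + length K \<noteq> 2\<close> that
      by (intro M_spaceD_zero[OF z]) (simp add: length_nths_delete)
    then show ?thesis by (simp add: M_dbar_eq chart_dbar_const)
  qed
  fix p q :: nat assume pq: "p + q = 2"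
  show "M_component p q (M_dbar X E L z) \<in> ext_forms X E L p q"
  proof (cases p)
    case 0
    have "M_component p q (M_dbar X E L z) = (\<lambda>_. 0)"
      by (auto simp: M_component_def M_dbar_eq 0)
    then show ?thesis
      using forms_zero[OF X transition_hol_ext_bundle[OF X E L]] by (auto simp: ext_forms_ext_bundle alternating_def)
  next
    case (Suc p')
    have eq: "M_component p q (M_dbar X E L z) = dbar X (ext_bundle E L q) (M_component p' q z)"
    proof
      fix k :: "'c \<times> ('i \<times> 'j) \<times> 'x \<times> 'n list \<times> ('f \<times> 'f) \<times> 'g list"
      obtain c i x J ab K where k: "k = (c, i, x, J, (ab, K))" by (metis surj_pair)
      show "M_component p q (M_dbar X E L z) k = dbar X (ext_bundle E L q) (M_component p' q z) k"
      proof (cases "length J = p \<and> length K = q")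
        case True
        then show ?thesis
          by (auto simp: k M_component_apply M_dbar_eq dbar_eq frame_dom_ext_bundle length_nths_delete Suc intro!: sum.cong)
      next
        case False
        have "M_component p' q z (c, i, y, nths J (- {t}), (ab, K)) = 0" if "t < length J" for t y
          using False that length_nths_delete[OF that] by (auto simp: M_component_apply Suc)
        then show ?thesis
          using False by (auto simp: k M_component_apply dbar_eq chart_dbar_const)
      qed
    qed
    have "M_component p' q z \<in> forms X (ext_bundle E L q) p'"
      using M_spaceD[OF z, of p' q] pq Suc by (simp add: ext_forms_ext_bundle)
    moreover have "p' = 0 \<or> p' = Suc 0" using pq Suc by auto
    ultimately have "M_component p q (M_dbar X E L z) \<in> forms X (ext_bundle E L q) p"
      unfolding eq using dbar_forms_0[OF X transition_hol_ext_bundle[OF X E L]]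
        dbar_forms_1[OF X transition_hol_ext_bundle[OF X E L]] Suc by (auto simp: numeral_2_eq_2)
    \<comment> \<open>As \<open>p\<close> is positive, \<open>q\<close> is at most 1, and lists of
      length at most 1 have only the trivial permutation.\<close>
    moreover have "alternating (\<lambda>K. M_component p q (M_dbar X E L z) (c, i, x, J, (ab, K)))" for c i x J ab
      using pq Suc by (intro alternating_le1) (auto simp: M_component_apply split: if_splits)
    ultimately show ?thesis by (simp add: ext_forms_ext_bundle)
  qed
qed

lemma M_dbar_lin:
  assumes z: "z \<in> M_space X E L n" and w: "w \<in> M_space X E L m"
  shows "M_dbar X E L (\<lambda>k. s * z k + w k) k = s * M_dbar X E L z k + M_dbar X E L w k"
proof -
  obtain c i x J ab K where k: "k = (c, i, x, J, (ab, K))" by (metis surj_pair)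
  show ?thesis
  proof (cases "x \<in> chart_dom X c \<and> x \<in> frame_dom E (fst i) \<and> x \<in> frame_dom L (snd i) \<and> set J \<subseteq> coords X")
    case True
    have "chart_dbar X c (J ! t) (\<lambda>x. s * z (c, i, x, J', (ab, K)) + w (c, i, x, J', (ab, K))) x =
        s * chart_dbar X c (J ! t) (\<lambda>x. z (c, i, x, J', (ab, K))) x + chart_dbar X c (J ! t) (\<lambda>x. w (c, i, x, J', (ab, K))) x"
      if "t < length J" for t J'
    proof -
      have b: "J ! t \<in> coords X" using True that by auto
      have d: "chart_diff X c (J ! t) (\<lambda>x. z (c, i, x, J', (ab, K))) x" "chart_diff X c (J ! t) (\<lambda>x. w (c, i, x, J', (ab, K))) x"
        using M_space_chart_diff[OF X E L z] M_space_chart_diff[OF X E L w] True b by blast+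
      have "chart_dbar X c (J ! t) (\<lambda>x. s * z (c, i, x, J', (ab, K)) + w (c, i, x, J', (ab, K))) x =
        chart_dbar X c (J ! t) (\<lambda>x. s * z (c, i, x, J', (ab, K))) x + chart_dbar X c (J ! t) (\<lambda>x. w (c, i, x, J', (ab, K))) x"
        by (intro chart_dbar_add chart_diff_mult chart_diff_const d)
      then show ?thesis using True by (simp add: chart_dbar_cmult[OF X d(1)])
    qed
    then show ?thesis unfolding k M_dbar_eq using True
      by (simp add: sum_distrib_left sum.distrib[symmetric] algebra_simps)
  qed (auto simp: k M_dbar_eq)
qed

context
  fixes \<theta> :: "('c, 'i \<times> 'j, 'x, 'n, ('f \<times> 'f) \<times> 'g list) coeff_index \<Rightarrow> complex"
  assumes \<theta>: "\<theta> \<in> ext_forms X E L 0 1"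
begin

lemma theta_M1: "\<theta> \<in> M_space X E L 1"
proof (rule M_spaceI)
  have eq: "M_component p q \<theta> (c, i, x, J, (ab, K)) = (if p = 0 \<and> q = 1 then \<theta> (c, i, x, J, (ab, K)) else 0)"
    for p q c i x J ab K
    using theta_support[OF \<theta>, of c i x J ab K] by (auto simp: M_component_apply)
  fix p q :: nat assume pq: "p + q = 1"
  show "M_component p q \<theta> \<in> ext_forms X E L p q"
  proof (cases "p = 0")
    case True
    then have "M_component p q \<theta> = \<theta>" using pq by (auto simp: eq)
    then show ?thesis using \<theta> True pq by simp
  next
    case False
    then have "M_component p q \<theta> = (\<lambda>_. 0)" by (auto simp: eq)
    then show ?thesis
      using forms_zero[OF X transition_hol_ext_bundle[OF X E L]] by (auto simp: ext_forms_ext_bundle alternating_def)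
  qed
qed (use theta_support[OF \<theta>] in fastforce)

lemma M_diff_lin:
  assumes "z \<in> M_space X E L n" "w \<in> M_space X E L m"
  shows "M_diff X E L \<theta> (\<lambda>k. s * z k + w k) k = s * M_diff X E L \<theta> z k + M_diff X E L \<theta> w k"
  unfolding M_diff_eq[OF \<theta>] M_dbar_lin[OF assms] M_bracket_lin_right by (simp only: distrib_left add_ac)

end

end

section \<open>Algebra-valued functions\<close>

locale complex_algebra = vector_space s for s :: "complex \<Rightarrow> 'b::comm_ring_1 \<Rightarrow> 'b" +
  assumes scale_mult: "s c x * y = s c (x * y)"
begin

lemma scale_mult_right: "x * s c y = s c (x * y)"
  using scale_mult[of c y x] by (simp add: mult.commute)

lemma scale_times: "s c x * s d y = s (c * d) (x * y)"
  by (simp add: scale_mult scale_mult_right)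

definition functional :: "('b \<Rightarrow> complex) \<Rightarrow> bool" where
  "functional \<phi> \<longleftrightarrow> (\<forall>x y. \<phi> (x + y) = \<phi> x + \<phi> y) \<and> (\<forall>c x. \<phi> (s c x) = c * \<phi> x)"

lemma functional_add: "functional \<phi> \<Longrightarrow> \<phi> (x + y) = \<phi> x + \<phi> y"
  and functional_scale: "functional \<phi> \<Longrightarrow> \<phi> (s c x) = c * \<phi> x"
  by (auto simp: functional_def)

lemma functional_zero: "functional \<phi> \<Longrightarrow> \<phi> 0 = 0"
  using functional_scale[of \<phi> 0 0] by simp

lemma functional_minus: "functional \<phi> \<Longrightarrow> \<phi> (- x) = - \<phi> x"
  using functional_scale[of \<phi> "-1" x] by simp

lemma functional_diff: "functional \<phi> \<Longrightarrow> \<phi> (x - y) = \<phi> x - \<phi> y"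
  using functional_add[of \<phi> x "- y"] by (simp add: functional_minus)

lemma functional_sum: "functional \<phi> \<Longrightarrow> \<phi> (\<Sum>i\<in>I. f i) = (\<Sum>i\<in>I. \<phi> (f i))"
  by (induction I rule: infinite_finite_induct) (auto simp: functional_zero functional_add)

text \<open>\<open>alg_dbar X c b x f f'\<close> says that \<open>f\<close> is a finite sum of functions \<open>s (w y) v\<close> with \<open>w\<close>
  differentiable at \<open>x\<close>, and that \<open>f'\<close> is its derivative in the direction of the conjugate
  \<open>b\<close>-th coordinate of the chart \<open>c\<close>.\<close>

inductive alg_dbar ::
  "('c, 'x, 'n::finite) manifold \<Rightarrow> 'c \<Rightarrow> 'n \<Rightarrow> 'x \<Rightarrow> ('x \<Rightarrow> 'b) \<Rightarrow> 'b \<Rightarrow> bool" for X c b x where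
  base: "chart_diff X c b w x \<Longrightarrow> alg_dbar X c b x (\<lambda>y. s (w y) v) (s (chart_dbar X c b w x) v)"
| add: "alg_dbar X c b x f f' \<Longrightarrow> alg_dbar X c b x g g' \<Longrightarrow> alg_dbar X c b x (\<lambda>y. f y + g y) (f' + g')"

lemma alg_dbar_const: "alg_dbar X c b x (\<lambda>_. k) 0"
proof -
  have "alg_dbar X c b x (\<lambda>y. s ((\<lambda>_. 1) y) k) (s (chart_dbar X c b (\<lambda>_. 1) x) k)"
    by (rule alg_dbar.base) (rule chart_diff_const)
  then show ?thesis by (simp add: chart_dbar_const)
qed

lemma alg_dbar_sum:
  "(\<And>i. i \<in> I \<Longrightarrow> alg_dbar X c b x (f i) (f' i)) \<Longrightarrow> alg_dbar X c b x (\<lambda>y. \<Sum>i\<in>I. f i y) (\<Sum>i\<in>I. f' i)"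
  by (induction I rule: infinite_finite_induct) (auto intro: alg_dbar_const alg_dbar.add)

text \<open>The return from the formal derivative to an actual one: after a functional the value
  \<open>f'\<close> is determined by the function \<open>f\<close>, whatever sum was used to
  represent it.\<close>

lemma alg_dbar_functional:
  assumes f: "alg_dbar X c b x f f'" and \<phi>: "functional \<phi>" and X: "complex_manifold X" and x: "x \<in> chart_dom X c"
  shows "chart_diff X c b (\<lambda>y. \<phi> (f y)) x \<and> chart_dbar X c b (\<lambda>y. \<phi> (f y)) x = \<phi> f'"
  using f
proof induction
  case (base w v)
  have "(\<lambda>y. \<phi> (s (w y) v)) = (\<lambda>y. \<phi> v * w y)" by (simp add: functional_scale[OF \<phi>] mult.commute)
  then show ?case
    using chart_diff_mult[OF chart_diff_const base] chart_dbar_cmult[OF X base x]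
    by (simp add: functional_scale[OF \<phi>] mult.commute)
next
  case (add f f' g g')
  then show ?case by (simp add: functional_add[OF \<phi>] chart_diff_add chart_dbar_add)
qed

lemma alg_dbar_mult:
  assumes f: "alg_dbar X c b x f f'" and g: "alg_dbar X c b x g g'"
    and X: "complex_manifold X" and x: "x \<in> chart_dom X c"
  shows "alg_dbar X c b x (\<lambda>y. f y * g y) (f' * g x + f x * g')"
  using f
proof induction
  case f: (base w v)
  from g show ?case
  proof induction
    case (base w' v')
    have "alg_dbar X c b x (\<lambda>y. s (w y * w' y) (v * v')) (s (chart_dbar X c b (\<lambda>y. w y * w' y) x) (v * v'))"
      by (intro alg_dbar.base chart_diff_mult f base)
    then show ?case
      by (simp add: scale_times chart_dbar_mult[OF X f base x] scale_left_distrib)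
  next
    case (add h h' k k')
    from alg_dbar.add[OF add.IH] show ?case by (simp add: algebra_simps)
  qed
next
  case (add h h' k k')
  from alg_dbar.add[OF add.IH] show ?case by (simp add: algebra_simps)
qed

lemma alg_dbar_uminus: "alg_dbar X c b x f f' \<Longrightarrow> complex_manifold X \<Longrightarrow> x \<in> chart_dom X c \<Longrightarrow>
    alg_dbar X c b x (\<lambda>y. - f y) (- f')"
  using alg_dbar_mult[OF alg_dbar_const[of X c b x "-1"], of f f'] by simp

lemma alg_dbar_diff: "alg_dbar X c b x f f' \<Longrightarrow> alg_dbar X c b x g g' \<Longrightarrow> complex_manifold X \<Longrightarrow> x \<in> chart_dom X c \<Longrightarrow>
    alg_dbar X c b x (\<lambda>y. f y - g y) (f' - g')"
  using alg_dbar.add[OF _ alg_dbar_uminus, of X c b x f f' g g'] by simp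

lemma alg_dbar_scale: "alg_dbar X c b x f f' \<Longrightarrow> complex_manifold X \<Longrightarrow> x \<in> chart_dom X c \<Longrightarrow>
    alg_dbar X c b x (\<lambda>y. s k (f y)) (s k f')"
  using alg_dbar_mult[OF alg_dbar_const[of X c b x "s k 1"], of f f'] by (simp add: scale_mult)

lemma alg_dbar_mat_mult:
  assumes "\<And>a b'. alg_dbar X c b x (\<lambda>y. A y (a, b')) (A' (a, b'))" "\<And>a b'. alg_dbar X c b x (\<lambda>y. B y (a, b')) (B' (a, b'))"
    and X: "complex_manifold X" and x: "x \<in> chart_dom X c"
  shows "alg_dbar X c b x (\<lambda>y. mat_mult R (A y) (B y) ab) (mat_mult R A' (B x) ab + mat_mult R (A x) B' ab)"
proof -
  obtain p q where ab: "ab = (p, q)" by (metis surj_pair)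
  show ?thesis
    unfolding ab mat_mult_def prod.case sum.distrib[symmetric]
    by (intro alg_dbar_sum alg_dbar_mult assms)
qed

lemma alg_dbar_mat_comm:
  assumes "\<And>a b'. alg_dbar X c b x (\<lambda>y. A y (a, b')) (A' (a, b'))" "\<And>a b'. alg_dbar X c b x (\<lambda>y. B y (a, b')) (B' (a, b'))"
    and X: "complex_manifold X" and x: "x \<in> chart_dom X c"
  shows "alg_dbar X c b x (\<lambda>y. mat_comm R (A y) (B y) ab) (mat_comm R A' (B x) ab + mat_comm R (A x) B' ab)"
proof -
  have eq: "mat_comm R A' (B x) ab + mat_comm R (A x) B' ab =
      (mat_mult R A' (B x) ab + mat_mult R (A x) B' ab) - (mat_mult R B' (A x) ab + mat_mult R (B x) A' ab)"
    by (simp add: mat_comm_def)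
  show ?thesis
    unfolding eq unfolding mat_comm_def by (intro alg_dbar_diff alg_dbar_mat_mult assms)
qed

section \<open>Bilinearity of the bracket over the algebra\<close>

lemma sign_scale: "(-1) ^ t * s c x = s ((-1) ^ t * c) x"
  by (cases "even t") simp_all

lemma shuffle_sign_scale: "shuffle_sign S * s c x = s (shuffle_sign S * c) x"
  by (simp add: shuffle_sign_def sign_scale)

lemma mat_comm_scale: "mat_comm R (\<lambda>ab. s (A ab) v) (\<lambda>ab. s (B ab) w) ab = s (mat_comm R A B ab) (v * w)"
proof -
  obtain p q where ab: "ab = (p, q)" by (metis surj_pair)
  show ?thesis
    by (simp add: ab mat_comm_def mat_mult_def scale_times scale_sum_left scale_left_diff_distrib mult.commute)
qed

lemma M_bracket_scale:
  "M_bracket E (\<lambda>k. s (z k) v) (\<lambda>k. s (z' k) w) k = s (M_bracket E z z' k) (v * w)"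
proof -
  obtain c i x J ab K where k: "k = (c, i, x, J, (ab, K))" by (metis surj_pair)
  show ?thesis
    unfolding k M_bracket_alt mat_comm_scale sign_scale shuffle_sign_scale scale_sum_left[symmetric] ..
qed

end

lemma mat_comm_sum_left: "mat_comm R (\<lambda>ab. \<Sum>t\<in>I. A t ab) B ab = (\<Sum>t\<in>I. mat_comm R (A t) B ab)"
  by (simp add: mat_comm_def mat_mult_sum sum_subtractf)

lemma mat_comm_sum_right: "mat_comm R B (\<lambda>ab. \<Sum>t\<in>I. A t ab) ab = (\<Sum>t\<in>I. mat_comm R B (A t) ab)"
  by (simp add: mat_comm_def mat_mult_sum sum_subtractf)

lemma M_bracket_sum_left: "M_bracket E (\<lambda>k. \<Sum>t\<in>I. f t k) w k = (\<Sum>t\<in>I. M_bracket E (f t) w k)"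
proof -
  obtain c i x J ab K where k: "k = (c, i, x, J, (ab, K))" by (metis surj_pair)
  have "M_bracket E (\<lambda>k. \<Sum>t\<in>I. f t k) w k =
      (\<Sum>S\<in>Pow {..<length J}. \<Sum>T\<in>Pow {..<length K}. \<Sum>t\<in>I. shuffle_sign S * (shuffle_sign T *
      ((-1) ^ (length (nths J (- S)) * length (nths K T)) *
       mat_comm (fibre E) (\<lambda>ab. f t (c, i, x, nths J S, (ab, nths K T)))
         (\<lambda>ab. w (c, i, x, nths J (- S), (ab, nths K (- T)))) ab)))"
    unfolding k M_bracket_alt mat_comm_sum_left by (simp add: sum_distrib_left)
  also have "\<dots> = (\<Sum>t\<in>I. \<Sum>S\<in>Pow {..<length J}. \<Sum>T\<in>Pow {..<length K}. shuffle_sign S * (shuffle_sign T *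
      ((-1) ^ (length (nths J (- S)) * length (nths K T)) *
       mat_comm (fibre E) (\<lambda>ab. f t (c, i, x, nths J S, (ab, nths K T)))
         (\<lambda>ab. w (c, i, x, nths J (- S), (ab, nths K (- T)))) ab)))"
    by (rule trans[OF sum.cong[OF refl sum.swap] sum.swap])
  also have "\<dots> = (\<Sum>t\<in>I. M_bracket E (f t) w k)"
    unfolding k M_bracket_alt by (simp add: sum_distrib_left)
  finally show ?thesis .
qed

lemma M_bracket_sum_right: "M_bracket E w (\<lambda>k. \<Sum>t\<in>I. f t k) k = (\<Sum>t\<in>I. M_bracket E w (f t) k)"
proof -
  obtain c i x J ab K where k: "k = (c, i, x, J, (ab, K))" by (metis surj_pair)
  have "M_bracket E w (\<lambda>k. \<Sum>t\<in>I. f t k) k =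
      (\<Sum>S\<in>Pow {..<length J}. \<Sum>T\<in>Pow {..<length K}. \<Sum>t\<in>I. shuffle_sign S * (shuffle_sign T *
      ((-1) ^ (length (nths J (- S)) * length (nths K T)) *
       mat_comm (fibre E) (\<lambda>ab. w (c, i, x, nths J S, (ab, nths K T)))
         (\<lambda>ab. f t (c, i, x, nths J (- S), (ab, nths K (- T)))) ab)))"
    unfolding k M_bracket_alt mat_comm_sum_right by (simp add: sum_distrib_left)
  also have "\<dots> = (\<Sum>t\<in>I. \<Sum>S\<in>Pow {..<length J}. \<Sum>T\<in>Pow {..<length K}. shuffle_sign S * (shuffle_sign T *
      ((-1) ^ (length (nths J (- S)) * length (nths K T)) *
       mat_comm (fibre E) (\<lambda>ab. w (c, i, x, nths J S, (ab, nths K T)))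
         (\<lambda>ab. f t (c, i, x, nths J (- S), (ab, nths K (- T)))) ab)))"
    by (rule trans[OF sum.cong[OF refl sum.swap] sum.swap])
  also have "\<dots> = (\<Sum>t\<in>I. M_bracket E w (f t) k)"
    unfolding k M_bracket_alt by (simp add: sum_distrib_left)
  finally show ?thesis .
qed

lemma mat_comm_anti: "mat_comm R A B ab = - mat_comm R B A ab"
  by (simp add: mat_comm_def)

lemma length_sum_2_cases:
  assumes "length J + length K = 2"
  obtains (20) p q where "J = [p, q]" "K = []" | (11) p g where "J = [p]" "K = [g]"
    | (02) g h where "J = []" "K = [g, h]"
proof -
  have "length J = 2 \<and> length K = 0 \<or> length J = 1 \<and> length K = 1 \<or> length J = 0 \<and> length K = 2"
    using assms by linarith
  then show ?thesis
    using 20 11 02 by (auto simp: length_Suc_conv numeral_2_eq_2)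
qed

text \<open>Two elements of odd degree in a graded Lie algebra have a symmetric bracket. The mixed
  brackets of \<theta> and \<open>z\<close> are therefore equal and cancel the factor 1/2 in the
  curvature.\<close>

lemma M_bracket_sym:
  assumes z: "degree_one z" and w: "degree_one w"
  shows "M_bracket E z w k = M_bracket E w z k"
proof -
  obtain c i x J ab K where k: "k = (c, i, x, J, (ab, K))" by (metis surj_pair)
  show ?thesis
  proof (cases "length J + length K = 2")
    case True
    then show ?thesis
    proof (cases rule: length_sum_2_cases)
      case (20 p q)
      show ?thesis unfolding k 20 M_bracket_components[OF z w] M_bracket_components[OF w z]
        by (subst (1 2) mat_comm_anti) simp
    next
      case (11 p g)
      show ?thesis unfolding k 11 M_bracket_components[OF z w] M_bracket_components[OF w z]
        by (subst (1 2) mat_comm_anti) simp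
    next
      case (02 g h)
      show ?thesis unfolding k 02 M_bracket_components[OF z w] M_bracket_components[OF w z]
        by (subst (1 2) mat_comm_anti) simp
    qed
  next
    case False
    then show ?thesis using M_bracket_degree_two[OF z w] M_bracket_degree_two[OF w z] by (simp add: k)
  qed
qed

section \<open>Bianchi identities\<close>

text \<open>In these identities \<open>d\<^sub>p\<^sub>q\<close> stands for the derivative of \<open>A\<^sub>q\<close> in direction \<open>p\<close>, \<open>F\<close> for the
  curvature, and \<open>T\<close> for the value of \<open>\<theta>\<close>, which may replace \<open>Y\<close> in products with \<open>F\<close>.\<close>

lemma bianchi_30:
  assumes "\<And>ab. F12 ab = d12 ab - d21 ab + mat_comm R A1 A2 ab"
    and "\<And>ab. F13 ab = d13 ab - d31 ab + mat_comm R A1 A3 ab"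
    and "\<And>ab. F23 ab = d23 ab - d32 ab + mat_comm R A2 A3 ab"
    and z: "mat_comm R F12 A3 = (\<lambda>_. 0)" "mat_comm R F13 A2 = (\<lambda>_. 0)" "mat_comm R F23 A1 = (\<lambda>_. 0)"
  shows "(mat_comm R d12 A3 ab + mat_comm R A2 d13 ab) - (mat_comm R d21 A3 ab + mat_comm R A1 d23 ab) +
      (mat_comm R d31 A2 ab + mat_comm R A1 d32 ab) = 0"
proof -
  \<comment> \<open>The definition of the curvature eliminates three of the six derivatives and the
    other three cancel. What is left is the Jacobi identity for \<open>A1\<close>,
    \<open>A2\<close>, \<open>A3\<close> and commutators with the curvature, which vanish by
    hypothesis.\<close>
  have d: "d12 = (\<lambda>ab. F12 ab + d21 ab - mat_comm R A1 A2 ab)" "d13 = (\<lambda>ab. F13 ab + d31 ab - mat_comm R A1 A3 ab)"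
    "d23 = (\<lambda>ab. F23 ab + d32 ab - mat_comm R A2 A3 ab)"
    using assms(1-3) by auto
  have z': "mat_mult R F12 A3 ab = mat_mult R A3 F12 ab" "mat_mult R F13 A2 ab = mat_mult R A2 F13 ab" "mat_mult R F23 A1 ab = mat_mult R A1 F23 ab"
    using z[THEN fun_cong, of ab] by (simp_all add: mat_comm_def)
  show ?thesis unfolding d mat_comm_def by (simp add: mat_mult_lin mat_mult_assoc z')
qed

lemma bianchi_21:
  assumes "\<And>ab. F12 ab = d12 ab - d21 ab + mat_comm R A1 A2 ab"
    and "\<And>ab. F1 ab = d1 ab + mat_comm R A1 Y ab" and "\<And>ab. F2 ab = d2 ab + mat_comm R A2 Y ab"
    and z: "mat_comm R F1 A2 = (\<lambda>_. 0)" "mat_comm R F2 A1 = (\<lambda>_. 0)" and Y: "mat_comm R F12 Y = mat_comm R F12 T"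
  shows "(mat_comm R d12 Y ab + mat_comm R A2 d1 ab) - (mat_comm R d21 Y ab + mat_comm R A1 d2 ab) + mat_comm R T F12 ab = 0"
proof -
  have d: "d12 = (\<lambda>ab. F12 ab + d21 ab - mat_comm R A1 A2 ab)" "d1 = (\<lambda>ab. F1 ab - mat_comm R A1 Y ab)"
    "d2 = (\<lambda>ab. F2 ab - mat_comm R A2 Y ab)"
    using assms(1-3) by auto
  have z': "mat_mult R F1 A2 ab = mat_mult R A2 F1 ab" "mat_mult R F2 A1 ab = mat_mult R A1 F2 ab"
    "mat_mult R F12 Y ab = mat_mult R Y F12 ab + (mat_mult R F12 T ab - mat_mult R T F12 ab)"
    using z[THEN fun_cong, of ab] Y[THEN fun_cong, of ab] by (simp_all add: mat_comm_def algebra_simps)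
  show ?thesis unfolding d mat_comm_def by (simp add: mat_mult_lin mat_mult_assoc z')
qed

lemma bianchi_12:
  assumes "\<And>ab. F1 ab = d1 ab + mat_comm R A Y1 ab" "\<And>ab. F2 ab = d2 ab + mat_comm R A Y2 ab"
    and F12: "\<And>ab. F12 ab = mat_comm R Y1 Y2 ab"
    and z: "mat_comm R F12 A = (\<lambda>_. 0)" and Y: "mat_comm R F2 Y1 = mat_comm R F2 T1" "mat_comm R F1 Y2 = mat_comm R F1 T2"
  shows "mat_comm R d1 Y2 ab + mat_comm R Y1 d2 ab - (mat_comm R T1 F2 ab - mat_comm R T2 F1 ab) = 0"
proof -
  have d: "d1 = (\<lambda>ab. F1 ab - mat_comm R A Y1 ab)" "d2 = (\<lambda>ab. F2 ab - mat_comm R A Y2 ab)"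
    using assms(1-2) by auto
  have F12': "F12 = mat_comm R Y1 Y2" using F12 by auto
  \<comment> \<open>\<open>F12\<close> is itself the commutator of \<open>Y1\<close> and
    \<open>Y2\<close>; that it commutes with \<open>A\<close> is solved for one triple product, in
    order to rewrite with it.\<close>
  have z': "mat_mult R A (mat_mult R Y1 Y2) ab = mat_mult R A (mat_mult R Y2 Y1) ab + (mat_mult R Y1 (mat_mult R Y2 A) ab - mat_mult R Y2 (mat_mult R Y1 A) ab)"
    using z[THEN fun_cong, of ab] unfolding F12' mat_comm_def by (simp add: mat_mult_lin mat_mult_assoc algebra_simps)
  have Y': "mat_mult R F2 Y1 ab = mat_mult R Y1 F2 ab + (mat_mult R F2 T1 ab - mat_mult R T1 F2 ab)"
    "mat_mult R F1 Y2 ab = mat_mult R Y2 F1 ab + (mat_mult R F1 T2 ab - mat_mult R T2 F1 ab)"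
    using Y[THEN fun_cong, of ab] by (simp_all add: mat_comm_def algebra_simps)
  show ?thesis unfolding d mat_comm_def by (simp add: mat_mult_lin mat_mult_assoc z' Y')
qed

lemma bianchi_03:
  assumes F: "\<And>ab. F12 ab = mat_comm R Y1 Y2 ab" "\<And>ab. F13 ab = mat_comm R Y1 Y3 ab" "\<And>ab. F23 ab = mat_comm R Y2 Y3 ab"
    and T: "mat_comm R F23 Y1 = mat_comm R F23 T1" "mat_comm R F13 Y2 = mat_comm R F13 T2" "mat_comm R F12 Y3 = mat_comm R F12 T3"
  shows "mat_comm R T1 F23 ab - mat_comm R T2 F13 ab + mat_comm R T3 F12 ab = 0"
proof -
  \<comment> \<open>Replacing each \<open>T\<close> by \<open>Y\<close> again turns the claim into
    the Jacobi identity for \<open>Y1\<close>, \<open>Y2\<close>, \<open>Y3\<close>.\<close>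
  have "mat_comm R T1 F23 ab - mat_comm R T2 F13 ab + mat_comm R T3 F12 ab =
      mat_comm R Y1 F23 ab - mat_comm R Y2 F13 ab + mat_comm R Y3 F12 ab"
    using T[THEN fun_cong, of ab] by (simp add: mat_comm_anti[of R T1] mat_comm_anti[of R T2] mat_comm_anti[of R T3]
        mat_comm_anti[of R Y1] mat_comm_anti[of R Y2] mat_comm_anti[of R Y3])
  moreover have "F12 = mat_comm R Y1 Y2" "F13 = mat_comm R Y1 Y3" "F23 = mat_comm R Y2 Y3" using F by auto
  ultimately show ?thesis unfolding mat_comm_def by (simp add: mat_mult_lin mat_mult_assoc)
qed

text \<open>Only singletons \<open>T\<close> leave an index list of length one for \<open>u\<close>.
  The bracket with \<theta> thus becomes an alternating sum over the positions in \<open>K\<close>,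
  in analogy to dbar over the positions in \<open>J\<close>.\<close>

lemma end_bracket_single:
  assumes u: "\<And>ab K. length K \<noteq> 1 \<Longrightarrow> u (ab, K) = 0"
  shows "end_bracket R u w (ab, K) =
    (\<Sum>t<length K. (-1) ^ t * mat_comm R (\<lambda>ab. u (ab, [K ! t])) (\<lambda>ab. w (ab, nths K (- {t}))) ab)"
proof -
  let ?g = "\<lambda>T. shuffle_sign T * mat_comm R (\<lambda>ab. u (ab, nths K T)) (\<lambda>ab. w (ab, nths K (- T))) ab"
  have "end_bracket R u w (ab, K) = (\<Sum>T\<in>Pow {..<length K}. ?g T)"
    by (rule end_bracket_alt)
  also have "\<dots> = (\<Sum>T\<in>(\<lambda>t. {t}) ` {..<length K}. ?g T)"
  proof (rule sum.mono_neutral_right)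
    show "\<forall>T\<in>Pow {..<length K} - (\<lambda>t. {t}) ` {..<length K}. ?g T = 0"
    proof
      fix T assume T: "T \<in> Pow {..<length K} - (\<lambda>t. {t}) ` {..<length K}"
      then have "{i. i < length K \<and> i \<in> T} = T" by auto
      then have "length (nths K T) = card T" by (simp add: length_nths)
      moreover have "card T \<noteq> 1" using T by (auto simp: card_1_singleton_iff)
      ultimately show "?g T = 0" by (simp add: u mat_comm_zero)
    qed
  qed auto
  also have "\<dots> = (\<Sum>t<length K. ?g {t})"
    by (subst sum.reindex) auto
  also have "\<dots> = (\<Sum>t<length K. (-1) ^ t * mat_comm R (\<lambda>ab. u (ab, [K ! t])) (\<lambda>ab. w (ab, nths K (- {t}))) ab)"
  proof (intro sum.cong refl)
    fix t assume "t \<in> {..<length K}"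
    then have "nths K {t} = [K ! t]"
    proof (induction K arbitrary: t)
      case (Cons a K)
      show ?case
      proof (cases t)
        case (Suc t')
        then have "{j. Suc j \<in> {t}} = {t'}" by auto
        then show ?thesis using Cons Suc by (simp add: nths_Cons)
      qed (simp add: nths_Cons)
    qed simp
    then show "?g {t} = (-1) ^ t * mat_comm R (\<lambda>ab. u (ab, [K ! t])) (\<lambda>ab. w (ab, nths K (- {t}))) ab"
      by (simp add: shuffle_sign_simps)
  qed
  finally show ?thesis .
qed

lemma M_dbar_nil: "M_dbar X E L w (c, i, x, [], (ab, K)) = 0"
  by (simp add: M_dbar_eq)

section \<open>The curvature of a deformation\<close>

text \<open>For \<open>\<Theta> = \<theta> + z\<close> the curvature \<open>dbar \<Theta> + [\<Theta>, \<Theta>] / 2\<close> is the Maurer-Cartan expression of \<open>z\<close>.\<close>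

locale curvature = complex_algebra s for s :: "complex \<Rightarrow> 'b::comm_ring_1 \<Rightarrow> 'b" +
  fixes X :: "('c, 'x::t2_space, 'n::finite) manifold" and E :: "('i, 'x, 'f) vbundle"
    and L :: "('j, 'x, 'g) vbundle"
    and \<theta> :: "('c, 'i \<times> 'j, 'x, 'n, ('f \<times> 'f) \<times> 'g list) coeff_index \<Rightarrow> complex"
    and n :: nat
    and u :: "nat \<Rightarrow> ('c, 'i \<times> 'j, 'x, 'n, ('f \<times> 'f) \<times> 'g list) coeff_index \<Rightarrow> complex"
    and v :: "nat \<Rightarrow> 'b"
  assumes X: "complex_manifold X" and E: "holomorphic_bundle X E" and L: "holomorphic_bundle X L"
    and \<theta>: "\<theta> \<in> ext_forms X E L 0 1"
    and u: "\<And>t. t < n \<Longrightarrow> u t \<in> M_space X E L 1"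
begin

definition \<Theta> where "\<Theta> k = (\<Sum>t<n. s (u t k) (v t))"

definition curv where "curv k = (\<Sum>t<n. s (M_dbar X E L (u t) k) (v t)) + s (1 / 2) (M_bracket E \<Theta> \<Theta> k)"

definition D where
  "D c i x p J K ab = (\<Sum>t<n. s (chart_dbar X c p (\<lambda>x. u t (c, i, x, J, (ab, K))) x) (v t))"

definition DD where
  "DD c i x p q J K ab = (\<Sum>t<n. s (chart_dbar X c p (chart_dbar X c q (\<lambda>x. u t (c, i, x, J, (ab, K)))) x) (v t))"

definition in_dom where
  "in_dom c i x \<longleftrightarrow> x \<in> chart_dom X c \<and> x \<in> frame_dom E (fst i) \<and> x \<in> frame_dom L (snd i)"

lemma \<Theta>_degree_one: "degree_one \<Theta>"
  unfolding degree_one_def \<Theta>_def using M_space_degree_one[OF u] by (auto intro!: sum.neutral simp: degree_oneD)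

lemma \<Theta>_nonzero:
  assumes "\<Theta> (c, i, x, J, ((a, b), K)) \<noteq> 0"
  shows "in_dom c i x \<and> set J \<subseteq> coords X \<and> a \<in> fibre E \<and> b \<in> fibre E \<and> set K \<subseteq> fibre L"
proof -
  from assms obtain t where t: "t \<in> {..<n}" "s (u t (c, i, x, J, ((a, b), K))) (v t) \<noteq> 0"
    unfolding \<Theta>_def by (rule sum.not_neutral_contains_not_neutral)
  then have "u t (c, i, x, J, ((a, b), K)) \<noteq> 0" by auto
  from M_space_support[OF u this] t(1) show ?thesis by (auto simp: in_dom_def)
qed

lemma M_bracket_\<Theta>: "M_bracket E \<Theta> \<Theta> k = (\<Sum>t<n. \<Sum>t'<n. s (M_bracket E (u t) (u t') k) (v t * v t'))"
  unfolding \<Theta>_def[abs_def] M_bracket_sum_left M_bracket_sum_right M_bracket_scale ..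

lemma curv_expand: "curv k = (\<Sum>t<n. s (M_dbar X E L (u t) k) (v t)) +
    (\<Sum>t<n. \<Sum>t'<n. s (1 / 2 * M_bracket E (u t) (u t') k) (v t * v t'))"
  by (simp add: curv_def M_bracket_\<Theta> scale_sum_right)

text \<open>After expansion over the tensor representation, \<phi> turns the curvature into a
  complex linear combination of the \<open>M_dbar\<close> and the brackets of the
  \<open>u t\<close>, all of which lie in the degree 2 part of M.\<close>

lemma functional_curv_M2:
  assumes \<phi>: "functional \<phi>"
  shows "(\<lambda>k. \<phi> (curv k)) \<in> M_space X E L 2"
proof -
  have eq: "\<phi> (curv k) = 1 * (\<Sum>t<n. \<phi> (v t) * M_dbar X E L (u t) k) +
      (\<Sum>t<n. 1 * (\<Sum>t'<n. (1 / 2 * \<phi> (v t * v t')) * M_bracket E (u t) (u t') k))" for k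
    unfolding curv_expand
    by (simp add: functional_add[OF \<phi>] functional_sum[OF \<phi>] functional_scale[OF \<phi>] mult_ac)
  show ?thesis unfolding eq
    by (intro M_space_lin[OF X E L] M_space_sum[OF X E L] M_dbar_M2[OF X E L] M_bracket_M2[OF X E L] u) auto
qed

lemma curv_nonzero:
  assumes "curv (c, i, x, J, ((a, b), K)) \<noteq> 0"
  shows "in_dom c i x \<and> set J \<subseteq> coords X \<and> a \<in> fibre E \<and> b \<in> fibre E \<and> set K \<subseteq> fibre L \<and> length J + length K = 2"
proof -
  let ?k = "(c, i, x, J, ((a, b), K))"
  have *: "w ?k = 0" if "w \<in> M_space X E L 2" "\<not> ?thesis" for w
    using M_space_support[OF that(1), of c i x J a b K] M_spaceD_zero[OF that(1), of J K c i x "(a, b)"] that(2)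
    by (auto simp: in_dom_def)
  show ?thesis
  proof (rule ccontr)
    assume nt: "\<not> ?thesis"
    have "curv ?k = 0" unfolding curv_expand
      by (simp add: *[OF M_dbar_M2[OF X E L u] nt] *[OF M_bracket_M2[OF X E L u u] nt])
    with assms show False by simp
  qed
qed

text \<open>Stated for \<open>x - (- x)\<close> because this is how two antisymmetric commutators
  appear. In the algebra 1/2 is available as a scalar only.\<close>

lemma half_double: "s (1 / 2) (x - (- x)) = x"
proof -
  have "s (1 / 2) (x - (- x)) = s (1 / 2 + 1 / 2) x"
    by (simp only: diff_minus_eq_add scale_right_distrib scale_left_distrib)
  then show ?thesis by simp
qed

lemma half_bracket:
  "s (1 / 2) (M_bracket E \<Theta> \<Theta> (c, i, x, [p, q], (ab, []))) =
    mat_comm (fibre E) (\<lambda>ab. \<Theta> (c, i, x, [p], (ab, []))) (\<lambda>ab. \<Theta> (c, i, x, [q], (ab, []))) ab"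
  "s (1 / 2) (M_bracket E \<Theta> \<Theta> (c, i, x, [p], (ab, [g]))) =
    mat_comm (fibre E) (\<lambda>ab. \<Theta> (c, i, x, [p], (ab, []))) (\<lambda>ab. \<Theta> (c, i, x, [], (ab, [g]))) ab"
  "s (1 / 2) (M_bracket E \<Theta> \<Theta> (c, i, x, [], (ab, [g, h]))) =
    mat_comm (fibre E) (\<lambda>ab. \<Theta> (c, i, x, [], (ab, [g]))) (\<lambda>ab. \<Theta> (c, i, x, [], (ab, [h]))) ab"
proof -
  have *: "s (1 / 2) (mat_comm R A B ab - mat_comm R B A ab) = mat_comm R A B ab" for R :: "'f set" and A B
    by (simp only: half_double mat_comm_anti[of R B A])
  show
  "s (1 / 2) (M_bracket E \<Theta> \<Theta> (c, i, x, [p, q], (ab, []))) =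
    mat_comm (fibre E) (\<lambda>ab. \<Theta> (c, i, x, [p], (ab, []))) (\<lambda>ab. \<Theta> (c, i, x, [q], (ab, []))) ab"
  "s (1 / 2) (M_bracket E \<Theta> \<Theta> (c, i, x, [p], (ab, [g]))) =
    mat_comm (fibre E) (\<lambda>ab. \<Theta> (c, i, x, [p], (ab, []))) (\<lambda>ab. \<Theta> (c, i, x, [], (ab, [g]))) ab"
  "s (1 / 2) (M_bracket E \<Theta> \<Theta> (c, i, x, [], (ab, [g, h]))) =
    mat_comm (fibre E) (\<lambda>ab. \<Theta> (c, i, x, [], (ab, [g]))) (\<lambda>ab. \<Theta> (c, i, x, [], (ab, [h]))) ab"
    unfolding M_bracket_components[OF \<Theta>_degree_one \<Theta>_degree_one] * by (rule refl)+
qed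

context
  fixes c i x
  assumes x: "in_dom c i x"
begin

lemma x_chart: "x \<in> chart_dom X c"
  using x by (simp add: in_dom_def)

lemma M_dbar_components:
  assumes "p \<in> coords X"
  shows "M_dbar X E L w (c, i, x, [p], (ab, K)) = chart_dbar X c p (\<lambda>x. w (c, i, x, [], (ab, K))) x"
    and "q \<in> coords X \<Longrightarrow> M_dbar X E L w (c, i, x, [p, q], (ab, K)) =
      chart_dbar X c p (\<lambda>x. w (c, i, x, [q], (ab, K))) x - chart_dbar X c q (\<lambda>x. w (c, i, x, [p], (ab, K))) x"
    and "q \<in> coords X \<Longrightarrow> r \<in> coords X \<Longrightarrow> M_dbar X E L w (c, i, x, [p, q, r], (ab, K)) =
      chart_dbar X c p (\<lambda>x. w (c, i, x, [q, r], (ab, K))) x - chart_dbar X c q (\<lambda>x. w (c, i, x, [p, r], (ab, K))) x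
      + chart_dbar X c r (\<lambda>x. w (c, i, x, [p, q], (ab, K))) x"
  using x assms by (simp_all add: M_dbar_eq nths_Cons in_dom_def lessThan_Suc)

lemma curv_components:
  assumes p: "p \<in> coords X"
  shows "q \<in> coords X \<Longrightarrow> curv (c, i, x, [p, q], (ab, [])) = D c i x p [q] [] ab - D c i x q [p] [] ab +
      mat_comm (fibre E) (\<lambda>ab. \<Theta> (c, i, x, [p], (ab, []))) (\<lambda>ab. \<Theta> (c, i, x, [q], (ab, []))) ab"
    and "curv (c, i, x, [p], (ab, [g])) = D c i x p [] [g] ab +
      mat_comm (fibre E) (\<lambda>ab. \<Theta> (c, i, x, [p], (ab, []))) (\<lambda>ab. \<Theta> (c, i, x, [], (ab, [g]))) ab"
  unfolding curv_def half_bracket D_def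
  by (simp_all add: M_dbar_components p scale_left_diff_distrib sum_subtractf)

lemma curv_components_02: "curv (c, i, x, [], (ab, [g, h])) =
      mat_comm (fibre E) (\<lambda>ab. \<Theta> (c, i, x, [], (ab, [g]))) (\<lambda>ab. \<Theta> (c, i, x, [], (ab, [h]))) ab"
  unfolding curv_def half_bracket by (simp add: M_dbar_nil)

lemma alg_dbar_\<Theta>: "p \<in> coords X \<Longrightarrow> alg_dbar X c p x (\<lambda>x. \<Theta> (c, i, x, J, (ab, K))) (D c i x p J K ab)"
  unfolding \<Theta>_def D_def
  using x M_space_chart_diff[OF X E L u] by (intro alg_dbar_sum alg_dbar.base) (auto simp: in_dom_def)

lemma alg_dbar_M_dbar:
  assumes "p \<in> coords X"
  shows "alg_dbar X c p x (\<lambda>x. \<Sum>t<n. s (M_dbar X E L (u t) (c, i, x, J, (ab, K))) (v t))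
    (\<Sum>t<n. s (chart_dbar X c p (\<lambda>x. M_dbar X E L (u t) (c, i, x, J, (ab, K))) x) (v t))"
  using x M_space_chart_diff[OF X E L M_dbar_M2[OF X E L u]] assms
  by (intro alg_dbar_sum alg_dbar.base) (auto simp: in_dom_def)

lemma fd: "open (frame_dom (ext_bundle E L 0) i)" "x \<in> frame_dom (ext_bundle E L 0) i"
  "y \<in> chart_dom X c \<Longrightarrow> y \<in> frame_dom (ext_bundle E L 0) i \<Longrightarrow> in_dom c i y"
  using x open_fd[OF X E L] by (auto simp: frame_dom_ext_bundle in_dom_def)

lemma DD_commute: "p \<in> coords X \<Longrightarrow> q \<in> coords X \<Longrightarrow> DD c i x p q J K ab = DD c i x q p J K ab"
  unfolding DD_def using chart_dbar_commute[OF X fd(1) M_space_smooth[OF X E L u] x_chart fd(2)]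
  by (intro sum.cong refl) auto

end

lemma chart_dbar_M_dbar:
  assumes x: "in_dom c i x" and pq: "p \<in> coords X" "q \<in> coords X" and t: "t < n"
  shows "chart_dbar X c p (\<lambda>x. M_dbar X E L (u t) (c, i, x, [q], (ab, K))) x =
      chart_dbar X c p (chart_dbar X c q (\<lambda>x. u t (c, i, x, [], (ab, K)))) x"
    and "r \<in> coords X \<Longrightarrow> chart_dbar X c p (\<lambda>x. M_dbar X E L (u t) (c, i, x, [q, r], (ab, K))) x =
      chart_dbar X c p (chart_dbar X c q (\<lambda>x. u t (c, i, x, [r], (ab, K)))) x -
      chart_dbar X c p (chart_dbar X c r (\<lambda>x. u t (c, i, x, [q], (ab, K)))) x"
proof -
  note cong = chart_dbar_cong[OF X fd(1)[OF x] x_chart[OF x] fd(2)[OF x] pq(1)]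
  show "chart_dbar X c p (\<lambda>x. M_dbar X E L (u t) (c, i, x, [q], (ab, K))) x =
      chart_dbar X c p (chart_dbar X c q (\<lambda>x. u t (c, i, x, [], (ab, K)))) x"
    by (rule cong) (use M_dbar_components(1)[OF _ pq(2)] fd(3)[OF x] in blast)
  assume r: "r \<in> coords X"
  have d: "chart_diff X c p (chart_dbar X c m (\<lambda>x. u t (c, i, x, J, (ab, K)))) x" if "m \<in> coords X" for m J
    by (rule chart_smooth_chart_diff[OF X fd(1)[OF x] chart_smooth_chart_dbar[OF X fd(1)[OF x] that M_space_smooth[OF X E L u[OF t]]]
        x_chart[OF x] fd(2)[OF x] pq(1)])
  have "chart_dbar X c p (\<lambda>x. M_dbar X E L (u t) (c, i, x, [q, r], (ab, K))) x =
      chart_dbar X c p (\<lambda>x. chart_dbar X c q (\<lambda>x. u t (c, i, x, [r], (ab, K))) x +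
        (- 1) * chart_dbar X c r (\<lambda>x. u t (c, i, x, [q], (ab, K))) x) x"
    by (rule cong) (use M_dbar_components(2)[OF _ pq(2) r] fd(3)[OF x] in simp)
  also have "\<dots> = chart_dbar X c p (chart_dbar X c q (\<lambda>x. u t (c, i, x, [r], (ab, K)))) x +
      chart_dbar X c p (\<lambda>x. (- 1) * chart_dbar X c r (\<lambda>x. u t (c, i, x, [q], (ab, K))) x) x"
    by (rule chart_dbar_add) (intro d chart_diff_mult chart_diff_const pq r)+
  also have "chart_dbar X c p (\<lambda>x. (- 1) * chart_dbar X c r (\<lambda>x. u t (c, i, x, [q], (ab, K))) x) x =
      (- 1) * chart_dbar X c p (chart_dbar X c r (\<lambda>x. u t (c, i, x, [q], (ab, K)))) x"
    by (rule chart_dbar_cmult[OF X d[OF r] x_chart[OF x]])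
  finally show "chart_dbar X c p (\<lambda>x. M_dbar X E L (u t) (c, i, x, [q, r], (ab, K))) x =
      chart_dbar X c p (chart_dbar X c q (\<lambda>x. u t (c, i, x, [r], (ab, K)))) x -
      chart_dbar X c p (chart_dbar X c r (\<lambda>x. u t (c, i, x, [q], (ab, K)))) x" by simp
qed

text \<open>The Leibniz rule for the components of the curvature. Second derivatives are kept apart
  as \<open>DD\<close>, so that their symmetry can remove them from the alternating sums of the
  Bianchi identity.\<close>

lemma alg_dbar_curv:
  assumes x: "in_dom c i x" and p: "p \<in> coords X"
  shows "q \<in> coords X \<Longrightarrow> r \<in> coords X \<Longrightarrow> alg_dbar X c p x (\<lambda>x. curv (c, i, x, [q, r], (ab, [])))
      (DD c i x p q [r] [] ab - DD c i x p r [q] [] ab +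
       (mat_comm (fibre E) (D c i x p [q] []) (\<lambda>ab. \<Theta> (c, i, x, [r], (ab, []))) ab +
        mat_comm (fibre E) (\<lambda>ab. \<Theta> (c, i, x, [q], (ab, []))) (D c i x p [r] []) ab))"
    and "q \<in> coords X \<Longrightarrow> alg_dbar X c p x (\<lambda>x. curv (c, i, x, [q], (ab, [g])))
      (DD c i x p q [] [g] ab +
       (mat_comm (fibre E) (D c i x p [q] []) (\<lambda>ab. \<Theta> (c, i, x, [], (ab, [g]))) ab +
        mat_comm (fibre E) (\<lambda>ab. \<Theta> (c, i, x, [q], (ab, []))) (D c i x p [] [g]) ab))"
    and "alg_dbar X c p x (\<lambda>x. curv (c, i, x, [], (ab, [g, h])))
       (mat_comm (fibre E) (D c i x p [] [g]) (\<lambda>ab. \<Theta> (c, i, x, [], (ab, [h]))) ab +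
        mat_comm (fibre E) (\<lambda>ab. \<Theta> (c, i, x, [], (ab, [g]))) (D c i x p [] [h]) ab)"
proof -
  note com = alg_dbar_mat_comm[OF alg_dbar_\<Theta>[OF x p] alg_dbar_\<Theta>[OF x p] X x_chart[OF x]]
  note db = alg_dbar_M_dbar[OF x p]
  show "alg_dbar X c p x (\<lambda>x. curv (c, i, x, [q, r], (ab, [])))
      (DD c i x p q [r] [] ab - DD c i x p r [q] [] ab +
       (mat_comm (fibre E) (D c i x p [q] []) (\<lambda>ab. \<Theta> (c, i, x, [r], (ab, []))) ab +
        mat_comm (fibre E) (\<lambda>ab. \<Theta> (c, i, x, [q], (ab, []))) (D c i x p [r] []) ab))"
    if qr: "q \<in> coords X" "r \<in> coords X"
  proof -
    have eq: "DD c i x p q [r] [] ab - DD c i x p r [q] [] ab =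
        (\<Sum>t<n. s (chart_dbar X c p (\<lambda>x. M_dbar X E L (u t) (c, i, x, [q, r], (ab, []))) x) (v t))"
      unfolding DD_def sum_subtractf[symmetric] scale_left_diff_distrib[symmetric]
      by (intro sum.cong refl) (simp add: chart_dbar_M_dbar(2)[OF x p qr(1) _ qr(2)])
    show ?thesis unfolding curv_def half_bracket eq by (intro alg_dbar.add db com)
  qed
  show "alg_dbar X c p x (\<lambda>x. curv (c, i, x, [q], (ab, [g])))
      (DD c i x p q [] [g] ab +
       (mat_comm (fibre E) (D c i x p [q] []) (\<lambda>ab. \<Theta> (c, i, x, [], (ab, [g]))) ab +
        mat_comm (fibre E) (\<lambda>ab. \<Theta> (c, i, x, [q], (ab, []))) (D c i x p [] [g]) ab))"
    if q: "q \<in> coords X"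
  proof -
    have eq: "DD c i x p q [] [g] ab =
        (\<Sum>t<n. s (chart_dbar X c p (\<lambda>x. M_dbar X E L (u t) (c, i, x, [q], (ab, [g]))) x) (v t))"
      unfolding DD_def by (intro sum.cong refl) (simp add: chart_dbar_M_dbar(1)[OF x p q])
    show ?thesis unfolding curv_def half_bracket eq by (intro alg_dbar.add db com)
  qed
  show "alg_dbar X c p x (\<lambda>x. curv (c, i, x, [], (ab, [g, h])))
       (mat_comm (fibre E) (D c i x p [] [g]) (\<lambda>ab. \<Theta> (c, i, x, [], (ab, [h]))) ab +
        mat_comm (fibre E) (\<lambda>ab. \<Theta> (c, i, x, [], (ab, [g]))) (D c i x p [] [h]) ab)"
  proof -
    have eq: "(\<lambda>x. curv (c, i, x, [], (ab, [g, h]))) = (\<lambda>x.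
       mat_comm (fibre E) (\<lambda>ab. \<Theta> (c, i, x, [], (ab, [g]))) (\<lambda>ab. \<Theta> (c, i, x, [], (ab, [h]))) ab)"
      unfolding curv_def half_bracket by (simp add: M_dbar_nil)
    show ?thesis unfolding eq by (rule com)
  qed
qed

text \<open>The value of \<open>\<theta>\<close> may replace that of \<open>\<Theta>\<close> in products with the curvature; this holds when
  the curvature takes values in an ideal that is annihilated by the maximal ideal.\<close>

context
  assumes ann: "\<And>k k'. curv k * \<Theta> k' = s (\<theta> k') (curv k)"
begin

lemma mat_comm_ann:
  "mat_comm R (\<lambda>ab. curv (c, i, x, J, (ab, K))) (\<lambda>ab. \<Theta> (c', i', x', J', (ab, K'))) =
   mat_comm R (\<lambda>ab. curv (c, i, x, J, (ab, K))) (\<lambda>ab. s (\<theta> (c', i', x', J', (ab, K'))) 1)"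
  by (auto simp: mat_comm_def mat_mult_def ann mult.commute[of "\<Theta> _"] scale_mult_right mult.commute[of "s _ 1"])

text \<open>\<theta> has no part of type (0,1), and it is \<theta> that decides how the curvature
  multiplies \<Theta>.\<close>

lemma mat_comm_ann_zero:
  "mat_comm R (\<lambda>ab. curv (c, i, x, J, (ab, K))) (\<lambda>ab. \<Theta> (c', i', x', [p], (ab, []))) = (\<lambda>_. 0)"
proof -
  have "\<theta> (c', i', x', [p], (ab, [])) = 0" for ab
    using theta_support[OF \<theta>, of c' i' x' "[p]" ab "[]"] by auto
  then show ?thesis unfolding mat_comm_ann by (simp add: mat_comm_zero)
qed

lemma mat_comm_functional:
  assumes \<phi>: "functional \<phi>"
  shows "mat_comm R (\<lambda>ab. A ab) (\<lambda>ab. \<phi> (F ab)) ab = \<phi> (mat_comm R (\<lambda>ab. s (A ab) 1) F ab)"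
proof -
  obtain p q where ab: "ab = (p, q)" by (metis surj_pair)
  show ?thesis
    by (simp add: ab mat_comm_def mat_mult_def functional_diff[OF \<phi>] functional_sum[OF \<phi>] scale_mult scale_mult_right
        functional_scale[OF \<phi>] mult.commute)
qed

text \<open>The differential of the curvature lives in total degree 3. Each of its four types is one
  of the identities \<open>bianchi_30\<close>, \<open>bianchi_21\<close>, \<open>bianchi_12\<close>,
  \<open>bianchi_03\<close>; in the first two the second derivatives of \<Theta> cancel
  beforehand.\<close>

theorem functional_curv_Z2:
  assumes \<phi>: "functional \<phi>"
  shows "(\<lambda>k. \<phi> (curv k)) \<in> Z2 X E L \<theta>"
proof -
  let ?w = "\<lambda>k. \<phi> (curv k)"
  let ?C = "mat_comm (fibre E)"
  have "M_diff X E L \<theta> ?w k = 0" for k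
  proof -
    obtain c i x J ab K where k: "k = (c, i, x, J, (ab, K))" by (metis surj_pair)
    let ?A = "\<lambda>J K ab. \<Theta> (c, i, x, J, (ab, K))" and ?F = "\<lambda>J K ab. curv (c, i, x, J, (ab, K))"
    let ?T = "\<lambda>g ab. s (\<theta> (c, i, x, [], (ab, [g]))) 1"
    have \<theta>0: "\<theta> (c, i, x, [], (ab, K)) = 0" if "length K \<noteq> 1" for ab K
      using theta_support[OF \<theta>, of c i x "[]" ab K] that by auto
    have "M_diff X E L \<theta> ?w k = M_dbar X E L ?w k +
        (-1) ^ length J * end_bracket (fibre E) (\<lambda>f. \<theta> (c, i, x, [], f)) (\<lambda>f. ?w (c, i, x, J, f)) (ab, K)"
      by (simp add: k M_diff_def M_dbar_def ext_bundle_def)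
    also have "\<dots> = M_dbar X E L ?w k + (-1) ^ length J *
        (\<Sum>t<length K. (-1) ^ t * \<phi> (?C (?T (K ! t)) (?F J (nths K (- {t}))) ab))"
      using end_bracket_single[of "\<lambda>f. \<theta> (c, i, x, [], f)" "fibre E" "\<lambda>f. ?w (c, i, x, J, f)" ab K] \<theta>0
      by (simp add: mat_comm_functional[OF \<phi>])
    finally have eq: "M_diff X E L \<theta> ?w k = M_dbar X E L ?w k + (-1) ^ length J *
        (\<Sum>t<length K. (-1) ^ t * \<phi> (?C (?T (K ! t)) (?F J (nths K (- {t}))) ab))" .
    show ?thesis
    proof (cases "in_dom c i x \<and> set J \<subseteq> coords X \<and> length J + length K = 3")
      case False
      have "M_dbar X E L ?w k = 0"
      proof (cases "in_dom c i x \<and> set J \<subseteq> coords X")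
        case True
        then have "length J + length K \<noteq> 3" using False by blast
        then have "curv (c, i, y, nths J (- {t}), (ab, K)) = 0" if "t < length J" for t y
          using curv_nonzero[of c i y "nths J (- {t})" "fst ab" "snd ab" K] length_nths_delete[OF that] that
          by fastforce
        then show ?thesis by (simp add: k M_dbar_eq functional_zero[OF \<phi>] chart_dbar_const)
      qed (auto simp: k M_dbar_eq in_dom_def)
      moreover have "?F J (nths K (- {t})) = (\<lambda>_. 0)" if "t < length K" for t
      proof
        fix ab
        show "?F J (nths K (- {t})) ab = 0"
          using curv_nonzero[of c i x J "fst ab" "snd ab" "nths K (- {t})"] length_nths_delete[OF that] that False
          by fastforce
      qed
      ultimately show ?thesis unfolding eq by (simp add: mat_comm_zero functional_zero[OF \<phi>])
    next
      case True
      then have x: "in_dom c i x" and J: "set J \<subseteq> coords X" by auto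
      note \<phi>_simps = functional_add[OF \<phi>] functional_diff[OF \<phi>]
      have cw: "chart_dbar X c p (\<lambda>y. \<phi> (f y)) x = \<phi> f'" if "alg_dbar X c p x f f'" for f f' p
        using alg_dbar_functional[OF that \<phi> X x_chart[OF x]] by blast
      from True consider "length J = 3" "length K = 0" | "length J = 2" "length K = 1"
        | "length J = 1" "length K = 2" | "length J = 0" "length K = 3" by linarith
      then show ?thesis
      proof cases
        case 1
        then obtain p q r where JK: "J = [p, q, r]" "K = []" by (auto simp: length_Suc_conv numeral_3_eq_3)
        then have N: "p \<in> coords X" "q \<in> coords X" "r \<in> coords X" using J by auto
        have "M_diff X E L \<theta> ?w k = \<phi> (
           (?C (D c i x p [q] []) (?A [r] []) ab + ?C (?A [q] []) (D c i x p [r] []) ab) -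
           (?C (D c i x q [p] []) (?A [r] []) ab + ?C (?A [p] []) (D c i x q [r] []) ab) +
           (?C (D c i x r [p] []) (?A [q] []) ab + ?C (?A [p] []) (D c i x r [q] []) ab))"
          unfolding eq unfolding k JK M_dbar_components(3)[OF x N] cw[OF alg_dbar_curv(1)[OF x N(1,2,3)]]
            cw[OF alg_dbar_curv(1)[OF x N(2,1,3)]] cw[OF alg_dbar_curv(1)[OF x N(3,1,2)]]
            DD_commute[OF x N(2,1)] DD_commute[OF x N(3,1)] DD_commute[OF x N(3,2)]
          by (simp add: \<phi>_simps)
        also have "\<dots> = \<phi> 0"
          by (subst bianchi_30[OF curv_components(1)[OF x N(1,2)] curv_components(1)[OF x N(1,3)]
              curv_components(1)[OF x N(2,3)] mat_comm_ann_zero mat_comm_ann_zero mat_comm_ann_zero]) (rule refl)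
        finally show ?thesis by (simp add: functional_zero[OF \<phi>])
      next
        case 2
        then obtain p q g where JK: "J = [p, q]" "K = [g]" by (auto simp: length_Suc_conv numeral_2_eq_2)
        then have N: "p \<in> coords X" "q \<in> coords X" using J by auto
        have "M_diff X E L \<theta> ?w k = \<phi> (
           (?C (D c i x p [q] []) (?A [] [g]) ab + ?C (?A [q] []) (D c i x p [] [g]) ab) -
           (?C (D c i x q [p] []) (?A [] [g]) ab + ?C (?A [p] []) (D c i x q [] [g]) ab) +
           ?C (?T g) (?F [p, q] []) ab)"
          unfolding eq unfolding k JK M_dbar_components(2)[OF x N] cw[OF alg_dbar_curv(2)[OF x N(1,2)]]
            cw[OF alg_dbar_curv(2)[OF x N(2,1)]] DD_commute[OF x N(2,1)]
          by (simp add: \<phi>_simps nths_Cons)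
        also have "\<dots> = \<phi> 0"
          by (subst bianchi_21[OF curv_components(1)[OF x N(1,2)] curv_components(2)[OF x N(1)]
              curv_components(2)[OF x N(2)] mat_comm_ann_zero mat_comm_ann_zero mat_comm_ann]) (rule refl)
        finally show ?thesis by (simp add: functional_zero[OF \<phi>])
      next
        case 3
        then obtain p g h where JK: "J = [p]" "K = [g, h]" by (auto simp: length_Suc_conv numeral_2_eq_2)
        then have N: "p \<in> coords X" using J by auto
        have "M_diff X E L \<theta> ?w k = \<phi> (
           ?C (D c i x p [] [g]) (?A [] [h]) ab + ?C (?A [] [g]) (D c i x p [] [h]) ab -
           (?C (?T g) (?F [p] [h]) ab - ?C (?T h) (?F [p] [g]) ab))"
          unfolding eq unfolding k JK M_dbar_components(1)[OF x N] cw[OF alg_dbar_curv(3)[OF x N]]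
          by (simp add: \<phi>_simps nths_Cons)
        also have "\<dots> = \<phi> 0"
          by (subst bianchi_12[OF curv_components(2)[OF x N] curv_components(2)[OF x N]
              curv_components_02 mat_comm_ann_zero mat_comm_ann mat_comm_ann]) (rule x refl)+
        finally show ?thesis by (simp add: functional_zero[OF \<phi>])
      next
        case 4
        then obtain g h l where JK: "J = []" "K = [g, h, l]" by (auto simp: length_Suc_conv numeral_3_eq_3)
        have "M_diff X E L \<theta> ?w k =
           \<phi> (?C (?T g) (?F [] [h, l]) ab - ?C (?T h) (?F [] [g, l]) ab + ?C (?T l) (?F [] [g, h]) ab)"
          unfolding eq unfolding k JK by (simp add: \<phi>_simps nths_Cons M_dbar_nil lessThan_Suc)
        also have "\<dots> = \<phi> 0"
          by (subst bianchi_03[OF curv_components_02[OF x] curv_components_02[OF x] curv_components_02[OF x]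
              mat_comm_ann mat_comm_ann mat_comm_ann]) (rule refl)
        finally show ?thesis by (simp add: functional_zero[OF \<phi>])
      qed
    qed
  qed
  then show ?thesis using functional_curv_M2[OF \<phi>] by (auto simp: Z2_def)
qed

end

end

section \<open>Traces of words\<close>

definition mat_one :: "'f \<times> 'f \<Rightarrow> 'v::comm_ring_1" where
  "mat_one = (\<lambda>(a, b). if a = b then 1 else 0)"

lemma mat_one_apply: "mat_one (a, b) = (if a = b then 1 else 0)"
  by (simp add: mat_one_def)

text \<open>The recursion of \<open>word_product\<close> over an arbitrary coefficient ring, needed
  for words in the algebra-valued field.\<close>

fun mat_word :: "'f set \<Rightarrow> ('f \<times> 'f \<Rightarrow> 'v::comm_ring_1) list \<Rightarrow> 'f \<times> 'f \<Rightarrow> 'v" where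
  "mat_word R [] = mat_one"
| "mat_word R (A # As) = mat_mult R A (mat_word R As)"

definition mat_trace :: "'f set \<Rightarrow> ('f \<times> 'f \<Rightarrow> 'v::comm_ring_1) \<Rightarrow> 'v" where
  "mat_trace R A = (\<Sum>a\<in>R. A (a, a))"

lemma word_product_mat_word: "word_product R As ab = mat_word R As ab"
proof (induction As arbitrary: ab)
  case Nil
  then show ?case by (cases ab) (simp add: mat_one_apply)
next
  case (Cons A As)
  then show ?case by (cases ab) (simp add: mat_mult_def)
qed

lemma trace_word_mat_trace: "trace_word R As = mat_trace R (mat_word R As)"
  by (simp add: trace_word_def mat_trace_def word_product_mat_word)

lemma mat_trace_cong: "(\<And>a b. a \<in> R \<Longrightarrow> b \<in> R \<Longrightarrow> A (a, b) = B (a, b)) \<Longrightarrow> mat_trace R A = mat_trace R B"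
  by (simp add: mat_trace_def)

lemma mat_trace_mat_mult_commute: "mat_trace R (mat_mult R A B) = mat_trace R (mat_mult R B A)"
  unfolding mat_trace_def mat_mult_def prod.case by (subst sum.swap) (simp add: mult.commute)

lemma mat_trace_add: "mat_trace R (\<lambda>ab. A ab + B ab) = mat_trace R A + mat_trace R B"
  by (simp add: mat_trace_def sum.distrib)

lemma mat_trace_diff: "mat_trace R (\<lambda>ab. A ab - B ab) = mat_trace R A - mat_trace R B"
  by (simp add: mat_trace_def sum_subtractf)

lemma mat_mult_cong:
  assumes "\<And>m. m \<in> R \<Longrightarrow> A (a, m) = A' (a, m)" "\<And>m. m \<in> R \<Longrightarrow> B (m, b) = B' (m, b)"
  shows "mat_mult R A B (a, b) = mat_mult R A' B' (a, b)"
  using assms by (simp add: mat_mult_def)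

lemma mat_mult_one:
  assumes "finite R"
  shows "a \<in> R \<Longrightarrow> mat_mult R mat_one A (a, b) = A (a, b)" "b \<in> R \<Longrightarrow> mat_mult R A mat_one (a, b) = A (a, b)"
proof -
  have "mat_mult R mat_one A (a, b) = (\<Sum>m\<in>R. if a = m then A (m, b) else 0)"
    unfolding mat_mult_def mat_one_def by (auto intro!: sum.cong)
  then show "a \<in> R \<Longrightarrow> mat_mult R mat_one A (a, b) = A (a, b)" using assms by simp
  have "mat_mult R A mat_one (a, b) = (\<Sum>m\<in>R. if b = m then A (a, m) else 0)"
    unfolding mat_mult_def mat_one_def by (auto intro!: sum.cong)
  then show "b \<in> R \<Longrightarrow> mat_mult R A mat_one (a, b) = A (a, b)" using assms by simp
qed

lemma mat_word_zero: "(\<lambda>_. 0) \<in> set As \<Longrightarrow> mat_word R As = (\<lambda>_. 0)"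
  by (induction As) (auto simp: mat_mult_zero)

text \<open>\<open>mat_one\<close> acts as a unit only on indices in \<open>R\<close>, whence the
  restriction to rows in \<open>R\<close>.\<close>

lemma mat_word_append:
  assumes R: "finite R" and a: "a \<in> R"
  shows "mat_mult R (mat_word R As) (mat_word R Bs) (a, b) = mat_word R (As @ Bs) (a, b)"
  using a
proof (induction As arbitrary: a)
  case Nil
  then show ?case by (simp add: mat_mult_one(1)[OF R])
next
  case (Cons A As)
  have "mat_mult R (mat_word R (A # As)) (mat_word R Bs) (a, b) = mat_mult R A (mat_mult R (mat_word R As) (mat_word R Bs)) (a, b)"
    by (simp only: mat_word.simps mat_mult_assoc)
  also have "\<dots> = mat_mult R A (mat_word R (As @ Bs)) (a, b)"
    by (rule mat_mult_cong) (use Cons.IH in auto)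
  finally show ?case by simp
qed

text \<open>The derivation \<open>Y g \<mapsto> F g\<close> applied to a word.\<close>

fun word_deriv :: "'f set \<Rightarrow> ('g \<Rightarrow> 'f \<times> 'f \<Rightarrow> 'v::comm_ring_1) \<Rightarrow> ('g \<Rightarrow> 'f \<times> 'f \<Rightarrow> 'v) \<Rightarrow> 'g list \<Rightarrow> 'f \<times> 'f \<Rightarrow> 'v" where
  "word_deriv R Y F [] = (\<lambda>_. 0)"
| "word_deriv R Y F (g # K) = (\<lambda>ab. mat_mult R (F g) (mat_word R (map Y K)) ab + mat_mult R (Y g) (word_deriv R Y F K) ab)"

text \<open>The commutator with \<open>A\<close> is a derivation, so applying it to one letter after
  the other telescopes to the commutator of \<open>A\<close> with the whole word.\<close>

lemma word_deriv_mat_comm: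
  assumes R: "finite R" and d: "\<And>g ab. d g ab = F g ab - mat_comm R A (Y g) ab" and "a \<in> R" "b \<in> R"
  shows "word_deriv R Y d K (a, b) = word_deriv R Y F K (a, b) -
    (mat_mult R A (mat_word R (map Y K)) (a, b) - mat_mult R (mat_word R (map Y K)) A (a, b))"
  using assms(3,4)
proof (induction K arbitrary: a)
  case Nil
  then show ?case by (simp add: mat_mult_one[OF R])
next
  case (Cons g K)
  let ?W = "mat_word R (map Y K)"
  have d': "d g = (\<lambda>ab. F g ab - (mat_mult R A (Y g) ab - mat_mult R (Y g) A ab))"
    using d by (auto simp: mat_comm_def)
  have "mat_mult R (Y g) (word_deriv R Y d K) (a, b) =
      mat_mult R (Y g) (\<lambda>ab. word_deriv R Y F K ab - (mat_mult R A ?W ab - mat_mult R ?W A ab)) (a, b)"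
    by (rule mat_mult_cong) (use Cons in auto)
  then show ?case unfolding word_deriv.simps d' by (simp add: mat_mult_lin mat_mult_assoc)
qed

lemma mat_trace_word_deriv_mat_comm:
  assumes "finite R" "\<And>g ab. d g ab = F g ab - mat_comm R A (Y g) ab"
  shows "mat_trace R (word_deriv R Y d K) = mat_trace R (word_deriv R Y F K)"
proof -
  have "mat_trace R (word_deriv R Y d K) = mat_trace R (\<lambda>ab. word_deriv R Y F K ab -
    (mat_mult R A (mat_word R (map Y K)) ab - mat_mult R (mat_word R (map Y K)) A ab))"
    by (rule mat_trace_cong) (rule word_deriv_mat_comm[OF assms])
  then show ?thesis
    by (simp add: mat_trace_diff mat_trace_mat_mult_commute[of R A])
qed

text \<open>The shape that occurs in \<open>h1\<close>: the cocycle stands in front, the field in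
  the remaining places.\<close>

fun first_letter_trace where
  "first_letter_trace R Y F [] = 0"
| "first_letter_trace R Y F (g # K) = mat_trace R (mat_mult R (F g) (mat_word R (map Y K)))"

text \<open>Cyclicity of the trace brings the differentiated letter to the front. The prefix
  \<open>P\<close> collects the letters already passed, which makes the induction work; for empty
  \<open>P\<close> the words on the right are the rotations of \<open>K\<close>.\<close>

lemma mat_trace_word_deriv_prefix:
  assumes R: "finite R"
  shows "mat_trace R (mat_mult R (mat_word R (map Y P)) (word_deriv R Y F K)) =
    (\<Sum>q<length K. first_letter_trace R Y F (drop q K @ P @ take q K))"
proof (induction K arbitrary: P)
  case Nil
  then show ?case by (simp add: mat_mult_zero mat_trace_def)
next
  case (Cons g K)
  let ?W = "\<lambda>K. mat_word R (map Y K)"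
  have "mat_trace R (mat_mult R (?W P) (word_deriv R Y F (g # K))) =
      mat_trace R (mat_mult R (?W P) (mat_mult R (F g) (?W K))) + mat_trace R (mat_mult R (?W P) (mat_mult R (Y g) (word_deriv R Y F K)))"
    by (simp add: mat_mult_lin mat_trace_add)
  also have "mat_trace R (mat_mult R (?W P) (mat_mult R (F g) (?W K))) = mat_trace R (mat_mult R (F g) (mat_mult R (?W K) (?W P)))"
    by (simp add: mat_trace_mat_mult_commute[of R "?W P"] mat_mult_assoc)
  also have "\<dots> = mat_trace R (mat_mult R (F g) (?W (K @ P)))"
    by (rule mat_trace_cong, rule mat_mult_cong) (simp_all add: mat_word_append[OF R])
  also have "mat_trace R (mat_mult R (?W P) (mat_mult R (Y g) (word_deriv R Y F K))) = mat_trace R (mat_mult R (?W (P @ [g])) (word_deriv R Y F K))"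
  proof -
    have 1: "mat_mult R (?W P) (Y g) (a, b) = ?W (P @ [g]) (a, b)" if "a \<in> R" "b \<in> R" for a b
    proof -
      have "mat_mult R (?W P) (Y g) (a, b) = mat_mult R (?W P) (mat_word R [Y g]) (a, b)"
        by (rule mat_mult_cong) (simp_all add: mat_mult_one(2)[OF R that(2)])
      also have "\<dots> = mat_word R (map Y P @ [Y g]) (a, b)"
        by (rule mat_word_append[OF R that(1)])
      finally show ?thesis by simp
    qed
    show ?thesis
      unfolding mat_mult_assoc[symmetric] by (rule mat_trace_cong, rule mat_mult_cong) (use 1 in auto)
  qed
  finally show ?case
    unfolding Cons.IH by (simp only: length_Cons sum.lessThan_Suc_shift) simp
qed

lemma mat_trace_word_deriv:
  assumes R: "finite R"
  shows "mat_trace R (word_deriv R Y F K) = (\<Sum>q<length K. first_letter_trace R Y F (rotate q K))"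
proof -
  have "mat_trace R (word_deriv R Y F K) = mat_trace R (mat_mult R (mat_word R (map Y [])) (word_deriv R Y F K))"
    by (rule mat_trace_cong) (simp add: mat_mult_one(1)[OF R])
  also have "\<dots> = (\<Sum>q<length K. first_letter_trace R Y F (rotate q K))"
    unfolding mat_trace_word_deriv_prefix[OF R] by (intro sum.cong refl) (simp add: rotate_drop_take)
  finally show ?thesis .
qed

section \<open>Sums over all permutations of the letters\<close>

lemma sum_permute_list_left:
  assumes "\<tau> permutes {..<length K}"
  shows "(\<Sum>\<sigma> | \<sigma> permutes {..<length K}. T (permute_list \<sigma> (permute_list \<tau> K))) =
    (\<Sum>\<sigma> | \<sigma> permutes {..<length K}. T (permute_list \<sigma> K))"
proof -
  have "(\<Sum>\<sigma> | \<sigma> permutes {..<length K}. T (permute_list \<sigma> K)) =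
      (\<Sum>\<sigma> | \<sigma> permutes {..<length K}. T (permute_list (\<tau> \<circ> \<sigma>) K))"
    using setum_permutations_compose_left[OF assms, of "\<lambda>\<sigma>. T (permute_list \<sigma> K)"] .
  moreover have "T (permute_list (\<tau> \<circ> \<sigma>) K) = T (permute_list \<sigma> (permute_list \<tau> K))"
    if "\<sigma> permutes {..<length K}" for \<sigma>
    using permute_list_compose[OF that] by simp
  ultimately show ?thesis by simp
qed

text \<open>A rotation is a permutation of positions and is absorbed by the sum over all
  permutations.\<close>

lemma sum_permute_list_rotate:
  "(\<Sum>\<sigma> | \<sigma> permutes {..<length K}. T (rotate q (permute_list \<sigma> K))) =
    (\<Sum>\<sigma> | \<sigma> permutes {..<length K}. T (permute_list \<sigma> K))"
proof -
  have "mset (rotate q [0..<length K]) = mset [0..<length K]"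
    by (metis append_take_drop_id mset_append rotate_drop_take union_commute)
  \<comment> \<open>\<rho> is read off from the rotated list of positions, so that it rotates every
    list of this length.\<close>
  then obtain \<rho> where \<rho>: "\<rho> permutes {..<length [0..<length K]}"
    "permute_list \<rho> [0..<length K] = rotate q [0..<length K]"
    by (rule mset_eq_permutation)
  have rot: "rotate q L = permute_list \<rho> L" if "length L = length K" for L
  proof -
    have "rotate q L = map ((!) L) (rotate q [0..<length L])"
      by (simp only: rotate_map[symmetric] map_nth)
    also have "\<dots> = permute_list \<rho> (map ((!) L) [0..<length L])"
      using \<rho> that by (simp add: permute_list_map)
    finally show ?thesis by (simp add: map_nth)
  qed
  have "(\<Sum>\<sigma> | \<sigma> permutes {..<length K}. T (permute_list \<sigma> K)) =
      (\<Sum>\<sigma> | \<sigma> permutes {..<length K}. T (permute_list (\<sigma> \<circ> \<rho>) K))"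
    using \<rho> by (intro sum_permutations_compose_right) simp
  also have "\<dots> = (\<Sum>\<sigma> | \<sigma> permutes {..<length K}. T (rotate q (permute_list \<sigma> K)))"
    using \<rho> by (intro sum.cong refl) (simp add: permute_list_compose rot)
  finally show ?thesis by simp
qed

section \<open>Words and traces under a change of frame\<close>

context complex_algebra
begin

text \<open>Multiplying out letter by letter: \<open>K'\<close> records which summand is chosen for
  each letter, so the product of the coefficients is a transition function of the tensor power of
  \<open>L\<close>.\<close>

lemma mat_word_linear:
  assumes G: "finite G"
    and lin: "\<And>g a b. g \<in> G \<Longrightarrow> a \<in> R \<Longrightarrow> b \<in> R \<Longrightarrow> Y g (a, b) = (\<Sum>h\<in>G. s (l g h) (Z h (a, b)))"
    and "set K \<subseteq> G" "a \<in> R" "b \<in> R"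
  shows "mat_word R (map Y K) (a, b) =
    (\<Sum>K'\<in>{K'. length K' = length K \<and> set K' \<subseteq> G}. s (\<Prod>t<length K. l (K ! t) (K' ! t)) (mat_word R (map Z K') (a, b)))"
  using assms(3-)
proof (induction K arbitrary: a)
  case Nil
  then show ?case unfolding list.size(3) sum_lists_0 by (simp add: mat_one_apply)
next
  case (Cons g K)
  let ?S = "{K'. length K' = length K \<and> set K' \<subseteq> G}"
  have "mat_word R (map Y (g # K)) (a, b) = (\<Sum>m\<in>R. Y g (a, m) * mat_word R (map Y K) (m, b))"
    by (simp add: mat_mult_def)
  also have "\<dots> = (\<Sum>m\<in>R. (\<Sum>h\<in>G. s (l g h) (Z h (a, m))) *
      (\<Sum>K'\<in>?S. s (\<Prod>t<length K. l (K ! t) (K' ! t)) (mat_word R (map Z K') (m, b))))"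
    using Cons by (intro sum.cong refl) (simp add: lin)
  also have "\<dots> = (\<Sum>m\<in>R. \<Sum>h\<in>G. \<Sum>K'\<in>?S. s (l g h * (\<Prod>t<length K. l (K ! t) (K' ! t)))
      (Z h (a, m) * mat_word R (map Z K') (m, b)))"
    by (simp add: sum_product scale_times)
  also have "\<dots> = (\<Sum>h\<in>G. \<Sum>K'\<in>?S. \<Sum>m\<in>R. s (l g h * (\<Prod>t<length K. l (K ! t) (K' ! t)))
      (Z h (a, m) * mat_word R (map Z K') (m, b)))"
    by (rule trans[OF sum.swap sum.cong[OF refl sum.swap]])
  also have "\<dots> = (\<Sum>h\<in>G. \<Sum>K'\<in>?S. s (l g h * (\<Prod>t<length K. l (K ! t) (K' ! t)))
      (mat_word R (map Z (h # K')) (a, b)))"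
    by (simp add: mat_mult_def scale_sum_right)
  also have "\<dots> = (\<Sum>K'\<in>{K'. length K' = length (g # K) \<and> set K' \<subseteq> G}.
      s (\<Prod>t<length (g # K). l ((g # K) ! t) (K' ! t)) (mat_word R (map Z K') (a, b)))"
    unfolding length_Cons sum_lists_Suc[OF G] prod.lessThan_Suc_shift by simp
  finally show ?case .
qed

end

text \<open>The inner factors \<open>G' G\<close> cancel between neighbouring letters. The empty
  word has no letter to carry the outer \<open>G\<close> and \<open>G'\<close>, so it is
  excluded.\<close>

lemma mat_word_conjugate:
  assumes unit: "\<And>b c. b \<in> R \<Longrightarrow> c \<in> R \<Longrightarrow> mat_mult R G' G (b, c) = (if b = c then 1 else 0)" and R: "finite R"
    and "K \<noteq> []" "a \<in> R" "b \<in> R"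
  shows "mat_word R (map (\<lambda>g. mat_mult R G (mat_mult R (Y g) G')) K) (a, b) = mat_mult R G (mat_mult R (mat_word R (map Y K)) G') (a, b)"
  using assms(3-)
proof (induction K arbitrary: a rule: list_nonempty_induct)
  case (single g)
  have "mat_mult R (Y g) mat_one (c, d) = Y g (c, d)" if "d \<in> R" for c d
    by (rule mat_mult_one(2)[OF R that])
  then have "mat_mult R (mat_mult R (Y g) mat_one) G' = mat_mult R (Y g) G'"
    unfolding mat_mult_def[of R "mat_mult R (Y g) mat_one"] by (auto simp: mat_mult_def[of R "Y g" G'])
  then show ?case by (simp add: mat_mult_one(2)[OF R \<open>b \<in> R\<close>])
next
  case (cons g K)
  have "mat_word R (map (\<lambda>g. mat_mult R G (mat_mult R (Y g) G')) (g # K)) (a, b) =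
      mat_mult R (mat_mult R G (mat_mult R (Y g) G')) (mat_mult R G (mat_mult R (mat_word R (map Y K)) G')) (a, b)"
    unfolding list.map mat_word.simps by (rule mat_mult_cong) (use cons in auto)
  also have "\<dots> = mat_mult R G (mat_mult R (Y g) (mat_mult R (mat_mult R G' G) (mat_mult R (mat_word R (map Y K)) G'))) (a, b)"
    by (simp only: mat_mult_assoc)
  also have "mat_mult R (Y g) (mat_mult R (mat_mult R G' G) (mat_mult R (mat_word R (map Y K)) G')) = mat_mult R (Y g) (mat_mult R (mat_word R (map Y K)) G')"
    by (rule mat_mult_unit) (use unit R in auto)
  finally show ?case by (simp add: mat_mult_assoc)
qed

lemma mat_trace_conjugate:
  assumes unit: "\<And>b c. b \<in> R \<Longrightarrow> c \<in> R \<Longrightarrow> mat_mult R G' G (b, c) = (if b = c then 1 else 0)" and R: "finite R"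
    and "K \<noteq> []"
  shows "mat_trace R (mat_word R (map (\<lambda>g. mat_mult R G (mat_mult R (Y g) G')) K)) = mat_trace R (mat_word R (map Y K))"
proof -
  let ?W = "mat_word R (map Y K)"
  have "mat_trace R (mat_word R (map (\<lambda>g. mat_mult R G (mat_mult R (Y g) G')) K)) = mat_trace R (mat_mult R G (mat_mult R ?W G'))"
    by (rule mat_trace_cong) (rule mat_word_conjugate[OF assms])
  also have "\<dots> = mat_trace R (mat_mult R ?W (mat_mult R G' G))"
    by (simp add: mat_trace_mat_mult_commute[of R G] mat_mult_assoc)
  also have "\<dots> = mat_trace R (mat_mult R ?W mat_one)"
    by (rule mat_trace_cong, rule mat_mult_cong) (use unit in \<open>auto simp: mat_one_apply\<close>)
  also have "\<dots> = mat_trace R ?W"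
    by (rule mat_trace_cong) (rule mat_mult_one(2)[OF R])
  finally show ?thesis .
qed

lemma sum_lists_permute:
  assumes \<sigma>: "\<sigma> permutes {..<k}"
  shows "(\<Sum>K\<in>{K. length K = k \<and> set K \<subseteq> G}. f (permute_list \<sigma> K)) = (\<Sum>K\<in>{K. length K = k \<and> set K \<subseteq> G}. f K)"
proof (rule sum.reindex_bij_witness[where i = "permute_list (inv \<sigma>)" and j = "permute_list \<sigma>"])
  have inv: "inv \<sigma> permutes {..<k}" by (rule permutes_inv[OF \<sigma>])
  fix K assume K: "K \<in> {K. length K = k \<and> set K \<subseteq> G}"
  show "permute_list (inv \<sigma>) (permute_list \<sigma> K) = K"
    using permute_list_compose[of "inv \<sigma>" K \<sigma>] K inv by (simp add: permutes_inv_o[OF \<sigma>])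
  show "permute_list \<sigma> (permute_list (inv \<sigma>) K) = K"
    using permute_list_compose[of \<sigma> K "inv \<sigma>"] K \<sigma> by (simp add: permutes_inv_o[OF \<sigma>])
  show "permute_list \<sigma> K \<in> {K. length K = k \<and> set K \<subseteq> G}" "permute_list (inv \<sigma>) K \<in> {K. length K = k \<and> set K \<subseteq> G}"
    using K \<sigma> inv by auto
qed simp

section \<open>Traces of powers of a deformed Higgs field\<close>

context complex_algebra
begin

text \<open>The analogue of \<open>alg_dbar\<close> for smoothness: finite sums with smooth complex
  factors, from which functionals lead back to smooth complex functions.\<close>

inductive alg_smooth ::
  "('c, 'x, 'n::finite) manifold \<Rightarrow> 'c \<Rightarrow> 'x set \<Rightarrow> ('x \<Rightarrow> 'b) \<Rightarrow> bool" for X c U where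
  base: "chart_smooth X c U w \<Longrightarrow> alg_smooth X c U (\<lambda>y. s (w y) v)"
| add: "alg_smooth X c U f \<Longrightarrow> alg_smooth X c U g \<Longrightarrow> alg_smooth X c U (\<lambda>y. f y + g y)"

lemma alg_smooth_const: "complex_manifold X \<Longrightarrow> open U \<Longrightarrow> alg_smooth X c U (\<lambda>_. k)"
  using alg_smooth.base[OF chart_smooth_const, of X U c 1 k] by simp

lemma alg_smooth_sum: "complex_manifold X \<Longrightarrow> open U \<Longrightarrow> (\<And>i. i \<in> I \<Longrightarrow> alg_smooth X c U (f i)) \<Longrightarrow>
    alg_smooth X c U (\<lambda>y. \<Sum>i\<in>I. f i y)"
  by (induction I rule: infinite_finite_induct) (auto intro: alg_smooth_const alg_smooth.add)

lemma alg_smooth_mult: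
  assumes X: "complex_manifold X" and U: "open U" and f: "alg_smooth X c U f" and g: "alg_smooth X c U g"
  shows "alg_smooth X c U (\<lambda>y. f y * g y)"
  using f
proof induction
  case f: (base w v)
  from g show ?case
  proof induction
    case (base w' v')
    show ?case unfolding scale_times by (intro alg_smooth.base chart_smooth_mult[OF X U] f base)
  next
    case (add h k)
    from alg_smooth.add[OF add.IH] show ?case by (simp add: distrib_left)
  qed
next
  case (add h k)
  from alg_smooth.add[OF add.IH] show ?case by (simp add: distrib_right)
qed

lemma alg_smooth_functional:
  assumes f: "alg_smooth X c U f" and \<phi>: "functional \<phi>" and X: "complex_manifold X" and U: "open U"
  shows "chart_smooth X c U (\<lambda>y. \<phi> (f y))"
  using f
proof induction
  case (base w v)
  show ?case unfolding functional_scale[OF \<phi>] by (intro chart_smooth_mult[OF X U] chart_smooth_const[OF X U] base)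
next
  case (add f g)
  then show ?case unfolding functional_add[OF \<phi>] by (intro chart_smooth_add[OF X U])
qed

lemma alg_smooth_mat_word:
  assumes X: "complex_manifold X" and U: "open U"
    and Y: "\<And>g ab. alg_smooth X c U (\<lambda>x. Y x g ab)"
  shows "alg_smooth X c U (\<lambda>x. mat_word R (map (Y x) K) ab)"
proof (induction K arbitrary: ab)
  case Nil
  then show ?case by (simp add: alg_smooth_const[OF X U])
next
  case (Cons g K)
  obtain a b where ab: "ab = (a, b)" by (metis surj_pair)
  show ?case unfolding list.map mat_word.simps mat_mult_def ab prod.case
    by (intro alg_smooth_sum[OF X U] alg_smooth_mult[OF X U] Y Cons)
qed

lemma alg_dbar_mat_word:
  assumes X: "complex_manifold X" and x: "x \<in> chart_dom X c"
    and Y: "\<And>g ab. alg_dbar X c p x (\<lambda>x. Y x g ab) (d g ab)"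
  shows "alg_dbar X c p x (\<lambda>x. mat_word R (map (Y x) K) ab) (word_deriv R (Y x) d K ab)"
proof (induction K arbitrary: ab)
  case Nil
  then show ?case by (simp add: alg_dbar_const)
next
  case (Cons g K)
  show ?case unfolding list.map mat_word.simps word_deriv.simps by (rule alg_dbar_mat_mult[OF Y Cons X x])
qed

end

context curvature
begin

definition higgs_mat where "higgs_mat c e j x g = (\<lambda>ab. \<Theta> (c, (e, j), x, [], (ab, [g])))"

definition word_trace where "word_trace c e j x K = mat_trace (fibre E) (mat_word (fibre E) (map (higgs_mat c e j x) K))"

text \<open>This is \<open>Tr Y\<^sup>k\<close> as a symmetric tensor, where \<open>Y\<close> is the
  \<open>L\<close>-valued part of \<Theta>: traces of words averaged over the order of the letters.
  The frame of \<open>E\<close> is chosen as in \<open>h1\<close>, so that both sides can be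
  compared coefficient by coefficient.\<close>

definition trace_form :: "nat \<Rightarrow> ('c, 'j, 'x, 'n, 'g list) coeff_index \<Rightarrow> 'b" where
  "trace_form k = (\<lambda>(c, j, x, J, K). if J = [] \<and> length K = k then
     s (1 / fact k) (\<Sum>\<sigma> | \<sigma> permutes {..<k}. word_trace c (SOME e. x \<in> frame_dom E e) j x (permute_list \<sigma> K)) else 0)"

lemma finite_E: "finite (fibre E)" and finite_L: "finite (fibre L)"
  using finite_fibres[OF X E L] by auto

lemma frame_E: "x \<in> frame_dom E (SOME e. x \<in> frame_dom E e)"
proof -
  have "\<exists>e. x \<in> frame_dom E e" using E unfolding holomorphic_bundle_def by blast
  then show ?thesis by (rule someI_ex)
qed

lemma transition_refl:
  assumes "holomorphic_bundle X F" "x \<in> frame_dom F i" "a \<in> fibre F" "b \<in> fibre F"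
  shows "transition F i i x a b = (if a = b then 1 else 0)"
  using assms(1)[unfolded holomorphic_bundle_def, THEN conjunct2, THEN conjunct2, THEN conjunct2, THEN conjunct1]
    assms(2-) by blast

text \<open>The complex transition functions enter as matrices with entries \<open>s _ 1\<close>
  over the algebra, so that the change of frame is a product of matrices to which the conjugation
  lemmas for words apply.\<close>

lemma higgs_mat_transform:
  assumes x: "in_dom c (e, j) x" "in_dom d (e', j') x" and g: "g \<in> fibre L" and ab: "a \<in> fibre E" "b \<in> fibre E"
  shows "higgs_mat d e' j' x g (a, b) = (\<Sum>h\<in>fibre L. s (transition L j' j x g h)
    (mat_mult (fibre E) (\<lambda>(a, b). s (transition E e' e x a b) 1)
      (mat_mult (fibre E) (higgs_mat c e j x h) (\<lambda>(a, b). s (transition E e e' x a b) 1)) (a, b)))"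
proof -
  let ?G = "\<lambda>(a, b). s (transition E e' e x a b) 1" and ?G' = "\<lambda>(a, b). s (transition E e e' x a b) 1"
  let ?l = "transition L j' j x"
  have G: "mat_mult (fibre E) ?G (mat_mult (fibre E) (\<lambda>ab. s (w ab) k) ?G') (a, b) =
      s (mat_conj (fibre E) (transition E e' e x) (transition E e e' x) w (a, b)) k" for w k
    unfolding mat_conj_eq_mat_mult
    by (simp add: mat_mult_def scale_mult scale_mult_right scale_sum_left sum_distrib_left sum_distrib_right mult_ac)
  have "higgs_mat d e' j' x g (a, b) = (\<Sum>t<n. s (\<Sum>h\<in>fibre L. ?l g h *
      end_conj E (e', j') (e, j) x (\<lambda>ab. u t (c, (e, j), x, [], (ab, [h]))) (a, b)) (v t))"
    unfolding higgs_mat_def \<Theta>_def using x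
    by (intro sum.cong refl arg_cong2[where f = s] M1_transform(2)[OF X E L u _ _ _ _ _ _ ab g, of _ x c d "(e, j)" "(e', j')", simplified])
      (auto simp: in_dom_def)
  also have "\<dots> = (\<Sum>t<n. \<Sum>h\<in>fibre L. s (?l g h)
      (mat_mult (fibre E) ?G (mat_mult (fibre E) (\<lambda>ab. s (u t (c, (e, j), x, [], (ab, [h]))) (v t)) ?G') (a, b)))"
    unfolding G by (simp add: end_conj_def scale_sum_left)
  also have "\<dots> = (\<Sum>h\<in>fibre L. \<Sum>t<n. s (?l g h)
      (mat_mult (fibre E) ?G (mat_mult (fibre E) (\<lambda>ab. s (u t (c, (e, j), x, [], (ab, [h]))) (v t)) ?G') (a, b)))"
    by (rule sum.swap)
  also have "\<dots> = (\<Sum>h\<in>fibre L. s (?l g h) (mat_mult (fibre E) ?G (mat_mult (fibre E) (higgs_mat c e j x h) ?G') (a, b)))"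
    unfolding higgs_mat_def \<Theta>_def mat_mult_sum by (simp add: scale_sum_right)
  finally show ?thesis .
qed

text \<open>Traces are invariant under conjugation, so the frame of \<open>E\<close> drops out and
  only the transition functions of \<open>L\<close> remain.\<close>

lemma word_trace_transform:
  assumes x: "in_dom c (e, j) x" "in_dom d (e', j') x" and K: "set K \<subseteq> fibre L" "K \<noteq> []"
  shows "word_trace d e' j' x K = (\<Sum>K'\<in>{K'. length K' = length K \<and> set K' \<subseteq> fibre L}.
    s (\<Prod>t<length K. transition L j' j x (K ! t) (K' ! t)) (word_trace c e j x K'))"
proof -
  let ?G = "\<lambda>(a, b). s (transition E e' e x a b) 1" and ?G' = "\<lambda>(a, b). s (transition E e e' x a b) 1"
  let ?Z = "\<lambda>h. mat_mult (fibre E) ?G (mat_mult (fibre E) (higgs_mat c e j x h) ?G')"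
  let ?R = "fibre E"
  have unit: "mat_mult ?R ?G' ?G (b, c) = (if b = c then 1 else 0)" if "b \<in> ?R" "c \<in> ?R" for b c
  proof -
    have "mat_mult ?R ?G' ?G (b, c) = s (\<Sum>m\<in>?R. transition E e e' x b m * transition E e' e x m c) 1"
      by (simp add: mat_mult_def scale_times scale_sum_left)
    then show ?thesis
      using transition_inverse[OF X E L, of x e e' b c] x that by (simp add: in_dom_def)
  qed
  have "word_trace d e' j' x K = mat_trace ?R (\<lambda>ab. \<Sum>K'\<in>{K'. length K' = length K \<and> set K' \<subseteq> fibre L}.
    s (\<Prod>t<length K. transition L j' j x (K ! t) (K' ! t)) (mat_word ?R (map ?Z K') ab))"
    unfolding word_trace_def
    by (rule mat_trace_cong) (rule mat_word_linear[where Z = ?Z and l = "transition L j' j x", OF finite_L _ K(1)], rule higgs_mat_transform[OF x])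
  also have "\<dots> = (\<Sum>K'\<in>{K'. length K' = length K \<and> set K' \<subseteq> fibre L}.
    s (\<Prod>t<length K. transition L j' j x (K ! t) (K' ! t)) (mat_trace ?R (mat_word ?R (map ?Z K'))))"
    unfolding mat_trace_def by (subst sum.swap) (simp add: scale_sum_right)
  also have "\<dots> = (\<Sum>K'\<in>{K'. length K' = length K \<and> set K' \<subseteq> fibre L}.
    s (\<Prod>t<length K. transition L j' j x (K ! t) (K' ! t)) (word_trace c e j x K'))"
    unfolding word_trace_def using K(2)
    by (intro sum.cong refl arg_cong2[where f = s] mat_trace_conjugate unit finite_E) auto
  finally show ?thesis .
qed

text \<open>A single vanishing letter kills a product. The empty word has the rank of
  \<open>E\<close> as its trace, hence its exclusion.\<close>

lemma word_trace_zero: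
  assumes "K \<noteq> []" and "\<not> (in_dom c (e, j) x \<and> set K \<subseteq> fibre L)"
  shows "word_trace c e j x K = 0"
proof -
  have "(\<lambda>_. 0) \<in> set (map (higgs_mat c e j x) K)"
  proof -
    obtain g where g: "g \<in> set K" "\<not> (in_dom c (e, j) x \<and> g \<in> fibre L)"
      using assms by (cases K) auto
    have "higgs_mat c e j x g = (\<lambda>_. 0)"
    proof
      fix ab :: "'f \<times> 'f"
      show "higgs_mat c e j x g ab = 0"
        using \<Theta>_nonzero[of c "(e, j)" x "[]" "fst ab" "snd ab" "[g]"] g(2) by (auto simp: higgs_mat_def)
    qed
    then show ?thesis using g(1) by (auto simp: image_iff) metis
  qed
  then show ?thesis unfolding word_trace_def by (simp add: mat_word_zero mat_trace_def)
qed

text \<open>The transformation law with chart and frame of \<open>L\<close> kept fixed: the products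
  of transition functions become Kronecker symbols, and only the frame of \<open>E\<close> changes.
  This makes the pointwise choice of a frame in \<open>trace_form\<close> harmless.\<close>

lemma word_trace_frame:
  assumes "in_dom c (e, j) x" "x \<in> frame_dom E e'" "K \<noteq> []"
  shows "word_trace c e' j x K = word_trace c e j x K"
proof (cases "set K \<subseteq> fibre L")
  case True
  have x': "in_dom c (e', j) x" using assms by (simp add: in_dom_def)
  have d: "(\<Prod>t<length K. transition L j j x (K ! t) (K' ! t)) = (if K' = K then 1 else 0)"
    if K': "length K' = length K" "set K' \<subseteq> fibre L" for K'
  proof -
    have "(\<Prod>t<length K. transition L j j x (K ! t) (K' ! t)) =
        (\<Prod>t<length K. if K ! t = K' ! t then 1 else (0::complex))"
      using True K' assms(1) by (intro prod.cong refl transition_refl[OF L]) (auto simp: in_dom_def subset_eq)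
    also have "\<dots> = (if K' = K then 1 else 0)"
    proof (cases "K' = K")
      case False
      then obtain t where "t < length K" "K ! t \<noteq> K' ! t" using K'(1) nth_equalityI by metis
      then show ?thesis using False by (auto intro!: prod_zero)
    qed simp
    finally show ?thesis .
  qed
  have fin: "finite {K'. length K' = length K \<and> set K' \<subseteq> fibre L}"
    using finite_lists_length_eq[OF finite_L, of "length K"] by (simp add: conj_commute)
  have "word_trace c e' j x K = (\<Sum>K'\<in>{K'. length K' = length K \<and> set K' \<subseteq> fibre L}. if K' = K then word_trace c e j x K' else 0)"
    unfolding word_trace_transform[OF assms(1) x' True assms(3)] by (intro sum.cong refl) (simp add: d)
  then show ?thesis using True fin by simp
next
  case False
  then show ?thesis using word_trace_zero[OF assms(3)] by simp
qed

context
  fixes k :: nat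
  assumes k: "k \<ge> 1"
begin

lemma trace_form_frame:
  assumes "in_dom c (e, j) x" "length K = k"
  shows "trace_form k (c, j, x, [], K) = s (1 / fact k) (\<Sum>\<sigma> | \<sigma> permutes {..<k}. word_trace c e j x (permute_list \<sigma> K))"
  unfolding trace_form_def using assms(2) k
  by (auto intro!: arg_cong2[where f = s] sum.cong word_trace_frame[OF assms(1) frame_E] simp flip: length_0_conv)

lemma trace_form_nonzero:
  assumes "trace_form k (c, j, x, J, K) \<noteq> 0"
  shows "x \<in> chart_dom X c \<and> x \<in> frame_dom L j \<and> J = [] \<and> length K = k \<and> set K \<subseteq> fibre L"
proof -
  let ?e = "SOME e. x \<in> frame_dom E e"
  have JK: "J = []" "length K = k" using assms by (auto simp: trace_form_def split: if_splits)
  have "\<exists>\<sigma>. \<sigma> permutes {..<k} \<and> word_trace c ?e j x (permute_list \<sigma> K) \<noteq> 0"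
  proof (rule ccontr)
    assume "\<not> ?thesis"
    then have "(\<Sum>\<sigma> | \<sigma> permutes {..<k}. word_trace c ?e j x (permute_list \<sigma> K)) = 0" by (intro sum.neutral) auto
    then show False using assms by (simp add: trace_form_def JK)
  qed
  then obtain \<sigma> where \<sigma>: "\<sigma> permutes {..<k}" "word_trace c ?e j x (permute_list \<sigma> K) \<noteq> 0" by blast
  have "permute_list \<sigma> K \<noteq> []" using JK k by (auto simp flip: length_0_conv)
  then have "in_dom c (?e, j) x \<and> set (permute_list \<sigma> K) \<subseteq> fibre L"
    using word_trace_zero \<sigma>(2) by blast
  then show ?thesis using JK \<sigma>(1) by (simp add: in_dom_def)
qed

lemma trace_form_permute:
  assumes "\<tau> permutes {..<length K}"
  shows "trace_form k (c, j, x, J, permute_list \<tau> K) = trace_form k (c, j, x, J, K)"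
  using sum_permute_list_left[OF assms, of "word_trace c (SOME e. x \<in> frame_dom E e) j x"] by (auto simp: trace_form_def)

text \<open>Permuting \<open>K'\<close> together with \<open>K\<close> only reorders the factors of
  the product of transition functions, so the average over permutations obeys the law of a single
  word.\<close>

lemma trace_form_transform:
  assumes x: "x \<in> chart_dom X c" "x \<in> chart_dom X d" "x \<in> frame_dom L j" "x \<in> frame_dom L j'"
    and K: "length K = k" "set K \<subseteq> fibre L"
  shows "trace_form k (d, j', x, [], K) = (\<Sum>K'\<in>{K'. length K' = k \<and> set K' \<subseteq> fibre L}.
    s (\<Prod>t<k. transition L j' j x (K ! t) (K' ! t)) (trace_form k (c, j, x, [], K')))"
proof -
  let ?e = "SOME e. x \<in> frame_dom E e" and ?S = "{K'. length K' = k \<and> set K' \<subseteq> fibre L}"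
  let ?l = "transition L j' j x"
  have e: "in_dom c (?e, j) x" "in_dom d (?e, j') x" using x frame_E by (auto simp: in_dom_def)
  have "word_trace d ?e j' x (permute_list \<sigma> K) = (\<Sum>K'\<in>?S. s (\<Prod>t<k. ?l (K ! t) (K' ! t)) (word_trace c ?e j x (permute_list \<sigma> K')))"
    if \<sigma>: "\<sigma> permutes {..<k}" for \<sigma>
  proof -
    have ne: "permute_list \<sigma> K \<noteq> []" using K k by (auto simp flip: length_0_conv)
    have "word_trace d ?e j' x (permute_list \<sigma> K) =
        (\<Sum>K'\<in>?S. s (\<Prod>t<k. ?l (permute_list \<sigma> K ! t) (K' ! t)) (word_trace c ?e j x K'))"
      using word_trace_transform[OF e _ ne] K \<sigma> by simp
    also have "\<dots> = (\<Sum>K'\<in>?S. s (\<Prod>t<k. ?l (permute_list \<sigma> K ! t) (permute_list \<sigma> K' ! t)) (word_trace c ?e j x (permute_list \<sigma> K')))"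
      by (rule sum_lists_permute[OF \<sigma>, symmetric])
    also have "\<dots> = (\<Sum>K'\<in>?S. s (\<Prod>t<k. ?l (K ! t) (K' ! t)) (word_trace c ?e j x (permute_list \<sigma> K')))"
    proof (intro sum.cong refl arg_cong2[where f = s])
      fix K' assume K': "K' \<in> ?S"
      have "(\<Prod>t<k. ?l (permute_list \<sigma> K ! t) (permute_list \<sigma> K' ! t)) = (\<Prod>t<k. ?l (K ! \<sigma> t) (K' ! \<sigma> t))"
        using K K' \<sigma> by (intro prod.cong refl) (simp add: permute_list_nth)
      also have "\<dots> = (\<Prod>t<k. ?l (K ! t) (K' ! t))"
        using prod.permute[OF \<sigma>, of "\<lambda>t. ?l (K ! t) (K' ! t)"] by (simp add: o_def)
      finally show "(\<Prod>t<k. ?l (permute_list \<sigma> K ! t) (permute_list \<sigma> K' ! t)) = (\<Prod>t<k. ?l (K ! t) (K' ! t))" .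
    qed
    finally show ?thesis .
  qed
  then have "trace_form k (d, j', x, [], K) = s (1 / fact k) (\<Sum>\<sigma> | \<sigma> permutes {..<k}.
      \<Sum>K'\<in>?S. s (\<Prod>t<k. ?l (K ! t) (K' ! t)) (word_trace c ?e j x (permute_list \<sigma> K')))"
    by (simp add: trace_form_def K)
  also have "\<dots> = (\<Sum>K'\<in>?S. s (\<Prod>t<k. ?l (K ! t) (K' ! t)) (trace_form k (c, j, x, [], K')))"
    by (subst sum.swap) (simp add: trace_form_def scale_sum_right mult.commute)
  finally show ?thesis .
qed

lemma alg_smooth_higgs_mat: "alg_smooth X c (frame_dom (ext_bundle E L 0) (e, j)) (\<lambda>x. higgs_mat c e j x g ab)"
  unfolding higgs_mat_def \<Theta>_def
  using open_fd[OF X E L] by (intro alg_smooth_sum[OF X] alg_smooth.base M_space_smooth[OF X E L u]) auto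

lemma open_frame_L: "open (frame_dom L j)" and open_frame_E: "open (frame_dom E e)"
  using E L by (auto simp: holomorphic_bundle_def)

lemma functional_trace_form_forms:
  assumes \<phi>: "functional \<phi>"
  shows "(\<lambda>i. \<phi> (trace_form k i)) \<in> sym_forms X L k 0"
proof -
  have nz: "x \<in> chart_dom X c \<and> x \<in> frame_dom L j \<and> J = [] \<and> length K = k \<and> set K \<subseteq> fibre L"
    if "\<phi> (trace_form k (c, j, x, J, K)) \<noteq> 0" for c j x J K
    using trace_form_nonzero[of c j x J K] that functional_zero[OF \<phi>] by metis
  have "(\<lambda>i. \<phi> (trace_form k i)) \<in> forms X (tensor_power k L) 0"
  proof (rule formsI)
    show "x \<in> chart_dom X c \<and> x \<in> frame_dom (tensor_power k L) i \<and> length J = 0 \<and> set J \<subseteq> coords X \<and>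
        f \<in> fibre (tensor_power k L)" if "\<phi> (trace_form k (c, i, x, J, f)) \<noteq> 0" for c i x J f
      using nz[OF that] by (simp add: tensor_power_def)
    show "alternating (\<lambda>J. \<phi> (trace_form k (c, i, x, J, f)))" for c i x f
      by (rule alternating_le1) (use nz in fastforce)
    show "chart_smooth X c (frame_dom (tensor_power k L) i) (\<lambda>x. \<phi> (trace_form k (c, i, x, J, f)))" for c i J f
    proof (cases "J = [] \<and> length f = k")
      case True
      have "chart_smooth X c (frame_dom L i) (\<lambda>x. \<phi> (trace_form k (c, i, x, J, f)))"
      \<comment> \<open>The frame of \<open>E\<close> selected in \<open>trace_form\<close> jumps
        from point to point. Near \<open>x\<close> it is replaced by the one selected at
        \<open>x\<close>, in which the coefficients are smooth.\<close>
      proof (rule chart_smooth_local[OF X])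
        fix x assume x: "x \<in> chart_dom X c" "x \<in> frame_dom L i"
        let ?e = "SOME e. x \<in> frame_dom E e"
        let ?U = "frame_dom (ext_bundle E L 0) (?e, i)"
        have U: "open ?U" by (rule open_fd[OF X E L])
        have "alg_smooth X c ?U (\<lambda>x. \<Sum>\<sigma> | \<sigma> permutes {..<k}. word_trace c ?e i x (permute_list \<sigma> f))"
          unfolding word_trace_def mat_trace_def
          by (intro alg_smooth_sum[OF X U] alg_smooth_mat_word[OF X U] alg_smooth_higgs_mat)
        from alg_smooth_functional[OF this \<phi> X U]
        have "chart_smooth X c ?U (\<lambda>x. 1 / fact k * \<phi> (\<Sum>\<sigma> | \<sigma> permutes {..<k}. word_trace c ?e i x (permute_list \<sigma> f)))"
          by (intro chart_smooth_mult[OF X U] chart_smooth_const[OF X U])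
        then have "chart_smooth X c ?U (\<lambda>x. \<phi> (trace_form k (c, i, x, J, f)))"
        proof (rule chart_smooth_cong[OF X U])
          fix y assume "y \<in> chart_dom X c" "y \<in> ?U"
          then have "in_dom c (?e, i) y" by (simp add: in_dom_def frame_dom_ext_bundle)
          then show "1 / fact k * \<phi> (\<Sum>\<sigma> | \<sigma> permutes {..<k}. word_trace c ?e i y (permute_list \<sigma> f)) = \<phi> (trace_form k (c, i, y, J, f))"
            using True by (simp only: trace_form_frame functional_scale[OF \<phi>])
        qed
        moreover have "frame_dom L i \<inter> frame_dom E ?e = ?U" by (auto simp: frame_dom_ext_bundle)
        ultimately show "\<exists>W. open W \<and> x \<in> W \<and> chart_smooth X c (frame_dom L i \<inter> W) (\<lambda>x. \<phi> (trace_form k (c, i, x, J, f)))"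
          using \<open>chart_smooth X c ?U (\<lambda>x. \<phi> (trace_form k (c, i, x, J, f)))\<close> frame_E open_frame_E
          by (intro exI[of _ "frame_dom E ?e"]) simp
      qed
      then show ?thesis by (simp add: tensor_power_def)
    next
      case False
      then have "(\<lambda>x. \<phi> (trace_form k (c, i, x, J, f))) = (\<lambda>_. 0)"
        by (auto simp: trace_form_def functional_zero[OF \<phi>])
      then show ?thesis using chart_smooth_const[OF X open_frame_L] by (simp add: tensor_power_def)
    qed
    fix c d i j x and J :: "'n list" and f
    assume *: "x \<in> chart_dom X c" "x \<in> chart_dom X d" "x \<in> frame_dom (tensor_power k L) i"
      "x \<in> frame_dom (tensor_power k L) j" "length J = 0" "set J \<subseteq> coords X" "f \<in> fibre (tensor_power k L)"
    have "\<phi> (trace_form k (d, j, x, [], f)) = (\<Sum>K'\<in>{K'. length K' = k \<and> set K' \<subseteq> fibre L}.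
        (\<Prod>t<k. transition L j i x (f ! t) (K' ! t)) * \<phi> (trace_form k (c, i, x, [], K')))"
      using * by (subst trace_form_transform[of x c d i j f])
        (auto simp: tensor_power_def functional_sum[OF \<phi>] functional_scale[OF \<phi>])
    then show "\<phi> (trace_form k (d, j, x, J, f)) =
       (\<Sum>J'\<in>{J'. length J' = 0 \<and> set J' \<subseteq> coords X}. \<Sum>f'\<in>fibre (tensor_power k L).
         (\<Prod>t<0. cnj (jacobian X c d x (J' ! t) (J ! t))) * transition (tensor_power k L) j i x f f' *
         \<phi> (trace_form k (c, i, x, J', f')))"
      unfolding sum_lists_0 using *(5) by (simp add: tensor_power_def)
  qed
  then show ?thesis
    by (simp add: sym_forms_def symmetric_def trace_form_permute)
qed

text \<open>The commutators with the (0,1)-part of \<open>\<Theta>\<close> do not contribute to the derivative of a trace,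
  and after symmetrization all positions of the derivative in a word are equivalent.\<close>

theorem h1_functional_curv:
  assumes \<phi>: "functional \<phi>"
    and words: "\<And>c i x J ab g K ba. \<phi> (curv (c, i, x, J, (ab, [g])) *
        mat_word (fibre E) (map (\<lambda>g ab. \<Theta> (c, i, x, [], (ab, [g]))) K) ba) =
      mat_word (fibre E) (map (\<lambda>g ab. \<theta> (c, i, x, [], (ab, [g]))) K) ba * \<phi> (curv (c, i, x, J, (ab, [g])))"
  shows "h1 E \<theta> k (\<lambda>i. \<phi> (curv i)) = dbar X (tensor_power k L) (\<lambda>i. \<phi> (trace_form k i))"
proof
  fix i :: "'c \<times> 'j \<times> 'x \<times> 'n list \<times> 'g list"
  obtain c j x J K where i: "i = (c, j, x, J, K)" by (metis surj_pair)
  let ?R = "fibre E" and ?e = "SOME e. x \<in> frame_dom E e"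
  let ?F = "\<lambda>g ab. curv (c, (?e, j), x, J, (ab, [g]))"
  define T where "T K = trace_word ?R ((\<lambda>ab. \<phi> (curv (c, (?e, j), x, J, (ab, [hd K])))) #
          map (\<lambda>g ab. \<theta> (c, (?e, j), x, [], (ab, [g]))) (tl K))" for K
  have h1: "h1 E \<theta> k (\<lambda>i. \<phi> (curv i)) i = (if length K = k then of_nat k * symmetrize T K else 0)"
    by (simp add: i h1_def Let_def T_def[abs_def])
  \<comment> \<open>Here \<open>words\<close> is used: behind a letter of the curvature the values
    of \<Theta> act as those of \<theta>, so the complex word in \<open>h1\<close> is the functional
    of a word over the algebra.\<close>
  have T: "T L = \<phi> (first_letter_trace ?R (higgs_mat c ?e j x) ?F L)" if len: "length L = k" for L
  proof -
    obtain g L' where L: "L = g # L'" using len k by (cases L) auto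
    have "T L = (\<Sum>a\<in>?R. \<Sum>m\<in>?R. \<phi> (?F g (a, m)) *
        mat_word ?R (map (\<lambda>g ab. \<theta> (c, (?e, j), x, [], (ab, [g]))) L') (m, a))"
      unfolding T_def L trace_word_mat_trace by (simp add: mat_trace_def mat_mult_def)
    also have "\<dots> = (\<Sum>a\<in>?R. \<Sum>m\<in>?R. \<phi> (?F g (a, m) * mat_word ?R (map (higgs_mat c ?e j x) L') (m, a)))"
      unfolding higgs_mat_def[abs_def] words by (simp add: mult.commute)
    also have "\<dots> = \<phi> (first_letter_trace ?R (higgs_mat c ?e j x) ?F L)"
      by (simp add: L mat_trace_def mat_mult_def functional_sum[OF \<phi>])
    finally show ?thesis .
  qed
  show "h1 E \<theta> k (\<lambda>i. \<phi> (curv i)) i = dbar X (tensor_power k L) (\<lambda>i. \<phi> (trace_form k i)) i"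
  proof (cases "length K = k \<and> length J = 1 \<and> x \<in> chart_dom X c \<and> x \<in> frame_dom L j \<and> set J \<subseteq> coords X")
    case False
    have "dbar X (tensor_power k L) (\<lambda>i. \<phi> (trace_form k i)) i = 0"
    proof (rule ccontr)
      assume nz: "\<not> ?thesis"
      have f: "(\<lambda>i. \<phi> (trace_form k i)) \<in> forms X (tensor_power k L) 0"
        using functional_trace_form_forms[OF \<phi>] by (simp add: sym_forms_def)
      from dbar_nonzero[OF f nz[unfolded i]] show False using False by (simp add: tensor_power_def)
    qed
    moreover have "h1 E \<theta> k (\<lambda>i. \<phi> (curv i)) i = 0"
    proof (cases "length K = k")
      case True
      have "(\<lambda>ab. \<phi> (curv (c, (?e, j), x, J, (ab, [g])))) = (\<lambda>_. 0)" for g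
      proof
        fix ab
        show "\<phi> (curv (c, (?e, j), x, J, (ab, [g]))) = 0"
        proof (rule ccontr)
          assume "\<not> ?thesis"
          then have "curv (c, (?e, j), x, J, ((fst ab, snd ab), [g])) \<noteq> 0"
            using functional_zero[OF \<phi>] by auto
          from curv_nonzero[OF this] show False using False True by (simp add: in_dom_def)
        qed
      qed
      then have "T L = 0" for L unfolding T_def trace_word_mat_trace by (simp add: mat_mult_zero mat_trace_def)
      then show ?thesis unfolding h1 by (simp add: symmetrize_def)
    qed (simp add: h1)
    ultimately show ?thesis by simp
  next
    case True
    then obtain p where p: "J = [p]" "p \<in> coords X" by (auto simp: length_Suc_conv)
    have K: "length K = k" using True by simp
    have x: "in_dom c (?e, j) x" using True frame_E by (simp add: in_dom_def)
    let ?d = "\<lambda>g ab. D c (?e, j) x p [] [g] ab"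
    let ?U = "frame_dom (ext_bundle E L 0) (?e, j)"
    have U: "open ?U" "x \<in> ?U" using open_fd[OF X E L] x by (auto simp: frame_dom_ext_bundle in_dom_def)
    have d: "?d g ab = ?F g ab - mat_comm ?R (\<lambda>ab. \<Theta> (c, (?e, j), x, [p], (ab, []))) (higgs_mat c ?e j x g) ab" for g ab
      using curv_components(2)[OF x p(2), of ab g] by (simp add: p(1) higgs_mat_def)
    have "dbar X (tensor_power k L) (\<lambda>i. \<phi> (trace_form k i)) i = chart_dbar X c p (\<lambda>x. \<phi> (trace_form k (c, j, x, [], K))) x"
      using True p by (simp add: i dbar_eq nths_Cons tensor_power_def)
    also have "\<dots> = chart_dbar X c p (\<lambda>x. \<phi> (s (1 / fact k)
        (\<Sum>\<sigma> | \<sigma> permutes {..<k}. word_trace c ?e j x (permute_list \<sigma> K)))) x"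
    proof (rule chart_dbar_cong[OF X U(1) _ U(2) p(2)])
      show "x \<in> chart_dom X c" using True by simp
      fix y assume "y \<in> chart_dom X c" "y \<in> ?U"
      then have "in_dom c (?e, j) y" by (simp add: in_dom_def frame_dom_ext_bundle)
      from trace_form_frame[OF this K] show "\<phi> (trace_form k (c, j, y, [], K)) =
        \<phi> (s (1 / fact k) (\<Sum>\<sigma> | \<sigma> permutes {..<k}. word_trace c ?e j y (permute_list \<sigma> K)))" by simp
    qed
    also have "\<dots> = \<phi> (s (1 / fact k) (\<Sum>\<sigma> | \<sigma> permutes {..<k}.
        mat_trace ?R (word_deriv ?R (higgs_mat c ?e j x) ?d (permute_list \<sigma> K))))"
    proof -
      have "alg_dbar X c p x (\<lambda>x. s (1 / fact k) (\<Sum>\<sigma> | \<sigma> permutes {..<k}. word_trace c ?e j x (permute_list \<sigma> K)))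
        (s (1 / fact k) (\<Sum>\<sigma> | \<sigma> permutes {..<k}. mat_trace ?R (word_deriv ?R (higgs_mat c ?e j x) ?d (permute_list \<sigma> K))))"
        unfolding word_trace_def mat_trace_def
        by (intro alg_dbar_scale alg_dbar_sum alg_dbar_mat_word X x_chart[OF x])
          (use alg_dbar_\<Theta>[OF x p(2)] in \<open>simp add: higgs_mat_def\<close>)
      from alg_dbar_functional[OF this \<phi> X x_chart[OF x]] show ?thesis by blast
    qed
    also have "\<dots> = 1 / fact k * (\<Sum>\<sigma> | \<sigma> permutes {..<k}. \<Sum>q<k. T (rotate q (permute_list \<sigma> K)))"
    proof -
      have "\<phi> (mat_trace ?R (word_deriv ?R (higgs_mat c ?e j x) ?d L)) = (\<Sum>q<k. T (rotate q L))" if "length L = k" for L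
        unfolding mat_trace_word_deriv_mat_comm[OF finite_E d] mat_trace_word_deriv[OF finite_E]
        using that by (simp add: functional_sum[OF \<phi>] T)
      then show ?thesis using K by (simp add: functional_scale[OF \<phi>] functional_sum[OF \<phi>])
    qed
    \<comment> \<open>Each of the \<open>k\<close> rotations contributes the same sum; this is the
      origin of the factor \<open>k\<close> in \<open>h1\<close>.\<close>
    also have "(\<Sum>\<sigma> | \<sigma> permutes {..<k}. \<Sum>q<k. T (rotate q (permute_list \<sigma> K))) =
        of_nat k * (\<Sum>\<sigma> | \<sigma> permutes {..<k}. T (permute_list \<sigma> K))"
      using sum_permute_list_rotate[where K = K and T = T] by (subst sum.swap) (simp add: K)
    finally show ?thesis unfolding h1 using K by (simp add: symmetrize_def)
  qed
qed

end

end

section \<open>Functionals and tensors\<close>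

context complex_algebra
begin

lemma functional_representation:
  assumes "independent B" "span B = UNIV"
  shows "functional (\<lambda>x. representation B x b)"
  unfolding functional_def using assms by (simp add: representation_add representation_scale)

text \<open>A nonzero difference extends to a basis, and its own coordinate functional does not
  vanish on it.\<close>

lemma functional_separates:
  assumes "\<And>\<phi>. functional \<phi> \<Longrightarrow> \<phi> x = \<phi> y"
  shows "x = y"
proof (rule ccontr)
  assume neq: "x \<noteq> y"
  then have ind: "independent {x - y}" by simp
  define B where "B = extend_basis {x - y}"
  have B: "independent B" "span B = UNIV" "x - y \<in> B"
    using independent_extend_basis[OF ind] span_extend_basis[OF ind] extend_basis_superset[OF ind]
    by (auto simp: B_def)
  let ?\<phi> = "\<lambda>z. representation B z (x - y)"
  have \<phi>: "functional ?\<phi>" by (rule functional_representation[OF B(1,2)])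
  have "?\<phi> (x - y) = 1" using representation_basis[OF B(1,3)] by simp
  moreover have "?\<phi> (x - y) = 0" using functional_diff[OF \<phi>] assms[OF \<phi>] by simp
  ultimately show False by simp
qed

text \<open>The values of \<open>f\<close> lie in the finite-dimensional space
  \<open>span W \<inter> J\<close>. A basis of it is extended to a basis of the whole algebra, so
  that the coordinate functionals are defined everywhere and can be applied inside products.\<close>

lemma dual_basis:
  assumes W: "finite W" and J: "subspace J" and f: "\<And>k. f k \<in> span W" "\<And>k. f k \<in> J"
  obtains m :: nat and b \<phi> where "\<And>t. t < m \<Longrightarrow> b t \<in> J" "\<And>t. functional (\<phi> t)"
    "\<And>k. f k = (\<Sum>t<m. s (\<phi> t (f k)) (b t))"
proof -
  obtain B where B: "B \<subseteq> span W \<inter> J" "independent B" "span W \<inter> J \<subseteq> span B"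
    using basis_exists[of "span W \<inter> J"] by metis
  have fin: "finite B" using independent_span_bound[OF W B(2)] B(1) by blast
  define B' where "B' = extend_basis B"
  have B': "independent B'" "span B' = UNIV" "B \<subseteq> B'"
    using independent_extend_basis[OF B(2)] span_extend_basis[OF B(2)] extend_basis_superset[OF B(2)]
    by (auto simp: B'_def)
  obtain b where b: "bij_betw b {0..<card B} B" using ex_bij_betw_nat_finite[OF fin] by blast
  show ?thesis
  proof
    show "b t \<in> J" if "t < card B" for t
      using b B(1) that by (auto simp: bij_betw_def)
    show "functional (\<lambda>x. representation B' x (b t))" for t
      by (rule functional_representation[OF B'(1,2)])
    fix k
    have fk: "f k \<in> span B" using f B(3) by blast
    have "(\<Sum>t<card B. s (representation B' (f k) (b t)) (b t)) = (\<Sum>x\<in>B. s (representation B' (f k) x) x)"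
      using sum.reindex_bij_betw[OF b, of "\<lambda>x. s (representation B' (f k) x) x"] by (simp add: atLeast0LessThan)
    also have "\<dots> = (\<Sum>x\<in>B. s (representation B (f k) x) x)"
      using representation_extend[OF B'(1) fk B'(3)] by simp
    also have "\<dots> = f k"
      by (rule sum_representation_eq[OF B(2) fk fin order_refl])
    finally show "f k = (\<Sum>t<card B. s (representation B' (f k) (b t)) (b t))" ..
  qed
qed

text \<open>Well-definedness of \<open>D \<otimes> id\<close>: by linearity, a functional applied to
  the right-hand side gives \<open>D\<close> of the functional applied to the tensor, which does not
  see the representation, and functionals separate points.\<close>

lemma tensor_map_eq:
  fixes D :: "('k \<Rightarrow> complex) \<Rightarrow> 'l \<Rightarrow> complex"
  assumes lin: "\<And>(n::nat) u c. (\<And>t. t < n \<Longrightarrow> u t \<in> U) \<Longrightarrow>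
      D (\<lambda>k. \<Sum>t<n. c t * u t k) = (\<lambda>l. \<Sum>t<n. c t * D (u t) l)"
    and u: "\<And>t. t < n \<Longrightarrow> u t \<in> U"
  shows "tensor_map s U D (tensor_sum s n u v) = tensor_sum s n (\<lambda>t. D (u t)) v"
  unfolding tensor_map_def
proof (rule the_equality)
  show "\<exists>n' u' v'. (\<forall>t<n'. u' t \<in> U) \<and> tensor_sum s n u v = tensor_sum s n' u' v' \<and>
      tensor_sum s n (\<lambda>t. D (u t)) v = tensor_sum s n' (\<lambda>t. D (u' t)) v'"
    using u by blast
next
  fix w assume "\<exists>n' u' v'. (\<forall>t<n'. u' t \<in> U) \<and> tensor_sum s n u v = tensor_sum s n' u' v' \<and>
      w = tensor_sum s n' (\<lambda>t. D (u' t)) v'"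
  then obtain n' u' v' where u': "\<And>t. t < n' \<Longrightarrow> u' t \<in> U" and eq: "tensor_sum s n u v = tensor_sum s n' u' v'"
    and w: "w = tensor_sum s n' (\<lambda>t. D (u' t)) v'" by blast
  have val: "\<phi> (tensor_sum s n (\<lambda>t. D (u t)) v l) = D (\<lambda>k. \<phi> (tensor_sum s n u v k)) l"
    if "functional \<phi>" "\<And>t. t < n \<Longrightarrow> u t \<in> U" for \<phi> n u v l
  proof -
    have "(\<lambda>k. \<phi> (tensor_sum s n u v k)) = (\<lambda>k. \<Sum>t<n. \<phi> (v t) * u t k)"
      using that(1) by (simp add: tensor_sum_def functional_sum functional_scale mult.commute)
    then show ?thesis
      using lin[of n u "\<lambda>t. \<phi> (v t)"] that
      by (simp add: tensor_sum_def functional_sum functional_scale mult.commute)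
  qed
  show "w = tensor_sum s n (\<lambda>t. D (u t)) v"
  proof
    fix l
    show "w l = tensor_sum s n (\<lambda>t. D (u t)) v l"
      by (rule functional_separates) (simp add: w val u u' eq)
  qed
qed

lemma mat_word_annihilator:
  assumes "\<And>g ab. y * Y g ab = s (T g ab) y"
  shows "y * mat_word R (map Y K) ab = s (mat_word R (map T K) ab) y"
proof (induction K arbitrary: ab)
  case Nil
  then show ?case by (cases ab) (simp add: mat_one_apply)
next
  case (Cons g K)
  obtain a b where ab: "ab = (a, b)" by (metis surj_pair)
  have "y * (Y g (a, m) * mat_word R (map Y K) (m, b)) = s (T g (a, m) * mat_word R (map T K) (m, b)) y" for m
    unfolding mult.assoc[symmetric] assms scale_mult Cons by simp
  then show ?case by (simp add: ab mat_mult_def sum_distrib_left scale_sum_left)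
qed

end

section \<open>The obstruction class\<close>

locale hitchin =
  fixes X :: "('c, 'x::t2_space, 'n::finite) manifold" and E :: "('i, 'x, 'f) vbundle"
    and L :: "('j, 'x, 'g) vbundle"
    and \<theta> :: "('c, 'i \<times> 'j, 'x, 'n, ('f \<times> 'f) \<times> 'g list) coeff_index \<Rightarrow> complex"
  assumes X: "complex_manifold X" and pair: "hitchin_pair X E L \<theta>"
begin

lemma E: "holomorphic_bundle X E" and L: "holomorphic_bundle X L" and \<theta>: "\<theta> \<in> ext_forms X E L 0 1"
  using pair by (simp_all add: hitchin_pair_def)

lemmas \<theta>_M1 = theta_M1[OF X E L \<theta>]

lemma M_dbar_theta: "M_dbar X E L \<theta> k = 0"
proof -
  obtain c i x J ab K where k: "k = (c, i, x, J, (ab, K))" by (metis surj_pair)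
  show ?thesis
  proof (cases "x \<in> chart_dom X c \<and> x \<in> frame_dom E (fst i) \<and> x \<in> frame_dom L (snd i) \<and> set J \<subseteq> coords X")
    case True
    have "chart_dbar X c (J ! t) (\<lambda>x. \<theta> (c, i, x, nths J (- {t}), (ab, K))) x = 0" if t: "t < length J" for t
    proof (cases "nths J (- {t}) = []")
      case eq: True
      let ?U = "frame_dom E (fst i) \<inter> frame_dom L (snd i)"
      have "hol_on (coords X) (chart X c ` (chart_dom X c \<inter> ?U)) (\<lambda>z. \<theta> (c, i, chart_inv X c z, [], (ab, K)))"
        using pair by (simp add: hitchin_pair_def Int_assoc[symmetric]) (metis prod.collapse)
      then have "chart_hol X c ?U (\<lambda>x. \<theta> (c, i, x, [], (ab, K)))"
        using hol_on_chart_hol[of X c ?U "\<lambda>x. \<theta> (c, i, x, [], (ab, K))"] by simp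
      moreover have "J ! t \<in> coords X" using True t by auto
      ultimately show ?thesis using True by (simp add: chart_hol_def eq)
    next
      case False
      then have "(\<lambda>x. \<theta> (c, i, x, nths J (- {t}), (ab, K))) = (\<lambda>_. 0)"
        using theta_support[OF \<theta>] by blast
      then show ?thesis by (simp add: chart_dbar_const)
    qed
    then show ?thesis by (simp add: k M_dbar_eq)
  qed (auto simp: k M_dbar_eq)
qed

text \<open>The integrability condition says that the components of \<theta> commute with each
  other. Together with holomorphy, the curvature of \<theta> itself vanishes.\<close>

lemma M_bracket_theta_theta: "M_bracket E \<theta> \<theta> k = 0"
proof -
  note deg = M_space_degree_one[OF \<theta>_M1]
  obtain c i x J ab K where k: "k = (c, i, x, J, (ab, K))" by (metis surj_pair)
  have zero: "(\<lambda>ab. \<theta> (c, i, x, [p], (ab, K))) = (\<lambda>_. 0)" for p K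
    using theta_support[OF \<theta>] by blast
  show ?thesis
  proof (cases "length J + length K = 2")
    case True
    then show ?thesis
    proof (cases rule: length_sum_2_cases)
      case (20 p q)
      then show ?thesis by (simp add: k M_bracket_components[OF deg deg] zero mat_comm_zero)
    next
      case (11 p g)
      then show ?thesis by (simp add: k M_bracket_components[OF deg deg] zero mat_comm_zero)
    next
      case (02 g h)
      obtain a b where ab: "ab = (a, b)" by (metis surj_pair)
      have t0: "\<theta> (c, i, x, [], (ab, K)) = 0" if "length K \<noteq> 1" for ab K
        using theta_support[OF \<theta>, of c i x "[]" ab K] that by auto
      have "end_wedge (fibre E) (\<lambda>f. \<theta> (c, i, x, [], f)) (\<lambda>f. \<theta> (c, i, x, [], f)) = (\<lambda>_. 0)"
        using pair unfolding hitchin_pair_def by blast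
      then have "end_wedge (fibre E) (\<lambda>f. \<theta> (c, i, x, [], f)) (\<lambda>f. \<theta> (c, i, x, [], f)) (ab, [g, h]) = 0"
        by (rule fun_cong)
      then have "mat_comm (fibre E) (\<lambda>ab. \<theta> (c, i, x, [], (ab, [g]))) (\<lambda>ab. \<theta> (c, i, x, [], (ab, [h]))) ab = 0"
        by (simp add: ab end_wedge_def mat_comm_def mat_mult_def sum_Pow_simps shuffle_sign_simps nths_Cons t0)
      then show ?thesis
        using mat_comm_anti[of "fibre E" "\<lambda>ab. \<theta> (c, i, x, [], (ab, [h]))" "\<lambda>ab. \<theta> (c, i, x, [], (ab, [g]))" ab]
        by (simp add: k 02 M_bracket_components[OF deg deg])
    qed
  qed (simp add: k M_bracket_degree_two[OF deg deg])
qed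

lemma M_diff_sum:
  fixes n :: nat
  assumes "\<And>t. t < n \<Longrightarrow> u t \<in> M_space X E L m"
  shows "M_diff X E L \<theta> (\<lambda>k. \<Sum>t<n. c t * u t k) = (\<lambda>l. \<Sum>t<n. c t * M_diff X E L \<theta> (u t) l)"
  using assms
proof (induction n)
  case 0
  have "M_diff X E L \<theta> (\<lambda>_. 0) k = 0" for k
    using M_diff_lin[OF X E L \<theta> M_space_zero[OF X E L] M_space_zero[OF X E L], where s = 1 and k = k] by simp
  then show ?case by auto
next
  case (Suc n)
  have 1: "(\<lambda>k. \<Sum>t<n. c t * u t k) \<in> M_space X E L m"
    using Suc.prems by (intro M_space_sum[OF X E L]) auto
  have "M_diff X E L \<theta> (\<lambda>k. c n * u n k + (\<Sum>t<n. c t * u t k)) =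
      (\<lambda>l. c n * M_diff X E L \<theta> (u n) l + (\<Sum>t<n. c t * M_diff X E L \<theta> (u t) l))"
    using M_diff_lin[OF X E L \<theta> Suc.prems[of n] 1] Suc by auto
  then show ?case by (simp add: add.commute)
qed

lemma sym_forms_lin:
  "\<omega> \<in> sym_forms X L k p \<Longrightarrow> \<eta> \<in> sym_forms X L k p \<Longrightarrow> (\<lambda>i. c * \<omega> i + \<eta> i) \<in> sym_forms X L k p"
  using forms_lin[OF X transition_hol_power[OF X transition_hol_bundle[OF X L]]]
  by (simp add: sym_forms_def symmetric_def)

lemma sym_forms_zero: "(\<lambda>_. 0) \<in> sym_forms X L k p"
  using forms_zero[OF X transition_hol_power[OF X transition_hol_bundle[OF X L]]]
  by (simp add: sym_forms_def symmetric_def)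

lemma sym_B1_lin:
  assumes "\<alpha> \<in> sym_B1 X L k" "\<beta> \<in> sym_B1 X L k"
  shows "(\<lambda>i. c * \<alpha> i + \<beta> i) \<in> sym_B1 X L k"
proof -
  obtain \<omega> \<eta> where *: "\<omega> \<in> sym_forms X L k 0" "\<eta> \<in> sym_forms X L k 0"
    "\<alpha> = dbar X (tensor_power k L) \<omega>" "\<beta> = dbar X (tensor_power k L) \<eta>"
    using assms by (auto simp: sym_B1_def)
  have "\<omega> \<in> forms X (tensor_power k L) 0" "\<eta> \<in> forms X (tensor_power k L) 0"
    using * by (auto simp: sym_forms_def)
  from dbar_lin[OF X transition_hol_power[OF X transition_hol_bundle[OF X L]] this, of c]
  have "(\<lambda>i. c * \<alpha> i + \<beta> i) = dbar X (tensor_power k L) (\<lambda>i. c * \<omega> i + \<eta> i)"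
    by (simp add: *)
  then show ?thesis unfolding sym_B1_def using sym_forms_lin[OF *(1,2)] by blast
qed

lemma h1_add: "h1 E \<theta> k (\<lambda>i. z i + w i) = (\<lambda>i. h1 E \<theta> k z i + h1 E \<theta> k w i)"
proof
  fix i :: "'c \<times> 'j \<times> 'x \<times> 'n list \<times> 'g list"
  obtain c j x J K where i: "i = (c, j, x, J, K)" by (metis surj_pair)
  show "h1 E \<theta> k (\<lambda>i. z i + w i) i = h1 E \<theta> k z i + h1 E \<theta> k w i"
    unfolding i h1_def
    by (simp add: Let_def symmetrize_def trace_word_mat_trace mat_mult_lin mat_trace_add sum.distrib add_divide_distrib distrib_left)
qed

text \<open>First order deformations: over the polynomial ring, the coefficient of the variable in the
  curvature of \<open>\<theta> + T w\<close> is \<open>M_diff w\<close>.\<close>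

lemma h1_M_diff:
  assumes w: "w \<in> M_space X E L 1" and k: "k \<ge> 1"
  shows "h1 E \<theta> k (M_diff X E L \<theta> w) \<in> sym_B1 X L k"
proof -
  define u where "u t = (if t = 0 then \<theta> else w)" for t :: nat
  define v :: "nat \<Rightarrow> complex poly" where "v t = (if t = 0 then 1 else [:0, 1:])" for t
  interpret curvature "smult :: complex \<Rightarrow> complex poly \<Rightarrow> complex poly" X E L \<theta> 2 u v
  proof
    show "u t \<in> M_space X E L 1" for t using w \<theta>_M1 by (simp add: u_def)
  qed (use \<theta> in \<open>auto simp: smult_add_right smult_add_left X E L\<close>)
  define \<phi> where "\<phi> p = coeff p 1" for p :: "complex poly"
  have \<phi>: "functional \<phi>" by (simp add: functional_def \<phi>_def)
  have sum2: "(\<Sum>t<2. f t) = f 0 + f (Suc 0)" for f :: "nat \<Rightarrow> 'z::comm_monoid_add"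
    by (simp add: lessThan_2)
  have sym: "M_bracket E w \<theta> i = M_bracket E \<theta> w i" for i
    by (rule M_bracket_sym[OF M_space_degree_one[OF w] M_space_degree_one[OF \<theta>_M1]])
  \<comment> \<open>The constant coefficient is the curvature of \<theta>, hence zero; in the linear
    one the two equal mixed brackets cancel the factor 1/2.\<close>
  have curv: "curv i = [:0, M_diff X E L \<theta> w i, 1 / 2 * M_bracket E w w i:]" for i
    unfolding curv_expand
    by (simp add: sum2 u_def v_def M_dbar_theta M_bracket_theta_theta sym M_diff_eq[OF \<theta>])
  have \<phi>_curv: "(\<lambda>i. \<phi> (curv i)) = M_diff X E L \<theta> w"
    by (simp add: curv \<phi>_def)
  have "h1 E \<theta> k (\<lambda>i. \<phi> (curv i)) = dbar X (tensor_power k L) (\<lambda>i. \<phi> (trace_form k i))"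
  proof (rule h1_functional_curv[OF k \<phi>])
    fix c i x J ab g K ba
    \<comment> \<open>Taking the constant coefficient is a ring homomorphism, so it sends words in
      \<Theta> to words in \<theta>.\<close>
    have hom: "coeff (mat_word (fibre E) (map Y K) ba) 0 = mat_word (fibre E) (map (\<lambda>g ab. coeff (Y g ab) 0) K) ba"
      for Y :: "'g \<Rightarrow> 'f \<times> 'f \<Rightarrow> complex poly" and ba
    proof (induction K arbitrary: ba)
      case Nil
      then show ?case by (cases ba) (simp add: mat_one_apply)
    next
      case (Cons g K)
      obtain a b where "ba = (a, b)" by (metis surj_pair)
      then show ?case by (simp add: mat_mult_def coeff_sum coeff_mult Cons)
    qed
    have "coeff (\<Theta> i) 0 = \<theta> i" for i by (simp add: \<Theta>_def sum2 u_def v_def)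
    then have W: "coeff (mat_word (fibre E) (map (\<lambda>g ab. \<Theta> (c, i, x, [], (ab, [g]))) K) ba) 0 =
        mat_word (fibre E) (map (\<lambda>g ab. \<theta> (c, i, x, [], (ab, [g]))) K) ba"
      by (simp add: hom)
    \<comment> \<open>The variable does not annihilate the curvature here, but the curvature has
      constant coefficient zero, so the linear coefficient of a product sees only the constant
      coefficient of the word. This is why \<open>words\<close> in \<open>h1_functional_curv\<close>
      is a condition after applying \<phi>.\<close>
    have "coeff (p * q) 1 = coeff p 0 * coeff q 1 + coeff p 1 * coeff q 0" for p q :: "complex poly"
      by (simp add: coeff_mult)
    then show "\<phi> (curv (c, i, x, J, (ab, [g])) *
        mat_word (fibre E) (map (\<lambda>g ab. \<Theta> (c, i, x, [], (ab, [g]))) K) ba) =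
      mat_word (fibre E) (map (\<lambda>g ab. \<theta> (c, i, x, [], (ab, [g]))) K) ba * \<phi> (curv (c, i, x, J, (ab, [g])))"
      by (simp add: \<phi>_def W curv)
  qed
  then show ?thesis
    unfolding \<phi>_curv sym_B1_def using functional_trace_form_forms[OF k \<phi>] by blast
qed

lemma coset_zero: "coset B (\<lambda>_. 0) = (B :: ('k \<Rightarrow> complex) set)"
  by (simp add: coset_def)

text \<open>As \<open>H2_h1\<close> is a definite description, two things are shown: the zero class
  contains the images of all representatives, because \<open>h1\<close> maps coboundaries to
  coboundaries, and it is the only class that does.\<close>

lemma in_kernel:
  assumes z: "z \<in> Z2 X E L \<theta>" and h1: "\<And>k. k \<ge> 1 \<Longrightarrow> h1 E \<theta> k z \<in> sym_B1 X L k"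
  shows "coset (B2 X E L \<theta>) z \<in> ker_H2_h1 X E L \<theta> r"
proof -
  let ?C = "coset (B2 X E L \<theta>) z"
  have "H2_h1 X E L \<theta> k ?C = coset (sym_B1 X L k) (\<lambda>_. 0)" if "k \<in> {1..r}" for k
  proof -
    let ?B = "sym_B1 X L k"
    have k: "k \<ge> 1" using that by simp
    have h: "h1 E \<theta> k w \<in> ?B" if w: "w \<in> ?C" for w
    proof -
      obtain y where y: "y \<in> M_space X E L 1" "(\<lambda>i. w i - z i) = M_diff X E L \<theta> y"
        using w unfolding coset_def B2_def by blast
      have "w = (\<lambda>i. M_diff X E L \<theta> y i + z i)"
        unfolding y(2)[symmetric] by simp
      then have "h1 E \<theta> k w = (\<lambda>i. 1 * h1 E \<theta> k (M_diff X E L \<theta> y) i + h1 E \<theta> k z i)"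
        by (simp add: h1_add)
      then show ?thesis using sym_B1_lin[OF h1_M_diff[OF y(1) k] h1[OF k], of 1] by simp
    qed
    have zC: "z \<in> ?C"
    proof -
      have "M_diff X E L \<theta> (\<lambda>_. 0) = (\<lambda>_. 0)"
        using M_diff_sum[of 0] by simp
      then have "(\<lambda>_. 0) \<in> B2 X E L \<theta>"
        unfolding B2_def using image_eqI[OF _ M_space_zero[OF X E L]] by metis
      then show ?thesis by (simp add: coset_def)
    qed
    show ?thesis
      unfolding H2_h1_def
    proof (rule the_equality)
      have "dbar X (tensor_power k L) (\<lambda>_. 0) = (\<lambda>_. 0)"
        by (auto simp: dbar_eq chart_dbar_const)
      then show "coset ?B (\<lambda>_. 0) \<in> sym_H1 X L k \<and> (\<forall>w\<in>?C. h1 E \<theta> k w \<in> coset ?B (\<lambda>_. 0))"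
        using h sym_forms_zero by (auto simp: sym_H1_def coset_zero[of ?B] intro!: image_eqI[of _ _ "\<lambda>_. 0"])
      \<comment> \<open>Any competing class also contains \<open>h1 E \<theta> k z\<close>, so its
        representative \<eta> is exact and the two cosets agree.\<close>
      fix D assume D: "D \<in> sym_H1 X L k \<and> (\<forall>w\<in>?C. h1 E \<theta> k w \<in> D)"
      then obtain \<eta> where \<eta>: "D = coset ?B \<eta>" by (auto simp: sym_H1_def)
      then have "(\<lambda>i. h1 E \<theta> k z i - \<eta> i) \<in> ?B" using D zC by (auto simp: coset_def)
      from sym_B1_lin[OF this h[OF zC], of "-1"] have \<eta>B: "\<eta> \<in> ?B" by simp
      have "w \<in> coset ?B \<eta> \<longleftrightarrow> w \<in> ?B" for w
      proof
        assume "w \<in> coset ?B \<eta>"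
        then have "(\<lambda>i. w i - \<eta> i) \<in> ?B" by (simp add: coset_def)
        from sym_B1_lin[OF this \<eta>B, of 1] show "w \<in> ?B" by simp
      next
        assume "w \<in> ?B"
        from sym_B1_lin[OF \<eta>B this, of "-1"] show "w \<in> coset ?B \<eta>" by (simp add: coset_def)
      qed
      then show "D = coset ?B (\<lambda>_. 0)" unfolding \<eta> coset_zero[of ?B] by blast
    qed
  qed
  then show ?thesis using z by (auto simp: ker_H2_h1_def HH2_def)
qed

lemma mc_expr_tensor_sum:
  assumes "complex_algebra s" and u: "\<And>t. t < n \<Longrightarrow> u t \<in> M_space X E L 1"
  shows "mc_expr X E L \<theta> s (tensor_sum s n u v) k = (\<Sum>t<n. s (M_diff X E L \<theta> (u t) k) (v t)) +
    s (1 / 2) (\<Sum>t<n. \<Sum>t'<n. s (M_bracket E (u t) (u t') k) (v t * v t'))"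
proof -
  interpret complex_algebra s by fact
  have "M_bracket E (tensor_sum s n u v) (tensor_sum s n u v) k =
      (\<Sum>t<n. \<Sum>t'<n. s (M_bracket E (u t) (u t') k) (v t * v t'))"
    unfolding tensor_sum_def M_bracket_sum_left M_bracket_sum_right M_bracket_scale ..
  moreover have "tensor_map s (M_space X E L 1) (M_diff X E L \<theta>) (tensor_sum s n u v) =
      tensor_sum s n (\<lambda>t. M_diff X E L \<theta> (u t)) v"
  proof (rule tensor_map_eq)
    show "M_diff X E L \<theta> (\<lambda>k. \<Sum>t<n. c t * u t k) = (\<lambda>l. \<Sum>t<n. c t * M_diff X E L \<theta> (u t) l)"
      if "\<And>t. t < n \<Longrightarrow> u t \<in> M_space X E L 1" for n :: nat and u c
      by (rule M_diff_sum) (rule that)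
  qed (rule u)
  ultimately show ?thesis by (simp add: mc_expr_def tensor_sum_def)
qed

text \<open>\<theta> is appended to the tensor representation of \<open>z\<close> as a summand with
  coefficient \<open>1\<close>. Its own curvature is zero, and the two mixed brackets, halved,
  supply the bracket with \<theta> that turns dbar into \<open>M_diff\<close>.\<close>

lemma mc_expr_curv:
  assumes s: "complex_algebra s" and u_M1: "\<And>t. t < n \<Longrightarrow> u t \<in> M_space X E L 1"
  shows "curvature.curv s X E L (Suc n) (\<lambda>t. if t < n then u t else \<theta>) (\<lambda>t. if t < n then v t else 1) =
    mc_expr X E L \<theta> s (tensor_sum s n u v)"
proof
  fix k
  let ?u = "\<lambda>t. if t < n then u t else \<theta>" and ?v = "\<lambda>t. if t < n then v t else 1"
  interpret complex_algebra s by fact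
  interpret curvature s X E L \<theta> "Suc n" ?u ?v
  proof
    show "?u t \<in> M_space X E L 1" for t using u_M1 \<theta>_M1 by simp
  qed (rule X E L \<theta>)+
  have sym: "M_bracket E (u t) \<theta> k = M_bracket E \<theta> (u t) k" if "t < n" for t
    by (rule M_bracket_sym[OF M_space_degree_one[OF u_M1[OF that]] M_space_degree_one[OF \<theta>_M1]])
  let ?S = "\<Sum>t<n. \<Sum>t'<n. s (M_bracket E (u t) (u t') k) (v t * v t')"
  let ?T = "\<Sum>t<n. s (M_bracket E \<theta> (u t) k) (v t)"
  \<comment> \<open>The doubled mixed term is written as a difference in order to match
    \<open>half_double\<close>.\<close>
  have "M_bracket E \<Theta> \<Theta> k = ?S + (?T - (- ?T))"
    unfolding M_bracket_\<Theta> by (simp add: M_bracket_theta_theta sum.distrib sym)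
  then have "s (1 / 2) (M_bracket E \<Theta> \<Theta> k) = s (1 / 2) ?S + ?T"
    by (simp only: scale_right_distrib half_double)
  moreover have "(\<Sum>t<n. s (M_diff X E L \<theta> (u t) k) (v t)) = (\<Sum>t<n. s (M_dbar X E L (u t) k) (v t)) + ?T"
    by (simp add: M_diff_eq[OF \<theta>] scale_left_distrib sum.distrib)
  ultimately show "curv k = mc_expr X E L \<theta> s (tensor_sum s n u v) k"
    using mc_expr_tensor_sum[where s = s and n = n and u = u and v = v and k = k, OF s u_M1] by (simp add: curv_def M_dbar_theta)
qed

end

lemma small_extension_algebras:
  assumes "small_extension sB sA \<pi>"
  shows "complex_algebra sB" "complex_algebra sA"
  using assms
  by (auto simp: small_extension_def local_artinian_algebra_def complex_algebra_def complex_algebra_axioms_def)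

theorem corollary7p9:
  fixes X :: "('c, 'x::t2_space, 'n::finite) manifold"
    and E :: "('i, 'x, 'f) vbundle"
    and L :: "('j, 'x, 'g) vbundle"
    and \<theta> :: "('c, 'i \<times> 'j, 'x, 'n, ('f \<times> 'f) \<times> 'g list) coeff_index \<Rightarrow> complex"
    and r :: nat
    and sB :: "complex \<Rightarrow> 'b::comm_ring_1 \<Rightarrow> 'b"
    and sA :: "complex \<Rightarrow> 'a::comm_ring_1 \<Rightarrow> 'a"
    and \<pi> :: "'b \<Rightarrow> 'a"
    and z :: "('c, 'i \<times> 'j, 'x, 'n, ('f \<times> 'f) \<times> 'g list) coeff_index \<Rightarrow> 'a"
    and z' :: "('c, 'i \<times> 'j, 'x, 'n, ('f \<times> 'f) \<times> 'g list) coeff_index \<Rightarrow> 'b"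
  assumes "compact_complex_manifold X"
    and "hitchin_pair X E L \<theta>"
    and "card (fibre E) = r"
    and "small_extension sB sA \<pi>"
    and "z \<in> MC X E L \<theta> sA"
    and "z' \<in> tensor sB (M_space X E L 1) max_ideal"
    and "\<pi> \<circ> z' = z"
  shows "obstruction_class X E L \<theta> sB (ext_kernel \<pi>) z'
           \<in> HH2_tensor X E L \<theta> sB (ker_H2_h1 X E L \<theta> r) (ext_kernel \<pi>)"
proof -
  interpret hitchin X E L \<theta>
    using assms(1,2) by unfold_locales (auto simp: compact_complex_manifold_def)
  note algebras = small_extension_algebras[OF assms(4)]
  interpret B: complex_algebra sB by (rule algebras(1))
  have \<pi>: "\<pi> (x + y) = \<pi> x + \<pi> y" "\<pi> (x * y) = \<pi> x * \<pi> y" "\<pi> (sB a x) = sA a (\<pi> x)" for x y a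
    using assms(4) by (auto simp: small_extension_def)
  have small: "x * y = 0" if "x \<in> max_ideal" "y \<in> ext_kernel \<pi>" for x y
    using assms(4) that by (auto simp: small_extension_def)
  have \<pi>0: "\<pi> 0 = 0" using \<pi>(1)[of 0 0] by simp
  have \<pi>_sum: "\<pi> (\<Sum>t\<in>I. f t) = (\<Sum>t\<in>I. \<pi> (f t))" for f :: "nat \<Rightarrow> 'b" and I
    by (induction I rule: infinite_finite_induct) (auto simp: \<pi>0 \<pi>(1))
  obtain n u v where z': "z' = tensor_sum sB n u v"
    and uv: "\<And>t. t < n \<Longrightarrow> u t \<in> M_space X E L 1" "\<And>t. t < n \<Longrightarrow> v t \<in> max_ideal"
    using assms(6) by (auto simp: tensor_def)
  define f where "f = mc_expr X E L \<theta> sB z'"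
  have z: "z = tensor_sum sA n u (\<lambda>t. \<pi> (v t))"
    unfolding assms(7)[symmetric] z' by (auto simp: tensor_sum_def \<pi>_sum \<pi>(3))
  have f_eq: "f k = (\<Sum>t<n. sB (M_diff X E L \<theta> (u t) k) (v t)) +
      sB (1 / 2) (\<Sum>t<n. \<Sum>t'<n. sB (M_bracket E (u t) (u t') k) (v t * v t'))" for k
    unfolding f_def z' by (rule mc_expr_tensor_sum[OF algebras(1)]) (rule uv(1))
  have "mc_expr X E L \<theta> sA z k = (\<Sum>t<n. sA (M_diff X E L \<theta> (u t) k) (\<pi> (v t))) +
      sA (1 / 2) (\<Sum>t<n. \<Sum>t'<n. sA (M_bracket E (u t) (u t') k) (\<pi> (v t) * \<pi> (v t')))" for k
    unfolding z by (rule mc_expr_tensor_sum[OF algebras(2)]) (rule uv(1))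
  \<comment> \<open>Since \<pi> is an algebra homomorphism, it carries the Maurer-Cartan expression
    of the lift to that of \<open>z\<close>, which is zero; so the obstruction takes values in the
    kernel.\<close>
  then have "\<pi> (f k) = mc_expr X E L \<theta> sA z k" for k
    by (simp add: f_eq \<pi> \<pi>_sum)
  then have f_ker: "f k \<in> ext_kernel \<pi>" for k
    using assms(5) by (simp add: MC_def ext_kernel_def)
  let ?u = "\<lambda>t. if t < n then u t else \<theta>" and ?v = "\<lambda>t. if t < n then v t else 1"
  interpret C: curvature sB X E L \<theta> "Suc n" ?u ?v
  proof
    show "?u t \<in> M_space X E L 1" for t using uv(1) \<theta>_M1 by simp
  qed (rule X E L \<theta>)+
  have curv: "C.curv = f"
    unfolding f_def z' by (rule mc_expr_curv[OF algebras(1)]) (rule uv(1))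
  \<comment> \<open>Products of \<open>f\<close> with the summands of the lift vanish, because their
    coefficients \<open>v t\<close> lie in the maximal ideal; only the summand \<theta> with
    coefficient \<open>1\<close> is left.\<close>
  have ann: "f k * C.\<Theta> k' = sB (\<theta> k') (f k)" for k k'
  proof -
    have "f k * v t = 0" if "t < n" for t
      using small[OF uv(2)[OF that] f_ker] by (simp add: mult.commute)
    then have "f k * (\<Sum>t<n. sB (u t k') (v t)) = 0"
      by (simp add: sum_distrib_left B.scale_mult_right)
    then show ?thesis by (simp add: C.\<Theta>_def distrib_left B.scale_mult_right)
  qed
  have good: "(\<lambda>k. \<phi> (f k)) \<in> {z \<in> Z2 X E L \<theta>. coset (B2 X E L \<theta>) z \<in> ker_H2_h1 X E L \<theta> r}"
    if \<phi>: "B.functional \<phi>" for \<phi>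
  proof -
    have Z: "(\<lambda>k. \<phi> (f k)) \<in> Z2 X E L \<theta>"
      using C.functional_curv_Z2[OF _ \<phi>] ann by (simp add: curv)
    have "h1 E \<theta> k (\<lambda>i. \<phi> (f i)) \<in> sym_B1 X L k" if k: "k \<ge> 1" for k
    proof -
      have "h1 E \<theta> k (\<lambda>i. \<phi> (C.curv i)) = dbar X (tensor_power k L) (\<lambda>i. \<phi> (C.trace_form k i))"
        by (rule C.h1_functional_curv[OF k \<phi>])
          (simp add: curv B.mat_word_annihilator[OF ann] B.functional_scale[OF \<phi>])
      then show ?thesis
        unfolding curv sym_B1_def using C.functional_trace_form_forms[OF k \<phi>] by blast
    qed
    then show ?thesis using Z in_kernel by simp
  qed
  \<comment> \<open>The linear part of the expression has coefficients \<open>v t\<close> and the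
    bracket has coefficients \<open>v t * v t'\<close>, so these finitely many elements span all
    values of \<open>f\<close>.\<close>
  define W where "W = v ` {..<n} \<union> (\<lambda>(t, t'). v t * v t') ` ({..<n} \<times> {..<n})"
  have fin: "finite W" by (simp add: W_def)
  have sub: "B.subspace (ext_kernel \<pi>)"
  proof -
    have "sA c 0 = 0" for c using \<pi>(3)[of c 0] \<pi>0 by simp
    then show ?thesis by (auto simp: B.subspace_def ext_kernel_def \<pi> \<pi>0)
  qed
  have span: "f k \<in> B.span W" for k
    unfolding f_eq
    by (intro B.span_add B.span_sum B.span_scale B.span_base) (auto simp: W_def)
  show ?thesis
  proof (rule B.dual_basis[OF fin sub span f_ker])
    fix m :: nat and b \<phi>
    assume b: "\<And>t. t < m \<Longrightarrow> b t \<in> ext_kernel \<pi>" and \<phi>: "\<And>t. B.functional (\<phi> t)"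
      and f: "\<And>k. f k = (\<Sum>t<m. sB (\<phi> t (f k)) (b t))"
    \<comment> \<open>The coordinate functionals write \<open>f\<close> as a tensor whose complex
      factors are good cocycles and whose other factors lie in the kernel of \<pi>; thus
      \<open>f\<close> itself represents the class in the required subspace.\<close>
    have "f = tensor_sum sB m (\<lambda>t k. \<phi> t (f k)) b"
      unfolding tensor_sum_def by (rule ext) (rule f)
    moreover have "\<forall>t<m. (\<lambda>k. \<phi> t (f k)) \<in> {z \<in> Z2 X E L \<theta>. coset (B2 X E L \<theta>) z \<in> ker_H2_h1 X E L \<theta> r} \<and>
        b t \<in> ext_kernel \<pi>"
      using good[OF \<phi>] b by blast
    ultimately have "f \<in> tensor sB {z \<in> Z2 X E L \<theta>. coset (B2 X E L \<theta>) z \<in> ker_H2_h1 X E L \<theta> r} (ext_kernel \<pi>)"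
      unfolding tensor_def by blast
    then show ?thesis
      unfolding obstruction_class_def HH2_tensor_def f_def by blast
  qed
qed

end
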